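(* For every $d\ge 1$, $\mathcal{W}_1(d)=\mathcal{K}_1(d)$; that is, a connected $d$-dimensional simplicial complex has all vertex-links $1$-stellated $(d-1)$-spheres if and only if it has all vertex-links $1$-stacked homology $(d-1)$-spheres.
   Context: Simplicial complexes are finite and contain the empty set as a face. For a finite set $\alpha$, $\overline{\alpha}$ is the complex of all subsets of $\alpha$, $\partial\alpha$ the complex of all proper subsets, and $\dim(\alpha)=\#(\alpha)-1$; $\ast$ denotes join. The standard sphere $S^d_{d+2}$ is the boundary complex of a $(d+1)$-simplex. Bistellar moves: let $X$ be $d$-dimensional and $\alpha,\beta$ disjoint non-empty finite sets with $\dim(\alpha)+\dim(\beta)=d$ such that the induced subcomplex of $X$ on $\alpha\sqcup\beta$ is $\overline{\alpha}\ast\partial\beta$ (if $\beta$ is a single vertex this means $\beta$ is a new vertex not in $X$). The complex $(X\setminus(\overline{\alpha}\ast\partial\beta))\cup(\partial\alpha\ast\overline{\beta})$ is obtained from $X$ by the bistellar move $\alpha\mapsto\beta$, of index $\dim(\beta)$. For $0\le k\le d+1$, a $d$-dimensional complex is a $k$-stellated $d$-sphere if it is obtained from $S^d_{d+2}$ by a finite (possibly empty) sequence of bistellar moves each of index $<k$. A homology sphere/ball means an $\mathbb{F}$-homology sphere/ball for some field $\mathbb{F}$. An $\mathbb{F}$-homology $d$-sphere is a $d$-dimensional complex in which the link of every face $\sigma$ (including $\emptyset$) has the reduced $\mathbb{F}$-homology of a $(d-\dim(\sigma)-1)$-sphere. An $\mathbb{F}$-homology $d$-ball is a $d$-dimensional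 $\mathbb{F}$-acyclic complex in which the link of every non-empty face $\sigma$ has the reduced homology of a $(d-\dim(\sigma)-1)$-sphere or of a point, and whose faces with acyclic link form an $\mathbb{F}$-homology $(d-1)$-sphere (its boundary). A homology $(d+1)$-ball is $k$-stacked if all its faces of codimension at least $k+1$ (dimension $\le d-k$) lie in its boundary; a homology $d$-sphere is $k$-stacked if it is the boundary of a $k$-stacked homology $(d+1)$-ball. $\mathcal{W}_k(d)$ (resp. $\mathcal{K}_k(d)$), $0\le k\le d$, is the class of connected $d$-dimensional simplicial complexes all of whose vertex-links are $k$-stellated $(d-1)$-spheres (resp. $k$-stacked homology $(d-1)$-spheres). *)

theory Defs
  imports
    "HOL-Algebra.AbelCoset"
    "HOL-Algebra.Module"
    "HOL-Library.Infinite_Typeclass"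
begin

section \<open>Simplicial complexes\<close>

text \<open>
  A complex is the set of its faces; dimensions are integers, since the empty face has dimension -1.
\<close>

definition simplicial_complex :: "'a set set \<Rightarrow> bool" where
  "simplicial_complex X \<longleftrightarrow>
     finite (\<Union>X) \<and> {} \<in> X \<and> (\<forall>\<sigma>\<in>X. \<forall>\<tau>. \<tau> \<subseteq> \<sigma> \<longrightarrow> \<tau> \<in> X)"

definition face_dim :: "'a set \<Rightarrow> int" where
  "face_dim \<sigma> = int (card \<sigma>) - 1"

definition complex_dim :: "'a set set \<Rightarrow> int" where
  "complex_dim X = Max (face_dim ` X)"

definition complex_of_dim :: "int \<Rightarrow> 'a set set \<Rightarrow> bool" where
  "complex_of_dim d X \<longleftrightarrow> simplicial_complex X \<and> complex_dim X = d"

abbreviation vertices :: "'a set set \<Rightarrow> 'a set" where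
  "vertices X \<equiv> \<Union>X"

definition full_complex :: "'a set \<Rightarrow> 'a set set" where
  "full_complex \<alpha> = {\<sigma>. \<sigma> \<subseteq> \<alpha>}"

definition boundary_complex :: "'a set \<Rightarrow> 'a set set" where
  "boundary_complex \<alpha> = {\<sigma>. \<sigma> \<subset> \<alpha>}"

definition join :: "'a set set \<Rightarrow> 'a set set \<Rightarrow> 'a set set" where
  "join X Y = {\<sigma> \<union> \<tau> | \<sigma> \<tau>. \<sigma> \<in> X \<and> \<tau> \<in> Y}"

definition induced_subcomplex :: "'a set set \<Rightarrow> 'a set \<Rightarrow> 'a set set" where
  "induced_subcomplex X U = {\<sigma> \<in> X. \<sigma> \<subseteq> U}"

definition link :: "'a set set \<Rightarrow> 'a set \<Rightarrow> 'a set set" where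
  "link X \<sigma> = {\<tau>. \<tau> \<inter> \<sigma> = {} \<and> \<tau> \<union> \<sigma> \<in> X}"

definition connected_complex :: "'a set set \<Rightarrow> bool" where
  "connected_complex X \<longleftrightarrow>
     (\<forall>u\<in>vertices X. \<forall>v\<in>vertices X. (u, v) \<in> {(x, y). {x, y} \<in> X}\<^sup>*)"


section \<open>Bistellar moves and stellated spheres\<close>

definition bistellar_admissible :: "int \<Rightarrow> 'a set set \<Rightarrow> 'a set \<Rightarrow> 'a set \<Rightarrow> bool" where
  "bistellar_admissible d X \<alpha> \<beta> \<longleftrightarrow>
     complex_of_dim d X \<and>
     finite \<alpha> \<and> finite \<beta> \<and> \<alpha> \<noteq> {} \<and> \<beta> \<noteq> {} \<and> \<alpha> \<inter> \<beta> = {} \<and>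
     face_dim \<alpha> + face_dim \<beta> = d \<and>
     induced_subcomplex X (\<alpha> \<union> \<beta>) = join (full_complex \<alpha>) (boundary_complex \<beta>)"

definition bistellar_move :: "'a set set \<Rightarrow> 'a set \<Rightarrow> 'a set \<Rightarrow> 'a set set" where
  "bistellar_move X \<alpha> \<beta> =
     (X - join (full_complex \<alpha>) (boundary_complex \<beta>))
       \<union> join (boundary_complex \<alpha>) (full_complex \<beta>)"

inductive stellated_sphere :: "nat \<Rightarrow> int \<Rightarrow> 'a set set \<Rightarrow> bool" for k :: nat and d :: int where
  standard_sphere:
    "finite V \<Longrightarrow> int (card V) = d + 2 \<Longrightarrow> stellated_sphere k d (boundary_complex V)"
| bistellar_step:
    "stellated_sphere k d X \<Longrightarrow> bistellar_admissible d X \<alpha> \<beta> \<Longrightarrow> face_dim \<beta> < int k \<Longrightarrow>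
     stellated_sphere k d (bistellar_move X \<alpha> \<beta>)"


section \<open>Reduced simplicial homology with coefficients in a field\<close>

text \<open>
  Chains are functions on faces. The multiplicative part of the module records below carries no
  information. Faces are oriented by the linear order on the vertex type, and the empty face
  is a face of dimension -1, so the homology is reduced. A face of dimension \<open>j\<close> with vertices
  \<open>v\<^sub>0 < \<dots> < v\<^sub>j\<close> has boundary \<open>\<Sum>i. (-1)\<^sup>i [v\<^sub>0, \<dots>, v\<^sub>i omitted, \<dots>, v\<^sub>j]\<close>; hence the coefficient
  of \<open>\<tau>\<close> in the boundary of \<open>c\<close> collects all \<open>c (insert v \<tau>)\<close>, with sign given by the position of
  \<open>v\<close> in \<open>insert v \<tau>\<close>.
\<close>

definition chain_space :: "'f ring \<Rightarrow> 'a set set \<Rightarrow> int \<Rightarrow> ('f, 'a set \<Rightarrow> 'f) module" where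
  "chain_space F X j =
     \<lparr>carrier = {c. (\<forall>\<sigma>. c \<sigma> \<in> carrier F) \<and>
                    (\<forall>\<sigma>. \<not> (\<sigma> \<in> X \<and> face_dim \<sigma> = j) \<longrightarrow> c \<sigma> = \<zero>\<^bsub>F\<^esub>)},
      mult = undefined, one = undefined,
      zero = (\<lambda>\<sigma>. \<zero>\<^bsub>F\<^esub>),
      add = (\<lambda>c c' \<sigma>. c \<sigma> \<oplus>\<^bsub>F\<^esub> c' \<sigma>),
      smult = (\<lambda>a c \<sigma>. a \<otimes>\<^bsub>F\<^esub> c \<sigma>)\<rparr>"

definition boundary_map ::
  "'f ring \<Rightarrow> ('a::linorder) set set \<Rightarrow> ('a set \<Rightarrow> 'f) \<Rightarrow> 'a set \<Rightarrow> 'f" where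
  "boundary_map F X c \<tau> =
     (\<Oplus>\<^bsub>F\<^esub>v \<in> {v. v \<notin> \<tau> \<and> insert v \<tau> \<in> X}.
        (\<ominus>\<^bsub>F\<^esub> \<one>\<^bsub>F\<^esub>) [^]\<^bsub>F\<^esub> card {w \<in> \<tau>. w < v} \<otimes>\<^bsub>F\<^esub> c (insert v \<tau>))"

definition cycle_space ::
  "'f ring \<Rightarrow> ('a::linorder) set set \<Rightarrow> int \<Rightarrow> ('f, 'a set \<Rightarrow> 'f) module" where
  "cycle_space F X j =
     (chain_space F X j)
       \<lparr>carrier := {c \<in> carrier (chain_space F X j). boundary_map F X c = (\<lambda>\<tau>. \<zero>\<^bsub>F\<^esub>)}\<rparr>"

definition boundaries ::
  "'f ring \<Rightarrow> ('a::linorder) set set \<Rightarrow> int \<Rightarrow> ('a set \<Rightarrow> 'f) set" where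
  "boundaries F X j = boundary_map F X ` carrier (chain_space F X (j + 1))"

definition reduced_homology ::
  "'f ring \<Rightarrow> ('a::linorder) set set \<Rightarrow> int \<Rightarrow> ('f, ('a set \<Rightarrow> 'f) set) module" where
  "reduced_homology F X j =
     (let Z = cycle_space F X j; B = boundaries F X j in
      \<lparr>carrier = carrier (Z A_Mod B),
       mult = undefined, one = undefined,
       zero = \<one>\<^bsub>Z A_Mod B\<^esub>,
       add = (\<otimes>\<^bsub>Z A_Mod B\<^esub>),
       smult = (\<lambda>a K. B <+>\<^bsub>Z\<^esub> ((\<lambda>c. a \<odot>\<^bsub>Z\<^esub> c) ` K))\<rparr>)"

definition zero_space :: "('f, 'b) module \<Rightarrow> bool" where
  "zero_space M \<longleftrightarrow> carrier M = {\<zero>\<^bsub>M\<^esub>}"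

definition iso_to_field :: "'f ring \<Rightarrow> ('f, 'b) module \<Rightarrow> bool" where
  "iso_to_field F M \<longleftrightarrow>
     (\<exists>h \<in> iso (add_monoid M) (add_monoid F).
        \<forall>a\<in>carrier F. \<forall>x\<in>carrier M. h (a \<odot>\<^bsub>M\<^esub> x) = a \<otimes>\<^bsub>F\<^esub> h x)"

definition sphere_homology :: "'f ring \<Rightarrow> int \<Rightarrow> ('a::linorder) set set \<Rightarrow> bool" where
  "sphere_homology F m X \<longleftrightarrow>
     iso_to_field F (reduced_homology F X m) \<and>
     (\<forall>j. j \<noteq> m \<longrightarrow> zero_space (reduced_homology F X j))"

text \<open>Acyclic complexes are those with the reduced homology of a point.\<close>

definition acyclic_complex :: "'f ring \<Rightarrow> ('a::linorder) set set \<Rightarrow> bool" where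
  "acyclic_complex F X \<longleftrightarrow> (\<forall>j. zero_space (reduced_homology F X j))"


section \<open>Homology spheres and balls\<close>

definition homology_sphere :: "'f ring \<Rightarrow> int \<Rightarrow> ('a::linorder) set set \<Rightarrow> bool" where
  "homology_sphere F d X \<longleftrightarrow>
     complex_of_dim d X \<and>
     (\<forall>\<sigma>\<in>X. sphere_homology F (d - face_dim \<sigma> - 1) (link X \<sigma>))"

text \<open>
  For a homology ball, the empty face belongs to the following set because its link is the ball
  itself.
\<close>

definition ball_boundary :: "'f ring \<Rightarrow> ('a::linorder) set set \<Rightarrow> 'a set set" where
  "ball_boundary F X = {\<sigma> \<in> X. acyclic_complex F (link X \<sigma>)}"

definition homology_ball :: "'f ring \<Rightarrow> int \<Rightarrow> ('a::linorder) set set \<Rightarrow> bool" where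
  "homology_ball F d X \<longleftrightarrow>
     complex_of_dim d X \<and> acyclic_complex F X \<and>
     (\<forall>\<sigma>\<in>X. \<sigma> \<noteq> {} \<longrightarrow>
        sphere_homology F (d - face_dim \<sigma> - 1) (link X \<sigma>) \<or> acyclic_complex F (link X \<sigma>)) \<and>
     homology_sphere F (d - 1) (ball_boundary F X)"

definition stacked_homology_ball ::
  "'f ring \<Rightarrow> nat \<Rightarrow> int \<Rightarrow> ('a::linorder) set set \<Rightarrow> bool" where
  "stacked_homology_ball F k d X \<longleftrightarrow>
     homology_ball F d X \<and>
     (\<forall>\<sigma>\<in>X. d - face_dim \<sigma> \<ge> int k + 1 \<longrightarrow> \<sigma> \<in> ball_boundary F X)"

text \<open>
  ``Some field'' ranges over all fields whose carrier is a subset of the type \<open>'f\<close>, an arbitrary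
  type serving as universe; the field may differ from one complex to another. If \<open>'f\<close> is infinite,
  it contains a copy of every prime field, which by invariance of Betti numbers under field
  extension is no restriction.
\<close>

definition stacked_homology_sphere ::
  "'f itself \<Rightarrow> nat \<Rightarrow> int \<Rightarrow> ('a::linorder) set set \<Rightarrow> bool" where
  "stacked_homology_sphere (_ :: 'f itself) k d X \<longleftrightarrow>
     (\<exists>F :: 'f ring. field F \<and> homology_sphere F d X) \<and>
     (\<exists>(F :: 'f ring) Y. field F \<and> stacked_homology_ball F k (d + 1) Y \<and> ball_boundary F Y = X)"


section \<open>The classes of complexes with stellated, respectively stacked, vertex links\<close>

definition W_class :: "nat \<Rightarrow> nat \<Rightarrow> 'a set set set" where
  "W_class k d =
     {X. complex_of_dim (int d) X \<and> connected_complex X \<and>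
         (\<forall>v\<in>vertices X. stellated_sphere k (int d - 1) (link X {v}))}"

definition K_class :: "'f itself \<Rightarrow> nat \<Rightarrow> nat \<Rightarrow> ('a::linorder) set set set" where
  "K_class T k d =
     {X. complex_of_dim (int d) X \<and> connected_complex X \<and>
         (\<forall>v\<in>vertices X. stacked_homology_sphere T k (int d - 1) (link X {v}))}"

end

(*
Both classes consist of the boundaries of stacked balls: families of (n+1)-element facets built
from a single simplex by gluing, one at a time, a new simplex with one new vertex onto a boundary
ridge. On the boundary such a gluing is exactly a bistellar move of index 0.

Conversely let Y be a 1-stacked homology n-ball. Connectedness of links makes the facets around
any face connected through ridges. If rho is an interior ridge, then its algebraic boundary lies in
the boundary sphere of Y, where it bounds some chain b, as all faces of codimension 2 are boundary
faces; by acyclicity rho - b bounds an n-chain c. Dividing c by the fundamental chain w of the ball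
gives a function on the facets that jumps across rho and across no other interior ridge. So every
edge of the dual graph is a bridge, the graph is a tree, and Y can be rebuilt facet by facet.

That the stacked balls are homology balls is shown over the field with two elements, since the
universe 'f contains a copy of it and no signs arise.
*)

theory Submission
  imports Defs "HOL-Library.Z2"
begin

section \<open>Stacked families of facets\<close>

text \<open>Both classes restrict the vertex links only, so everything happens for a single link of
  dimension \<open>n - 1\<close> and a ball of dimension \<open>n = d\<close> that it bounds. The
  combinatorial side is a family of facets rather than a complex because the boundary sphere forgets
  the ridges along which simplices were glued.

  The obvious way back, cutting a leaf simplex off a homology ball, would require the rest to be a
  homology ball again. This is avoided: once the dual graph is known to have only bridges, a largest
  stacked subfamily is shown to be the whole family. The delicate point is that an adjacent facet
  contributes a vertex new to the subfamily. It does, because the facets around that vertex are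
  connected through ridges containing it and so cannot be separated by the bridge.

  In the other direction the links of the growing ball and of its boundary are followed through one
  gluing. Mod 2 each of these spheres carries a canonical fundamental cycle, the sum of its facets,
  which can be carried along without choosing generators.\<close>

definition generated_complex :: "'a set set \<Rightarrow> 'a set set" where
  "generated_complex \<F> = {\<sigma>. \<exists>f\<in>\<F>. \<sigma> \<subseteq> f}"

definition boundary_ridges :: "nat \<Rightarrow> 'a set set \<Rightarrow> 'a set set" where
  "boundary_ridges n \<F> = {\<rho>. finite \<rho> \<and> card \<rho> = n \<and> (\<exists>!g. g \<in> \<F> \<and> \<rho> \<subseteq> g)}"

abbreviation stacked_boundary :: "nat \<Rightarrow> 'a set set \<Rightarrow> 'a set set" where
  "stacked_boundary n \<F> \<equiv> generated_complex (boundary_ridges n \<F>)"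

text \<open>The new vertex has to avoid the whole family and not only its boundary, since otherwise
  the new simplex could meet old ones outside \<open>\<rho>\<close>.\<close>

inductive stacked_facets :: "nat \<Rightarrow> 'a set set \<Rightarrow> bool" for n :: nat where
  single: "finite f \<Longrightarrow> card f = n + 1 \<Longrightarrow> stacked_facets n {f}"
| glue: "stacked_facets n \<F> \<Longrightarrow> \<rho> \<in> boundary_ridges n \<F> \<Longrightarrow> v \<notin> \<Union>\<F> \<Longrightarrow>
     stacked_facets n (insert (insert v \<rho>) \<F>)"

lemma stacked_facets_basic:
  assumes "stacked_facets n \<F>"
  shows "finite \<F>" "\<F> \<noteq> {}" "\<And>f. f \<in> \<F> \<Longrightarrow> finite f \<and> card f = n + 1"
proof -
  have "finite \<F> \<and> \<F> \<noteq> {} \<and> (\<forall>f\<in>\<F>. finite f \<and> card f = n + 1)"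
    using assms
  proof induction
    case (glue \<F> \<rho> v)
    then have "v \<notin> \<rho>" by (auto simp: boundary_ridges_def)
    with glue show ?case by (auto simp: boundary_ridges_def)
  qed auto
  then show "finite \<F>" "\<F> \<noteq> {}" "\<And>f. f \<in> \<F> \<Longrightarrow> finite f \<and> card f = n + 1" by auto
qed

text \<open>The move discards all faces of \<open>\<rho>\<close>, but the proper ones return with
  the inserted cone. In a complex containing \<open>\<rho>\<close> the only face really lost is
  therefore \<open>\<rho>\<close>.\<close>

lemma in_bistellar_move_new_vertex:
  "\<sigma> \<in> bistellar_move X \<rho> {v} \<longleftrightarrow>
     \<sigma> \<in> X \<and> \<not> \<sigma> \<subseteq> \<rho> \<or> (\<exists>\<tau>. \<tau> \<subset> \<rho> \<and> (\<sigma> = \<tau> \<or> \<sigma> = insert v \<tau>))"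
proof -
  have "join (full_complex \<rho>) (boundary_complex {v}) = Pow \<rho>"
    by (auto simp: join_def full_complex_def boundary_complex_def)
  moreover have "\<sigma> \<in> join (boundary_complex \<rho>) (full_complex {v}) \<longleftrightarrow>
    (\<exists>\<tau>. \<tau> \<subset> \<rho> \<and> (\<sigma> = \<tau> \<or> \<sigma> = insert v \<tau>))"
    unfolding join_def full_complex_def boundary_complex_def subset_singleton_iff by blast
  ultimately show ?thesis by (simp add: bistellar_move_def)
qed

lemma in_stacked_boundary_single:
  assumes "finite f" "card f = n + 1"
  shows "stacked_boundary n {f} = boundary_complex f"
proof -
  have "(\<exists>\<rho>. finite \<rho> \<and> card \<rho> = n \<and> \<rho> \<subseteq> f \<and> \<sigma> \<subseteq> \<rho>) \<longleftrightarrow> \<sigma> \<subset> f" for \<sigma>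
  proof
    assume "\<exists>\<rho>. finite \<rho> \<and> card \<rho> = n \<and> \<rho> \<subseteq> f \<and> \<sigma> \<subseteq> \<rho>"
    then show "\<sigma> \<subset> f" using assms(2) by auto
  next
    assume "\<sigma> \<subset> f"
    then obtain x where x: "x \<in> f" "x \<notin> \<sigma>" by auto
    then show "\<exists>\<rho>. finite \<rho> \<and> card \<rho> = n \<and> \<rho> \<subseteq> f \<and> \<sigma> \<subseteq> \<rho>"
      using assms \<open>\<sigma> \<subset> f\<close> by (intro exI[of _ "f - {x}"]) auto
  qed
  moreover have "(\<exists>!g. g = f \<and> \<rho> \<subseteq> g) \<longleftrightarrow> \<rho> \<subseteq> f" for \<rho> by auto
  ultimately show ?thesis
    by (simp add: generated_complex_def boundary_ridges_def boundary_complex_def)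
qed

text \<open>The ridges of the new simplex through \<open>v\<close> lie in no old facet,
  \<open>\<rho>\<close> now lies in two facets, and every other ridge keeps its facets.\<close>

lemma boundary_ridges_glue:
  assumes st: "stacked_facets n \<F>" and \<rho>: "\<rho> \<in> boundary_ridges n \<F>" and v: "v \<notin> \<Union>\<F>"
  shows "boundary_ridges n (insert (insert v \<rho>) \<F>) =
    (boundary_ridges n \<F> - {\<rho>}) \<union> (\<lambda>x. insert v (\<rho> - {x})) ` \<rho>"
proof -
  have fin: "finite \<rho>" "card \<rho> = n" using \<rho> by (auto simp: boundary_ridges_def)
  obtain g where g: "g \<in> \<F>" "\<rho> \<subseteq> g" "\<And>g'. g' \<in> \<F> \<Longrightarrow> \<rho> \<subseteq> g' \<Longrightarrow> g' = g"
    using \<rho> by (auto simp: boundary_ridges_def)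
  have v\<rho>: "v \<notin> \<rho>" using g v by auto
  have nf: "insert v \<rho> \<noteq> h" "\<not> insert v \<tau> \<subseteq> h" if "h \<in> \<F>" for h \<tau> using v that by auto
  have sub: "\<tau> \<subseteq> insert v \<rho> \<longleftrightarrow> \<tau> = \<rho> \<or> (\<exists>x\<in>\<rho>. \<tau> = insert v (\<rho> - {x}))"
    if "finite \<tau>" "card \<tau> = n" for \<tau>
  proof
    assume s: "\<tau> \<subseteq> insert v \<rho>"
    show "\<tau> = \<rho> \<or> (\<exists>x\<in>\<rho>. \<tau> = insert v (\<rho> - {x}))"
    proof (cases "v \<in> \<tau>")
      case True
      have "card (insert v \<rho> - \<tau>) = 1"
        using s that fin v\<rho> by (simp add: card_Diff_subset)
      then obtain x where x: "insert v \<rho> - \<tau> = {x}" by (auto simp: card_1_singleton_iff)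
      then have "x \<in> \<rho>" "\<tau> = insert v (\<rho> - {x})" using True s v\<rho> by auto
      then show ?thesis by auto
    next
      case False
      then have "\<tau> \<subseteq> \<rho>" using s by auto
      then show ?thesis using that fin card_subset_eq by metis
    qed
  qed auto
  show ?thesis (is "?L = ?R")
  proof (rule Set.set_eqI)
    fix \<tau>
    have new: "insert v (\<rho> - {x}) \<in> ?L" if "x \<in> \<rho>" for x
    proof -
      have "card (insert v (\<rho> - {x})) = n"
        using fin v\<rho> that card_Suc_Diff1[OF fin(1) that] by (simp)
      moreover have "\<exists>!h. h \<in> insert (insert v \<rho>) \<F> \<and> insert v (\<rho> - {x}) \<subseteq> h"
        using nf(2) by (intro ex1I[of _ "insert v \<rho>"]) auto
      ultimately show ?thesis using fin by (auto simp: boundary_ridges_def)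
    qed
    show "\<tau> \<in> ?L \<longleftrightarrow> \<tau> \<in> ?R"
    proof (cases "finite \<tau> \<and> card \<tau> = n")
      case False
      have "x \<in> \<rho> \<Longrightarrow> finite (insert v (\<rho> - {x})) \<and> card (insert v (\<rho> - {x})) = n" for x
        using new[of x] by (auto simp: boundary_ridges_def)
      with False show ?thesis by (auto simp: boundary_ridges_def)
    next
      case t: True
      show ?thesis
      proof (cases "v \<in> \<tau>")
        case True
        have "\<tau> \<in> ?R \<longleftrightarrow> (\<exists>x\<in>\<rho>. \<tau> = insert v (\<rho> - {x}))"
          using True v by (auto simp: boundary_ridges_def)
        moreover have "\<tau> \<in> ?L \<Longrightarrow> \<tau> \<subseteq> insert v \<rho>"
          using True v by (auto simp: boundary_ridges_def)
        ultimately show ?thesis using sub[of \<tau>] t new True v\<rho> by auto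
      next
        case False
        show ?thesis
        proof (cases "\<tau> = \<rho>")
          case True
          have "\<rho> \<notin> ?L"
          proof
            assume "\<rho> \<in> ?L"
            then have "\<exists>!h. h \<in> insert (insert v \<rho>) \<F> \<and> \<rho> \<subseteq> h" by (simp add: boundary_ridges_def)
            then have "g = insert v \<rho>" using g(1,2) by blast
            then show False using nf(1)[OF g(1)] by simp
          qed
          then show ?thesis unfolding True using v\<rho> by blast
        next
          case ne: False
          have "\<not> \<tau> \<subseteq> insert v \<rho>" using sub[of \<tau>] t False ne by auto
          then have "(\<exists>!h. h \<in> insert (insert v \<rho>) \<F> \<and> \<tau> \<subseteq> h) \<longleftrightarrow> (\<exists>!h. h \<in> \<F> \<and> \<tau> \<subseteq> h)"
            by (intro arg_cong[of _ _ Ex1] ext) auto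
          then have "\<tau> \<in> ?L \<longleftrightarrow> \<tau> \<in> boundary_ridges n \<F>" by (simp add: boundary_ridges_def)
          then show ?thesis using ne False by blast
        qed
      qed
    qed
  qed
qed

lemma stacked_boundary_glue:
  assumes st: "stacked_facets n \<F>" and \<rho>: "\<rho> \<in> boundary_ridges n \<F>" and v: "v \<notin> \<Union>\<F>"
  shows "stacked_boundary n (insert (insert v \<rho>) \<F>) =
    bistellar_move (stacked_boundary n \<F>) \<rho> {v}"
proof -
  have fin: "finite \<rho>" "card \<rho> = n" using \<rho> by (auto simp: boundary_ridges_def)
  have ps: "(\<exists>x\<in>\<rho>. \<sigma> \<subseteq> insert v (\<rho> - {x})) \<longleftrightarrow> (\<exists>\<tau>. \<tau> \<subset> \<rho> \<and> (\<sigma> = \<tau> \<or> \<sigma> = insert v \<tau>))" for \<sigma>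
  proof
    assume "\<exists>x\<in>\<rho>. \<sigma> \<subseteq> insert v (\<rho> - {x})"
    then obtain x where x: "x \<in> \<rho>" "\<sigma> \<subseteq> insert v (\<rho> - {x})" by auto
    then show "\<exists>\<tau>. \<tau> \<subset> \<rho> \<and> (\<sigma> = \<tau> \<or> \<sigma> = insert v \<tau>)"
      by (intro exI[of _ "\<sigma> - {v}"]) auto
  qed auto
  have "\<sigma> \<in> stacked_boundary n (insert (insert v \<rho>) \<F>) \<longleftrightarrow>
    (\<exists>\<tau>\<in>boundary_ridges n \<F> - {\<rho>}. \<sigma> \<subseteq> \<tau>) \<or> (\<exists>x\<in>\<rho>. \<sigma> \<subseteq> insert v (\<rho> - {x}))" for \<sigma>
    unfolding generated_complex_def boundary_ridges_glue[OF assms] by auto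
  also have "\<dots> \<sigma> \<longleftrightarrow> (\<exists>\<tau>\<in>boundary_ridges n \<F>. \<sigma> \<subseteq> \<tau>) \<and> \<not> \<sigma> \<subseteq> \<rho> \<or>
    (\<exists>x\<in>\<rho>. \<sigma> \<subseteq> insert v (\<rho> - {x}))" for \<sigma>
  proof -
    \<comment> \<open>A face common to \<open>\<rho>\<close> and a different ridge is a proper
      subset of \<open>\<rho>\<close>, so it survives inside one of the new ridges.\<close>
    have "\<exists>x\<in>\<rho>. \<sigma> \<subseteq> insert v (\<rho> - {x})" 
      if t: "\<tau>\<in>boundary_ridges n \<F> - {\<rho>}" "\<sigma> \<subseteq> \<tau>" "\<sigma> \<subseteq> \<rho>" for \<tau>
    proof -
      have "\<sigma> \<noteq> \<rho>" using t card_subset_eq[of \<tau> \<rho>] fin by (auto simp: boundary_ridges_def)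
      then show ?thesis using t(3) by auto
    qed
    then show ?thesis by blast
  qed
  finally show ?thesis
    unfolding set_eq_iff in_bistellar_move_new_vertex ps by (simp add: generated_complex_def)
qed

lemma stacked_boundary_subset: "stacked_boundary n \<F> \<subseteq> generated_complex \<F>"
proof
  fix \<sigma> assume "\<sigma> \<in> stacked_boundary n \<F>"
  then obtain \<rho> where "\<rho> \<in> boundary_ridges n \<F>" "\<sigma> \<subseteq> \<rho>" by (auto simp: generated_complex_def)
  moreover from this obtain g where "g \<in> \<F>" "\<rho> \<subseteq> g" by (auto simp: boundary_ridges_def)
  ultimately show "\<sigma> \<in> generated_complex \<F>" by (auto simp: generated_complex_def)
qed

text \<open>Of the faces of a glued simplex only \<open>\<rho>\<close> and the simplex itself miss
  the new boundary, and both have at least \<open>n\<close> vertices; no other old boundary face is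
  lost. This is the 1-stackedness of the ball.\<close>

lemma stacked_small_faces:
  assumes "stacked_facets n \<F>" "\<sigma> \<in> generated_complex \<F>" "card \<sigma> + 1 \<le> n"
  shows "\<sigma> \<in> stacked_boundary n \<F>"
  using assms
proof induction
  case (single f)
  then have "\<sigma> \<subset> f" by (auto simp: generated_complex_def)
  then show ?case
    using single by (simp add: in_stacked_boundary_single boundary_complex_def)
next
  case (glue \<F> \<rho> v)
  have fin: "finite \<rho>" "card \<rho> = n" and v\<rho>: "v \<notin> \<rho>"
    using glue by (auto simp: boundary_ridges_def)
  have "\<sigma> \<noteq> \<rho>" "\<not> \<sigma> = insert v \<rho>" using glue.prems fin v\<rho> by auto
  moreover have "\<sigma> \<subseteq> insert v \<rho> \<or> \<sigma> \<in> stacked_boundary n \<F>"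
    using glue by (auto simp: generated_complex_def)
  moreover have "\<exists>\<tau>. \<tau> \<subset> \<rho> \<and> (\<sigma> = \<tau> \<or> \<sigma> = insert v \<tau>)" if "\<sigma> \<subseteq> insert v \<rho>"
  proof (cases "v \<in> \<sigma>")
    case True
    then show ?thesis using that \<open>\<not> \<sigma> = insert v \<rho>\<close> v\<rho>
      by (intro exI[of _ "\<sigma> - {v}"]) auto
  qed (use that \<open>\<sigma> \<noteq> \<rho>\<close> in auto)
  ultimately show ?case
    unfolding stacked_boundary_glue[OF glue.hyps] in_bistellar_move_new_vertex by blast
qed

lemma boundary_ridges_nonempty:
  assumes "stacked_facets n \<F>" "n \<ge> 1"
  shows "boundary_ridges n \<F> \<noteq> {}"
proof -
  have "{} \<in> stacked_boundary n \<F>"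
    using stacked_small_faces[OF assms(1), of "{}"] stacked_facets_basic[OF assms(1)] assms(2)
    by (auto simp: generated_complex_def)
  then show ?thesis by (auto simp: generated_complex_def)
qed

lemma complex_of_dim_generated:
  assumes "finite \<F>" "\<F> \<noteq> {}" "\<And>f. f \<in> \<F> \<Longrightarrow> finite f \<and> card f = k"
  shows "complex_of_dim (int k - 1) (generated_complex \<F>)"
proof -
  have "generated_complex \<F> = (\<Union>f\<in>\<F>. Pow f)" by (auto simp: generated_complex_def)
  then have fin: "finite (generated_complex \<F>)" using assms by auto
  have "\<Union>(generated_complex \<F>) = \<Union>\<F>" by (auto simp: generated_complex_def)
  have "simplicial_complex (generated_complex \<F>)"
  proof -
    have "finite (\<Union>(generated_complex \<F>))"
      unfolding \<open>\<Union>(generated_complex \<F>) = \<Union>\<F>\<close> using assms by blast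
    then show ?thesis
      using assms(2) unfolding simplicial_complex_def generated_complex_def by blast
  qed
  moreover have "Max (face_dim ` generated_complex \<F>) = int k - 1"
  proof (rule Max_eqI)
    show "finite (face_dim ` generated_complex \<F>)" using fin by auto
    fix y assume "y \<in> face_dim ` generated_complex \<F>"
    then obtain \<sigma> f where "y = face_dim \<sigma>" "\<sigma> \<subseteq> f" "f \<in> \<F>"
      by (auto simp: generated_complex_def)
    moreover from this have "card \<sigma> \<le> k" using assms(3)[of f] card_mono[of f \<sigma>] by simp
    ultimately show "y \<le> int k - 1" by (simp add: face_dim_def)
  next
    obtain f where "f \<in> \<F>" using assms by auto
    then show "int k - 1 \<in> face_dim ` generated_complex \<F>"
      using assms(3) by (intro image_eqI[of _ _ f]) (auto simp: face_dim_def generated_complex_def)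
  qed
  ultimately show ?thesis by (simp add: complex_of_dim_def complex_dim_def)
qed

lemma finite_boundary_ridges:
  assumes "stacked_facets n \<F>"
  shows "finite (boundary_ridges n \<F>)"
proof (rule finite_subset)
  show "boundary_ridges n \<F> \<subseteq> (\<Union>f\<in>\<F>. Pow f)" by (auto simp: boundary_ridges_def)
  show "finite (\<Union>f\<in>\<F>. Pow f)" using stacked_facets_basic[OF assms] by auto
qed

section \<open>Gluings of simplices and moves of index 0\<close>

lemma stacked_imp_stellated:
  assumes "stacked_facets n \<F>" "n \<ge> 1"
  shows "stellated_sphere 1 (int n - 1) (stacked_boundary n \<F>)"
  using assms(1)
proof induction
  case (single f)
  then show ?case
    using stellated_sphere.standard_sphere[of f "int n - 1"] by (simp add: in_stacked_boundary_single)
next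
  case (glue \<F> \<rho> v)
  let ?X = "stacked_boundary n \<F>"
  have fin: "finite \<rho>" "card \<rho> = n" and v\<rho>: "v \<notin> \<rho>"
    using glue by (auto simp: boundary_ridges_def)
  \<comment> \<open>A vertex new to the family is also new to its boundary, so the induced
    subcomplex on \<open>\<rho> \<union> {v}\<close> consists of the faces of \<open>\<rho>\<close>
    only.\<close>
  have "v \<notin> \<Union>?X" using glue.hyps(3) unfolding generated_complex_def boundary_ridges_def by blast
  then have "{\<sigma> \<in> ?X. \<sigma> \<subseteq> insert v \<rho>} = Pow \<rho>"
    using glue.hyps(2) unfolding generated_complex_def by blast
  moreover have "join (full_complex \<rho>) (boundary_complex {v}) = Pow \<rho>"
    by (auto simp: join_def full_complex_def boundary_complex_def)
  ultimately have "induced_subcomplex ?X (\<rho> \<union> {v}) = join (full_complex \<rho>) (boundary_complex {v})"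
    by (simp add: induced_subcomplex_def)
  moreover have "complex_of_dim (int n - 1) ?X"
    using complex_of_dim_generated[OF finite_boundary_ridges[OF glue.hyps(1)]
      boundary_ridges_nonempty[OF glue.hyps(1) assms(2)], of n]
    by (auto simp: boundary_ridges_def)
  ultimately have "bistellar_admissible (int n - 1) ?X \<rho> {v}"
    unfolding bistellar_admissible_def using fin v\<rho> assms(2) by (auto simp: face_dim_def)
  then show ?case
    unfolding stacked_boundary_glue[OF glue.hyps]
    by (intro stellated_sphere.bistellar_step[OF glue.IH]) (auto simp: face_dim_def)
qed

text \<open>Index 0 forces \<open>\<beta>\<close> to be a single vertex. If \<open>X\<close> already
  contained it, it would be a face of the induced subcomplex, which is \<open>Pow \<alpha>\<close>,
  against disjointness.\<close>

lemma new_vertex_move: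
  assumes adm: "bistellar_admissible d X \<alpha> \<beta>" and "face_dim \<beta> < 1"
  obtains v where "\<beta> = {v}" "v \<notin> \<Union>X" "\<alpha> \<in> X" "finite \<alpha>" "int (card \<alpha>) = d + 1"
proof -
  have "finite \<beta>" "\<beta> \<noteq> {}" using adm by (auto simp: bistellar_admissible_def)
  then have "card \<beta> = 1" using assms(2) by (simp add: face_dim_def card_gt_0_iff Suc_leI le_antisym)
  then obtain v where v: "\<beta> = {v}" by (auto simp: card_1_singleton_iff)
  have ind: "{\<sigma>\<in>X. \<sigma> \<subseteq> insert v \<alpha>} = Pow \<alpha>"
    using adm v by (auto simp: bistellar_admissible_def induced_subcomplex_def join_def
        full_complex_def boundary_complex_def)
  have "\<alpha> \<inter> {v} = {}" "simplicial_complex X" "finite \<alpha>" "face_dim \<alpha> + face_dim {v} = d"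
    using adm v by (auto simp: bistellar_admissible_def complex_of_dim_def)
  moreover have "v \<notin> \<Union>X"
  proof
    assume "v \<in> \<Union>X"
    then have "{v} \<in> X" using \<open>simplicial_complex X\<close> by (auto simp: simplicial_complex_def)
    then have "{v} \<in> Pow \<alpha>" using ind by blast
    then show False using calculation by auto
  qed
  moreover have "\<alpha> \<in> X" using ind by blast
  ultimately show ?thesis using that[OF v] by (auto simp: face_dim_def)
qed

text \<open>Dimension 0 is exceptional: interior vertices of a path do not occur in its boundary, so a
  move may introduce a vertex that the path built so far already uses.\<close>

lemma stellated_zero_sphere:
  assumes "stellated_sphere 1 0 X"
  shows "\<exists>V. finite V \<and> card V = 2 \<and> X = boundary_complex V"
  using assms
proof induction
  case (standard_sphere V)
  then show ?case by auto
next
  case (bistellar_step X \<alpha> \<beta>)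
  then obtain V where V: "finite V" "card V = 2" "X = boundary_complex V" by auto
  obtain v where v: "\<beta> = {v}" "v \<notin> \<Union>X" "\<alpha> \<in> X" "finite \<alpha>" "int (card \<alpha>) = 0 + 1"
    using new_vertex_move[OF bistellar_step(2)] bistellar_step(3) by auto
  then obtain a where a: "\<alpha> = {a}" by (auto simp: card_1_singleton_iff)
  obtain x y where xy: "V = {x, y}" "x \<noteq> y" using V by (auto simp: card_2_iff)
  have pair: "\<sigma> \<in> X \<longleftrightarrow> \<sigma> = {} \<or> \<sigma> = {x} \<or> \<sigma> = {y}" for \<sigma>
    using xy V by (auto simp: boundary_complex_def)
  obtain b where b: "V = {a, b}" "a \<noteq> b" 
  proof (cases "a = x")
    case True
    then show ?thesis using that xy by blast
  next
    case False
    then have "a = y" using a v(3) pair by blast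
    then show ?thesis using that[of x] xy by blast
  qed
  then have Xb: "\<sigma> \<in> X \<longleftrightarrow> \<sigma> = {} \<or> \<sigma> = {a} \<or> \<sigma> = {b}" for \<sigma>
    using V by (auto simp: boundary_complex_def)
  then have "v \<noteq> a" "v \<noteq> b" using v(2) by auto
  have "bistellar_move X \<alpha> \<beta> = boundary_complex {b, v}"
    unfolding a v(1)
  proof (rule Set.set_eqI)
    fix \<sigma>
    have "\<tau> \<subset> {a} \<longleftrightarrow> \<tau> = {}" "\<sigma> \<subset> {b, v} \<longleftrightarrow> \<sigma> = {} \<or> \<sigma> = {b} \<or> \<sigma> = {v}" for \<tau>
      using \<open>v \<noteq> b\<close> by auto
    then show "\<sigma> \<in> bistellar_move X {a} {v} \<longleftrightarrow> \<sigma> \<in> boundary_complex {b, v}"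
      using b(2) by (auto simp: in_bistellar_move_new_vertex Xb boundary_complex_def)
  qed
  then show ?case using \<open>v \<noteq> b\<close> by (intro exI[of _ "{b, v}"]) auto
qed

text \<open>For \<open>n \<ge> 2\<close> all vertices of the family lie on its boundary, so a vertex
  new to the sphere is new to the ball and the move lifts to a gluing. For \<open>n = 1\<close> the
  two points are instead filled afresh by a single edge.\<close>

lemma stellated_imp_stacked:
  assumes "stellated_sphere 1 (int n - 1) X" "n \<ge> 1"
  shows "\<exists>\<F>. stacked_facets n \<F> \<and> X = stacked_boundary n \<F>"
proof (cases "n = 1")
  case True
  then obtain V where "finite V" "card V = n + 1" "X = boundary_complex V"
    using stellated_zero_sphere[of X] assms by auto
  then show ?thesis
    using stacked_facets.single in_stacked_boundary_single by metis
next
  case False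
  with assms have n: "n \<ge> 2" by auto
  show ?thesis using assms(1)
  proof induction
    case (standard_sphere V)
    then have "card V = n + 1" by auto
    then show ?case using standard_sphere stacked_facets.single in_stacked_boundary_single by metis
  next
    case (bistellar_step X \<alpha> \<beta>)
    then obtain \<F> where F: "stacked_facets n \<F>" "X = stacked_boundary n \<F>" by auto
    obtain v where v: "\<beta> = {v}" "v \<notin> \<Union>X" "\<alpha> \<in> X" "finite \<alpha>" "int (card \<alpha>) = int n - 1 + 1"
      using new_vertex_move[OF bistellar_step(2)] bistellar_step(3) by auto
    obtain \<rho> where \<rho>: "\<rho> \<in> boundary_ridges n \<F>" "\<alpha> \<subseteq> \<rho>" using v(3) F by (auto simp: generated_complex_def)
    then have "\<alpha> = \<rho>" using v(5) card_subset_eq[of \<rho> \<alpha>] by (auto simp: boundary_ridges_def)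
    have "v \<notin> \<Union>\<F>"
    proof
      assume "v \<in> \<Union>\<F>"
      then have "{v} \<in> X" using stacked_small_faces[OF F(1), of "{v}"] n F(2)
        by (auto simp: generated_complex_def)
      then show False using v(2) by auto
    qed
    then show ?case
      using stacked_facets.glue[OF F(1) \<rho>(1)] stacked_boundary_glue[OF F(1) \<rho>(1)] v(1) F(2) \<open>\<alpha> = \<rho>\<close>
      by metis
  qed
qed

section \<open>Recognising stacked families by their dual graph\<close>

lemma stacked_facets_constant:
  assumes "stacked_facets n \<F>"
    and "\<And>a b. a \<in> \<F> \<Longrightarrow> b \<in> \<F> \<Longrightarrow> card (a \<inter> b) = n \<Longrightarrow> r a = r b"
    and "f \<in> \<F>" "g \<in> \<F>"
  shows "r f = r g"
  using assms
proof (induction arbitrary: f g)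
  case (single h)
  then show ?case by simp
next
  case (glue \<F> \<rho> v)
  obtain h where h: "h \<in> \<F>" "\<rho> \<subseteq> h" "card \<rho> = n" using glue.hyps(2) by (auto simp: boundary_ridges_def)
  have "v \<notin> h" using h glue by auto
  then have "insert v \<rho> \<inter> h = \<rho>" using h by auto
  then have *: "r (insert v \<rho>) = r h" using glue.prems(1)[of "insert v \<rho>" h] h by auto
  have "r a = r h" if "a \<in> \<F>" for a
    using glue.IH[of a h] glue.prems(1) h that by blast
  then have "r a = r h" if "a \<in> insert (insert v \<rho>) \<F>" for a using * that by auto
  then show ?case using glue.prems by metis
qed

text \<open>Let \<open>S\<close> be a stacked subfamily of largest size. A facet \<open>f\<close>
  outside \<open>S\<close> adjacent to some \<open>g\<close> in \<open>S\<close> could be glued on,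
  against maximality; so \<open>S\<close> is closed under crossing ridges, and \<open>conn\<close>
  for the empty face gives everything. The function \<open>r\<close> from \<open>bridge\<close>
  certifies that \<open>f\<close> and \<open>g\<close> fall apart once their common ridge is dropped
  from the dual graph, which is what makes the vertex of \<open>f\<close> opposite that ridge
  new.\<close>

lemma stacked_facets_if_tree:
  fixes \<F> :: "'a set set"
  assumes fin: "finite \<F>" "\<F> \<noteq> {}" and unif: "\<And>f. f \<in> \<F> \<Longrightarrow> finite f \<and> card f = n + 1"
    and two: "\<And>\<rho> f g h. card \<rho> = n \<Longrightarrow> {f, g, h} \<subseteq> \<F> \<Longrightarrow> \<rho> \<subseteq> f \<inter> g \<inter> h \<Longrightarrow>
      f = g \<or> f = h \<or> g = h"
    and conn: "\<And>\<sigma> A. A \<noteq> {} \<Longrightarrow> A \<subseteq> {f \<in> \<F>. \<sigma> \<subseteq> f} \<Longrightarrow>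
      (\<And>a b. a \<in> A \<Longrightarrow> b \<in> \<F> \<Longrightarrow> \<sigma> \<subseteq> b \<Longrightarrow> card (a \<inter> b) = n \<Longrightarrow> b \<in> A) \<Longrightarrow>
      {f \<in> \<F>. \<sigma> \<subseteq> f} \<subseteq> A"
    and bridge: "\<And>f g. f \<in> \<F> \<Longrightarrow> g \<in> \<F> \<Longrightarrow> card (f \<inter> g) = n \<Longrightarrow>
      \<exists>r :: 'a set \<Rightarrow> 'k. r f \<noteq> r g \<and>
        (\<forall>a\<in>\<F>. \<forall>b\<in>\<F>. card (a \<inter> b) = n \<longrightarrow> a \<inter> b \<noteq> f \<inter> g \<longrightarrow> r a = r b)"
  shows "stacked_facets n \<F>"
proof -
  let ?P = "\<lambda>S. S \<subseteq> \<F> \<and> stacked_facets n S"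
  obtain f0 where "f0 \<in> \<F>" using fin by auto
  then have "?P {f0}" using unif stacked_facets.single by auto
  then have "\<exists>S. ?P S \<and> (\<forall>T. ?P T \<longrightarrow> card T \<le> card S)"
    using fin by (intro ex_has_greatest_nat[of ?P "{f0}" card "Suc (card \<F>)"])
      (auto simp: card_mono less_Suc_eq_le)
  then obtain S where S: "S \<subseteq> \<F>" "stacked_facets n S" and max: "\<And>T. ?P T \<Longrightarrow> card T \<le> card S"
    by blast
  have "f \<in> S" if g: "g \<in> S" and f: "f \<in> \<F>" and card: "card (g \<inter> f) = n" for f g
  proof (rule ccontr)
    assume fS: "f \<notin> S"
    let ?\<rho> = "f \<inter> g"
    have gF: "g \<in> \<F>" using g S by auto
    have c: "card ?\<rho> = n" using card by (simp add: Int_commute)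
    have "card (f - ?\<rho>) = 1" using unif[OF f] c by (simp add: card_Diff_subset)
    then obtain v where v: "f - ?\<rho> = {v}" by (auto simp: card_1_singleton_iff)
    then have fv: "f = insert v ?\<rho>" "v \<notin> g" by auto
    have ne: "f \<noteq> g" using fv by auto
    from bridge[OF f gF c] obtain r :: "'a set \<Rightarrow> 'k" where r: "r f \<noteq> r g \<and>
      (\<forall>a\<in>\<F>. \<forall>b\<in>\<F>. card (a \<inter> b) = n \<longrightarrow> a \<inter> b \<noteq> ?\<rho> \<longrightarrow> r a = r b)" ..
    then have jump: "r f \<noteq> r g" ..
    have const: "r a = r b" if "a \<in> \<F>" "b \<in> \<F>" "card (a \<inter> b) = n" "a \<inter> b \<noteq> ?\<rho>" for a b
      using conjunct2[OF r] that by simp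
    \<comment> \<open>Two members of \<open>S\<close> never meet exactly in \<open>?\<rho>\<close>,
      since together with \<open>f\<close> they would be three facets over it. Hence
      \<open>r\<close> cannot jump inside \<open>S\<close>.\<close>
    have rS: "r a = r g" if "a \<in> S" for a
    proof (rule stacked_facets_constant[where r = r, OF S(2) _ that g])
      fix a b assume ab: "a \<in> S" "b \<in> S" "card (a \<inter> b) = n"
      have inF: "a \<in> \<F>" "b \<in> \<F>" using ab S(1) by blast+
      have "card (a \<inter> a) \<noteq> n" using unif[OF inF(1)] by simp
      then have "a \<noteq> b" using ab(3) by metis
      moreover have "a \<noteq> f" "b \<noteq> f" using ab fS by blast+
      ultimately have "a \<inter> b \<noteq> ?\<rho>" using two[of ?\<rho> a b f] inF f c by blast
      then show "r a = r b" by (rule const[OF inF ab(3)])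
    qed
    \<comment> \<open>The facets around \<open>v\<close> are connected through ridges that contain
      \<open>v\<close>, and \<open>?\<rho>\<close> is not one of these. So \<open>r\<close> would
      not change on the way from \<open>f\<close> to \<open>h\<close>.\<close>
    have vS: "v \<notin> h" if h: "h \<in> S" for h
    proof
      assume vh: "v \<in> h"
      let ?A = "{a \<in> \<F>. v \<in> a \<and> r a = r f}"
      have "{a \<in> \<F>. {v} \<subseteq> a} \<subseteq> ?A"
      proof (rule conn)
        show "?A \<noteq> {}" using f fv(1) by blast
        fix a b assume ab: "a \<in> ?A" "b \<in> \<F>" "{v} \<subseteq> b" "card (a \<inter> b) = n"
        then have "a \<inter> b \<noteq> ?\<rho>" using fv(2) by blast
        then have "r a = r b" using ab by (intro const[OF _ ab(2,4)]) auto
        then show "b \<in> ?A" using ab by simp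
      qed auto
      then have "r h = r f" using vh h S(1) by blast
      then show False using rS[OF h] jump by simp
    qed
    have "?\<rho> \<in> boundary_ridges n S"
    proof -
      have "h = g" if "h \<in> S" "?\<rho> \<subseteq> h" for h
        using two[of ?\<rho> f g h] f gF c that S(1) fS ne by blast
      moreover have "finite ?\<rho>" using unif[OF f] by simp
      ultimately show ?thesis using g c unfolding boundary_ridges_def by blast
    qed
    then have "stacked_facets n (insert f S)"
      using stacked_facets.glue[OF S(2), of ?\<rho> v] vS fv(1) by auto
    then have "card (insert f S) \<le> card S" using max S(1) f by simp
    then show False using fS finite_subset[OF S(1) fin(1)] by simp
  qed
  then have "{f \<in> \<F>. {} \<subseteq> f} \<subseteq> S"
    using S stacked_facets_basic(2)[OF S(2)] by (intro conn) auto
  then show ?thesis using S by (simp add: subset_antisym)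
qed

section \<open>Homology with field coefficients\<close>

locale coefficient_field = field R for R :: "'f ring" (structure)
begin

definition incidence_sign :: "'v::linorder \<Rightarrow> 'v set \<Rightarrow> 'f" where
  "incidence_sign v \<tau> = (\<ominus> \<one>) [^] card {w \<in> \<tau>. w < v}"

lemma incidence_sign_closed [simp, intro]: "incidence_sign v \<tau> \<in> carrier R"
  by (simp add: incidence_sign_def)

lemma incidence_sign_cases: "incidence_sign v \<tau> = \<one> \<or> incidence_sign v \<tau> = \<ominus> \<one>"
proof -
  have "(\<ominus> \<one>) [^] k = \<one> \<or> (\<ominus> \<one>) [^] k = \<ominus> \<one>" for k :: nat
  proof (induction k)
    case (Suc k)
    then show ?case by (auto simp: r_minus)
  qed simp
  then show ?thesis by (simp add: incidence_sign_def)
qed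

text \<open>Inserting the smaller vertex shifts the position of the larger one by one, while
  inserting the larger vertex leaves the smaller in place.\<close>

lemma incidence_sign_swap:
  assumes "finite \<tau>" "v \<notin> \<tau>" "w \<notin> \<tau>" "v \<noteq> w"
  shows "incidence_sign v \<tau> \<otimes> incidence_sign w (insert v \<tau>) =
    \<ominus> (incidence_sign w \<tau> \<otimes> incidence_sign v (insert w \<tau>))"
proof -
  have *: "incidence_sign v \<tau> \<otimes> incidence_sign w (insert v \<tau>) =
    \<ominus> (incidence_sign w \<tau> \<otimes> incidence_sign v (insert w \<tau>))"
    if "v < w" "v \<notin> \<tau>" "w \<notin> \<tau>" for v w
  proof -
    have "{x \<in> insert v \<tau>. x < w} = insert v {x \<in> \<tau>. x < w}" using that by auto
    then have "card {x \<in> insert v \<tau>. x < w} = Suc (card {x \<in> \<tau>. x < w})"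
      using assms that by simp
    moreover have "{x \<in> insert w \<tau>. x < v} = {x \<in> \<tau>. x < v}" using that by auto
    ultimately show ?thesis
      by (simp add: incidence_sign_def r_minus l_minus m_comm)
  qed
  show ?thesis
  proof (cases "v < w")
    case False
    then have "w < v" using assms by auto
    then show ?thesis using *[of w v] assms by (simp add: minus_minus)
  qed (use * assms in blast)
qed

text \<open>The diagonal is left out because in characteristic two antisymmetry does not make it
  vanish. This cancellation gives both that the boundary squares to zero and that a separated vertex
  set detects a non-bounding difference of points.\<close>

lemma finsum_antisymmetric:
  assumes "finite A" and cl: "\<And>u v. u \<in> A \<Longrightarrow> v \<in> A \<Longrightarrow> g u v \<in> carrier R"
    and anti: "\<And>u v. u \<in> A \<Longrightarrow> v \<in> A \<Longrightarrow> u \<noteq> v \<Longrightarrow> g u v = \<ominus> g v u"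
  shows "(\<Oplus>v\<in>A. \<Oplus>u\<in>A - {v}. g v u) = \<zero>"
  using assms
proof (induction A)
  case empty
  then show ?case by simp
next
  case (insert a A)
  have cl: "g u v \<in> carrier R" if "u \<in> insert a A" "v \<in> insert a A" for u v
    using insert.prems(1) that by blast
  have inner: "(\<Oplus>u\<in>insert a A - {v}. g v u) = g v a \<oplus> (\<Oplus>u\<in>A - {v}. g v u)" if "v \<in> A" for v
  proof -
    have "insert a A - {v} = insert a (A - {v})" using insert.hyps that by auto
    then show ?thesis using insert.hyps that cl by (simp add: Pi_def)
  qed
  have cancel: "(\<Oplus>v\<in>A. g a v) \<oplus> (\<Oplus>v\<in>A. g v a) = \<zero>"
  proof -
    have "(\<Oplus>v\<in>A. g a v) \<oplus> (\<Oplus>v\<in>A. g v a) = (\<Oplus>v\<in>A. g a v \<oplus> g v a)"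
      using cl by (intro finsum_addf[symmetric]) auto
    also have "\<dots> = \<zero>"
    proof (rule add.finprod_one_eqI)
      fix v assume "v \<in> A"
      then have "g v a = \<ominus> g a v" using insert.prems(2)[of v a] insert.hyps by auto
      then show "g a v \<oplus> g v a = \<zero>" using cl \<open>v \<in> A\<close> by (simp add: r_neg)
    qed
    finally show ?thesis .
  qed
  have IH: "(\<Oplus>v\<in>A. \<Oplus>u\<in>A - {v}. g v u) = \<zero>"
    using insert.IH insert.prems by blast
  have "(\<Oplus>v\<in>insert a A. \<Oplus>u\<in>insert a A - {v}. g v u) =
    (\<Oplus>u\<in>A. g a u) \<oplus> (\<Oplus>v\<in>A. \<Oplus>u\<in>insert a A - {v}. g v u)"
  proof -
    have "insert a A - {a} = A" using insert.hyps by auto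
    moreover have "(\<Oplus>v\<in>insert a A. \<Oplus>u\<in>insert a A - {v}. g v u) =
      (\<Oplus>u\<in>insert a A - {a}. g a u) \<oplus> (\<Oplus>v\<in>A. \<Oplus>u\<in>insert a A - {v}. g v u)"
      using insert.hyps cl by (intro finsum_insert) (auto intro!: finsum_closed)
    ultimately show ?thesis by simp
  qed
  also have "(\<Oplus>v\<in>A. \<Oplus>u\<in>insert a A - {v}. g v u) = (\<Oplus>v\<in>A. g v a \<oplus> (\<Oplus>u\<in>A - {v}. g v u))"
    using cl inner by (intro finsum_cong') (auto intro!: finsum_closed add.m_closed)
  also have "\<dots> = (\<Oplus>v\<in>A. g v a) \<oplus> (\<Oplus>v\<in>A. \<Oplus>u\<in>A - {v}. g v u)"
    using cl by (intro finsum_addf) (auto intro!: finsum_closed)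
  also have "\<dots> = (\<Oplus>v\<in>A. g v a)" unfolding IH using cl by (simp add: Pi_def)
  finally show ?case using cancel by simp
qed

section \<open>Chains and the boundary operator\<close>

definition chain_on :: "'v set set \<Rightarrow> ('v set \<Rightarrow> 'f) \<Rightarrow> bool" where
  "chain_on X c \<longleftrightarrow> (\<forall>\<sigma>. c \<sigma> \<in> carrier R) \<and> (\<forall>\<sigma>. \<sigma> \<notin> X \<longrightarrow> c \<sigma> = \<zero>)"

text \<open>Summing over a fixed vertex set instead of the cofaces in \<open>X\<close> makes
  boundaries in a complex and in a subcomplex comparable.\<close>

lemma boundary_map_eq:
  assumes "chain_on X c" "finite V" "\<Union>X \<subseteq> V"
  shows "boundary_map R X c \<tau> = (\<Oplus>v\<in>V - \<tau>. incidence_sign v \<tau> \<otimes> c (insert v \<tau>))"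
proof -
  have "{v. v \<notin> \<tau> \<and> insert v \<tau> \<in> X} \<subseteq> V - \<tau>" using assms(3) by auto
  then show ?thesis unfolding boundary_map_def incidence_sign_def[symmetric]
    using assms by (intro add.finprod_mono_neutral_cong_left) (auto simp: chain_on_def)
qed

lemma boundary_map_cong:
  assumes "chain_on X c" "X \<subseteq> Y" "finite (\<Union>Y)"
  shows "boundary_map R X c = boundary_map R Y c"
proof -
  have "chain_on Y c" using assms by (auto simp: chain_on_def)
  moreover have "\<Union>X \<subseteq> \<Union>Y" using assms by auto
  ultimately show ?thesis using assms by (simp add: fun_eq_iff boundary_map_eq[of _ _ "\<Union>Y"])
qed

lemma boundary_map_add:
  assumes "chain_on X c" "chain_on X c'" "finite (\<Union>X)"
  shows "boundary_map R X (\<lambda>\<sigma>. c \<sigma> \<oplus> c' \<sigma>) \<tau> = boundary_map R X c \<tau> \<oplus> boundary_map R X c' \<tau>"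
proof -
  have "chain_on X (\<lambda>\<sigma>. c \<sigma> \<oplus> c' \<sigma>)" using assms by (auto simp: chain_on_def)
  then have "boundary_map R X (\<lambda>\<sigma>. c \<sigma> \<oplus> c' \<sigma>) \<tau> =
    (\<Oplus>v\<in>\<Union>X - \<tau>. incidence_sign v \<tau> \<otimes> c (insert v \<tau>) \<oplus> incidence_sign v \<tau> \<otimes> c' (insert v \<tau>))"
    using assms by (simp add: boundary_map_eq[of _ _ "\<Union>X"] r_distr chain_on_def)
  then show ?thesis using assms
    by (simp add: boundary_map_eq[of _ _ "\<Union>X"] chain_on_def Pi_def)
qed

lemma boundary_map_closed:
  assumes "chain_on X c" "finite (\<Union>X)"
  shows "boundary_map R X c \<tau> \<in> carrier R"
  using assms by (simp add: boundary_map_eq[of _ _ "\<Union>X"] chain_on_def Pi_def)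

lemma boundary_map_nonzeroD:
  assumes "chain_on X c" "finite (\<Union>X)" "boundary_map R X c \<tau> \<noteq> \<zero>"
  shows "\<exists>v. v \<notin> \<tau> \<and> c (insert v \<tau>) \<noteq> \<zero>"
proof (rule ccontr)
  assume "\<nexists>v. v \<notin> \<tau> \<and> c (insert v \<tau>) \<noteq> \<zero>"
  then have "boundary_map R X c \<tau> = \<zero>"
    unfolding boundary_map_eq[OF assms(1,2) order_refl]
    by (intro add.finprod_one_eqI) auto
  then show False using assms by simp
qed

lemma boundary_map_boundary_map:
  assumes X: "simplicial_complex X" and c: "chain_on X c"
  shows "boundary_map R X (boundary_map R X c) \<tau> = \<zero>"
proof -
  let ?V = "\<Union>X"
  have V: "finite ?V" using X by (auto simp: simplicial_complex_def)
  have cc: "c \<sigma> \<in> carrier R" for \<sigma> using c by (simp add: chain_on_def)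
  define g where "g v w = incidence_sign v \<tau> \<otimes> incidence_sign w (insert v \<tau>) \<otimes>
    c (insert w (insert v \<tau>))" for v w
  have gc: "g v w \<in> carrier R" for v w using cc by (simp add: g_def)
  have "chain_on X (boundary_map R X c)"
    unfolding chain_on_def
  proof (intro conjI allI impI)
    fix \<sigma> show "boundary_map R X c \<sigma> \<in> carrier R" using boundary_map_closed[OF c V] .
    assume "\<sigma> \<notin> X"
    then have "insert v \<sigma> \<notin> X" for v using X by (auto simp: simplicial_complex_def)
    then show "boundary_map R X c \<sigma> = \<zero>"
      using boundary_map_nonzeroD[OF c V, of \<sigma>] c by (auto simp: chain_on_def)
  qed
  moreover have "incidence_sign v \<tau> \<otimes> boundary_map R X c (insert v \<tau>) =
    (\<Oplus>w\<in>?V - \<tau> - {v}. g v w)" for v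
  proof -
    have fin: "finite (?V - \<tau> - {v})" by (intro finite_Diff V)
    have bm: "boundary_map R X c (insert v \<tau>) =
      (\<Oplus>w\<in>?V - \<tau> - {v}. incidence_sign w (insert v \<tau>) \<otimes> c (insert w (insert v \<tau>)))"
      using boundary_map_eq[OF c V order_refl, of "insert v \<tau>"] unfolding Diff_insert[of _ v \<tau>] .
    show ?thesis
      unfolding bm g_def m_assoc[OF incidence_sign_closed incidence_sign_closed cc]
      by (rule finsum_rdistr[OF fin incidence_sign_closed]) (simp add: cc Pi_def)
  qed
  ultimately have "boundary_map R X (boundary_map R X c) \<tau> =
    (\<Oplus>v\<in>?V - \<tau>. \<Oplus>w\<in>?V - \<tau> - {v}. g v w)"
    using boundary_map_eq[OF _ V order_refl, of "boundary_map R X c" \<tau>] by simp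
  also have "\<dots> = \<zero>"
  proof (rule finsum_antisymmetric[where g = g])
    fix u v assume uv: "u \<in> ?V - \<tau>" "v \<in> ?V - \<tau>" "u \<noteq> v"
    show "g u v = \<ominus> g v u"
    proof (cases "finite \<tau>")
      case True
      then show ?thesis using uv cc incidence_sign_swap[of \<tau> u v]
        by (simp add: g_def l_minus insert_commute)
    next
      \<comment> \<open>An infinite \<open>\<tau>\<close> has no cofaces in \<open>X\<close>, so
        both terms vanish and no comparison of signs is required.\<close>
      case False
      then have "\<not> insert u (insert v \<tau>) \<subseteq> ?V" using V finite_subset by (metis finite_insert)
      then have "insert u (insert v \<tau>) \<notin> X" by auto
      then show ?thesis using c by (simp add: g_def chain_on_def insert_commute)
    qed
  qed (use V gc in \<open>auto intro!: finite_Diff\<close>)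
  finally show ?thesis .
qed

section \<open>Reduced homology in terms of explicit cycles\<close>

lemma carrier_chain_space:
  "c \<in> carrier (chain_space R X j) \<longleftrightarrow>
    (\<forall>\<sigma>. c \<sigma> \<in> carrier R) \<and> (\<forall>\<sigma>. \<not> (\<sigma> \<in> X \<and> face_dim \<sigma> = j) \<longrightarrow> c \<sigma> = \<zero>)"
  by (simp add: chain_space_def)

lemma chain_on_chain_space: "c \<in> carrier (chain_space R X j) \<Longrightarrow> chain_on X c"
  by (simp add: carrier_chain_space chain_on_def)

abbreviation is_cycle :: "'v::linorder set set \<Rightarrow> int \<Rightarrow> ('v set \<Rightarrow> 'f) \<Rightarrow> bool" where
  "is_cycle X j c \<equiv> c \<in> carrier (chain_space R X j) \<and> boundary_map R X c = (\<lambda>\<tau>. \<zero>)"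

lemma boundary_map_zero: "boundary_map R X (\<lambda>\<sigma>. \<zero>) = (\<lambda>\<tau>. \<zero>)"
  unfolding boundary_map_def by (intro ext add.finprod_one_eqI) simp

text \<open>When the quotient is trivial, the coset of \<open>c\<close> is the set of boundaries; it
  contains \<open>c\<close> because zero is a boundary.\<close>

lemma zero_space_cycle:
  assumes "zero_space (reduced_homology R X j)" "is_cycle X j c"
  shows "\<exists>b\<in>carrier (chain_space R X (j + 1)). boundary_map R X b = c"
proof -
  let ?B = "boundaries R X j"
  have "{(\<lambda>\<sigma>. b \<sigma> \<oplus> c \<sigma>) | b. b \<in> ?B} \<in> carrier (reduced_homology R X j)"
    using assms(2)
    by (auto simp: reduced_homology_def A_FactGroup_def' A_RCOSETS_defs r_coset_def cycle_space_def
        Let_def chain_space_def)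
  then have eq: "{(\<lambda>\<sigma>. b \<sigma> \<oplus> c \<sigma>) | b. b \<in> ?B} = ?B"
    using assms(1) by (simp add: zero_space_def reduced_homology_def Let_def A_FactGroup_def')
  have "(\<lambda>\<sigma>. \<zero>) \<in> ?B"
    unfolding boundaries_def
    by (intro image_eqI[of _ _ "\<lambda>\<sigma>. \<zero>"]) (auto simp: boundary_map_zero carrier_chain_space)
  moreover have "(\<lambda>\<sigma>. \<zero> \<oplus> c \<sigma>) = c" using assms(2) by (simp add: carrier_chain_space)
  ultimately have "c \<in> {(\<lambda>\<sigma>. b \<sigma> \<oplus> c \<sigma>) | b. b \<in> ?B}"
    by (intro CollectI exI[of _ "\<lambda>\<sigma>. \<zero>"]) simp
  then have "c \<in> ?B" using eq by simp
  then show ?thesis by (auto simp: boundaries_def)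
qed

lemma boundary_map_smult:
  assumes "t \<in> carrier R" and zc: "\<And>\<sigma>. z \<sigma> \<in> carrier R"
  shows "boundary_map R X (\<lambda>\<sigma>. t \<otimes> z \<sigma>) \<tau> = t \<otimes> boundary_map R X z \<tau>"
proof -
  have "boundary_map R X (\<lambda>\<sigma>. t \<otimes> z \<sigma>) \<tau> =
    (\<Oplus>v\<in>{v. v \<notin> \<tau> \<and> insert v \<tau> \<in> X}. t \<otimes> (incidence_sign v \<tau> \<otimes> z (insert v \<tau>)))"
    unfolding boundary_map_def incidence_sign_def[symmetric]
    using assms by (intro finsum_cong') (auto simp: m_lcomm)
  also have "\<dots> = t \<otimes> boundary_map R X z \<tau>"
  proof (cases "finite {v. v \<notin> \<tau> \<and> insert v \<tau> \<in> X}")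
    case True
    then show ?thesis unfolding boundary_map_def incidence_sign_def[symmetric]
      using assms by (intro finsum_rdistr[symmetric]) auto
  qed (use assms in \<open>simp add: boundary_map_def\<close>)
  finally show ?thesis .
qed

lemma is_cycle_smult:
  assumes "t \<in> carrier R" "is_cycle X j z"
  shows "is_cycle X j (\<lambda>\<sigma>. t \<otimes> z \<sigma>)"
proof -
  have "z \<sigma> \<in> carrier R" for \<sigma> using assms(2) by (simp add: carrier_chain_space)
  then show ?thesis using assms by (auto simp: carrier_chain_space boundary_map_smult)
qed

text \<open>The boundaries are closed under shifting by a cycle \<open>c\<close> that bounds some
  \<open>b0\<close>: adding or subtracting \<open>b0\<close> moves the preimages. So all cosets
  coincide.\<close>

lemma zero_spaceI:
  assumes fin: "finite (\<Union>X)"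
    and ex: "\<And>c. is_cycle X j c \<Longrightarrow> \<exists>b\<in>carrier (chain_space R X (j + 1)). boundary_map R X b = c"
  shows "zero_space (reduced_homology R X j)"
proof -
  let ?B = "boundaries R X j"
  have coset: "{(\<lambda>\<sigma>. b \<sigma> \<oplus> c \<sigma>) | b. b \<in> ?B} = ?B" if c: "is_cycle X j c" for c
  proof -
    obtain b0 where b0: "b0 \<in> carrier (chain_space R X (j + 1))" "boundary_map R X b0 = c"
      using ex[OF c] by blast
    have add: "boundary_map R X (\<lambda>\<sigma>. b \<sigma> \<oplus> b0 \<sigma>) = (\<lambda>\<sigma>. boundary_map R X b \<sigma> \<oplus> c \<sigma>)"
      if "b \<in> carrier (chain_space R X (j + 1))" for b
      using boundary_map_add[OF chain_on_chain_space[OF that] chain_on_chain_space[OF b0(1)] fin] b0(2)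
      by auto
    show ?thesis
    proof (intro equalityI subsetI)
      fix y assume "y \<in> {(\<lambda>\<sigma>. b \<sigma> \<oplus> c \<sigma>) | b. b \<in> ?B}"
      then obtain b where b: "b \<in> carrier (chain_space R X (j + 1))"
        "y = (\<lambda>\<sigma>. boundary_map R X b \<sigma> \<oplus> c \<sigma>)"
        by (auto simp: boundaries_def)
      then have "y = boundary_map R X (\<lambda>\<sigma>. b \<sigma> \<oplus> b0 \<sigma>)" using add by simp
      moreover have "(\<lambda>\<sigma>. b \<sigma> \<oplus> b0 \<sigma>) \<in> carrier (chain_space R X (j + 1))"
        using b(1) b0(1) by (auto simp: carrier_chain_space)
      ultimately show "y \<in> ?B" by (simp add: boundaries_def)
    next
      fix y assume "y \<in> ?B"
      then obtain b where b: "b \<in> carrier (chain_space R X (j + 1))" "y = boundary_map R X b"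
        by (auto simp: boundaries_def)
      let ?d = "\<lambda>\<sigma>. b \<sigma> \<ominus> b0 \<sigma>"
      have d: "?d \<in> carrier (chain_space R X (j + 1))"
        using b(1) b0(1) by (auto simp: carrier_chain_space minus_eq)
      have "(\<lambda>\<sigma>. ?d \<sigma> \<oplus> b0 \<sigma>) = b"
        using b(1) b0(1) by (auto simp: carrier_chain_space minus_eq a_assoc l_neg)
      then have "y = (\<lambda>\<sigma>. boundary_map R X ?d \<sigma> \<oplus> c \<sigma>)" using add[OF d] b(2) by simp
      moreover have "boundary_map R X ?d \<in> ?B" using d by (simp add: boundaries_def)
      ultimately show "y \<in> {(\<lambda>\<sigma>. b \<sigma> \<oplus> c \<sigma>) | b. b \<in> ?B}" by blast
    qed
  qed
  have "carrier (reduced_homology R X j) = {{(\<lambda>\<sigma>. b \<sigma> \<oplus> c \<sigma>) | b. b \<in> ?B} | c. is_cycle X j c}"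
    by (auto simp: reduced_homology_def A_FactGroup_def' A_RCOSETS_defs r_coset_def cycle_space_def
        Let_def chain_space_def)
  also have "\<dots> = {?B}"
  proof -
    have "is_cycle X j (\<lambda>\<sigma>. \<zero>)" by (auto simp: carrier_chain_space boundary_map_zero)
    then have "?B \<in> {{(\<lambda>\<sigma>. b \<sigma> \<oplus> c \<sigma>) | b. b \<in> ?B} | c. is_cycle X j c}"
      using coset[of "\<lambda>\<sigma>. \<zero>"] by (intro CollectI exI[of _ "\<lambda>\<sigma>. \<zero>"]) simp
    then show ?thesis using coset by auto
  qed
  finally show ?thesis
    by (simp add: zero_space_def reduced_homology_def Let_def A_FactGroup_def')
qed

text \<open>Without faces of dimension \<open>j + 1\<close> the only boundary is zero, so cosets are
  singletons and homology is the space of cycles.\<close>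

lemma reduced_homology_top:
  assumes top: "\<forall>\<sigma>\<in>X. face_dim \<sigma> \<noteq> j + 1"
  shows carrier_homology_top: "carrier (reduced_homology R X j) = {{c} | c. is_cycle X j c}"
    and add_homology_top: "{c} \<oplus>\<^bsub>reduced_homology R X j\<^esub> {c'} = {\<lambda>\<sigma>. c \<sigma> \<oplus> c' \<sigma>}"
    and smult_homology_top: "t \<in> carrier R \<Longrightarrow> is_cycle X j c \<Longrightarrow>
      t \<odot>\<^bsub>reduced_homology R X j\<^esub> {c} = {\<lambda>\<sigma>. t \<otimes> c \<sigma>}"
proof -
  have "carrier (chain_space R X (j + 1)) = {\<lambda>\<sigma>. \<zero>}"
    using top by (auto simp: carrier_chain_space)
  then have B: "boundaries R X j = {\<lambda>\<sigma>. \<zero>}" by (simp add: boundaries_def boundary_map_zero)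
  show "carrier (reduced_homology R X j) = {{c} | c. is_cycle X j c}"
    by (auto simp: reduced_homology_def A_FactGroup_def' A_RCOSETS_defs r_coset_def cycle_space_def
        Let_def B chain_space_def)
  show "{c} \<oplus>\<^bsub>reduced_homology R X j\<^esub> {c'} = {\<lambda>\<sigma>. c \<sigma> \<oplus> c' \<sigma>}"
    by (auto simp: reduced_homology_def A_FactGroup_def FactGroup_def set_mult_def cycle_space_def
        Let_def chain_space_def)
  show "t \<odot>\<^bsub>reduced_homology R X j\<^esub> {c} = {\<lambda>\<sigma>. t \<otimes> c \<sigma>}"
    if "t \<in> carrier R" "is_cycle X j c"
    using that
    by (auto simp: reduced_homology_def set_add_def' cycle_space_def Let_def chain_space_def B)
qed

text \<open>Evaluation at \<open>\<sigma>0\<close> is the isomorphism: a multiple of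
  \<open>z\<close> is determined by its value there, because \<open>z\<close> takes the value
  one.\<close>

lemma iso_to_field_top:
  assumes top: "\<forall>\<sigma>\<in>X. face_dim \<sigma> \<noteq> j + 1"
    and z: "is_cycle X j z" "z \<sigma>0 = \<one>"
    and line: "\<And>c. is_cycle X j c \<Longrightarrow> \<exists>t\<in>carrier R. c = (\<lambda>\<sigma>. t \<otimes> z \<sigma>)"
  shows "iso_to_field R (reduced_homology R X j)"
proof -
  let ?H = "reduced_homology R X j"
  let ?h = "\<lambda>K. the_elem K \<sigma>0"
  note carr = carrier_homology_top[OF top] and add = add_homology_top[OF top]
    and smult = smult_homology_top[OF top]
  have cc: "c \<sigma> \<in> carrier R" if "is_cycle X j c" for c \<sigma> using that by (simp add: carrier_chain_space)
  have det: "c = (\<lambda>\<sigma>. c \<sigma>0 \<otimes> z \<sigma>)" if c: "is_cycle X j c" for c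
  proof -
    obtain t where t: "t \<in> carrier R" "c = (\<lambda>\<sigma>. t \<otimes> z \<sigma>)" using line[OF c] by blast
    then have "c \<sigma>0 = t" using z(2) by simp
    then show ?thesis using t(2) by simp
  qed
  have "bij_betw ?h (carrier ?H) (carrier R)"
  proof (rule bij_betw_imageI)
    show "inj_on ?h (carrier ?H)"
    proof (rule inj_onI)
      fix K L assume "K \<in> carrier ?H" "L \<in> carrier ?H" and eq: "?h K = ?h L"
      from \<open>K \<in> carrier ?H\<close> obtain c where c: "K = {c}" "is_cycle X j c"
        unfolding carr by (elim CollectE exE conjE) simp
      from \<open>L \<in> carrier ?H\<close> obtain c' where c': "L = {c'}" "is_cycle X j c'"
        unfolding carr by (elim CollectE exE conjE) simp
      have "c \<sigma>0 = c' \<sigma>0" using eq c(1) c'(1) by simp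
      then have "c = c'" using det[OF c(2)] det[OF c'(2)] by simp
      then show "K = L" using c(1) c'(1) by simp
    qed
    show "?h ` carrier ?H = carrier R"
    proof (intro equalityI subsetI)
      fix y assume "y \<in> ?h ` carrier ?H"
      then show "y \<in> carrier R" unfolding carr using cc by auto
    next
      fix t assume t: "t \<in> carrier R"
      then have "{\<lambda>\<sigma>. t \<otimes> z \<sigma>} \<in> carrier ?H" unfolding carr using is_cycle_smult[OF t z(1)] by blast
      moreover have "?h {\<lambda>\<sigma>. t \<otimes> z \<sigma>} = t" using t z(2) by simp
      ultimately show "t \<in> ?h ` carrier ?H" by (intro image_eqI[of _ _ "{\<lambda>\<sigma>. t \<otimes> z \<sigma>}"]) simp_all
    qed
  qed
  moreover have "?h (K \<oplus>\<^bsub>?H\<^esub> L) = ?h K \<oplus> ?h L" if "K \<in> carrier ?H" "L \<in> carrier ?H" for K L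
    using that unfolding carr by (auto simp: add)
  moreover have "?h K \<in> carrier R" if "K \<in> carrier ?H" for K
    using that unfolding carr by (auto simp: cc)
  ultimately have "?h \<in> iso (add_monoid ?H) (add_monoid R)" by (simp add: iso_def hom_def)
  moreover have "?h (a \<odot>\<^bsub>?H\<^esub> K) = a \<otimes> ?h K" if "a \<in> carrier R" "K \<in> carrier ?H" for a K
    using that unfolding carr by (auto simp: smult)
  ultimately show ?thesis unfolding iso_to_field_def by (intro bexI[of _ ?h] ballI)
qed

text \<open>The generator is the preimage of one under the isomorphism \<open>h\<close>; a cycle
  \<open>c\<close> and the multiple of \<open>z\<close> by \<open>h {c}\<close> have the same
  image.\<close>

lemma top_homology_line:
  assumes top: "\<forall>\<sigma>\<in>X. face_dim \<sigma> \<noteq> j + 1" and iso: "iso_to_field R (reduced_homology R X j)"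
  shows "\<exists>z. is_cycle X j z \<and> z \<noteq> (\<lambda>\<sigma>. \<zero>) \<and>
    (\<forall>c. is_cycle X j c \<longrightarrow> (\<exists>t\<in>carrier R. c = (\<lambda>\<sigma>. t \<otimes> z \<sigma>)))"
proof -
  let ?H = "reduced_homology R X j"
  note carr = carrier_homology_top[OF top] and add = add_homology_top[OF top]
    and smult = smult_homology_top[OF top]
  obtain h where h: "h \<in> iso (add_monoid ?H) (add_monoid R)"
    and hs: "\<And>a x. a \<in> carrier R \<Longrightarrow> x \<in> carrier ?H \<Longrightarrow> h (a \<odot>\<^bsub>?H\<^esub> x) = a \<otimes> h x"
    using iso by (auto simp: iso_to_field_def)
  have bij: "bij_betw h (carrier ?H) (carrier R)"
    and hom: "\<And>x y. x \<in> carrier ?H \<Longrightarrow> y \<in> carrier ?H \<Longrightarrow> h (x \<oplus>\<^bsub>?H\<^esub> y) = h x \<oplus> h y"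
    using h by (auto simp: iso_def hom_def)
  have "\<one> \<in> h ` carrier ?H" using bij by (simp add: bij_betw_def)
  then obtain x where x: "h x = \<one>" "x \<in> carrier ?H" by (elim imageE) simp
  obtain z where z: "x = {z}" "is_cycle X j z" using x carr by auto
  have zero: "is_cycle X j (\<lambda>\<sigma>. \<zero>)" by (auto simp: carrier_chain_space boundary_map_zero)
  have "h {\<lambda>\<sigma>. \<zero>} = h {\<lambda>\<sigma>. \<zero>} \<oplus> h {\<lambda>\<sigma>. \<zero>}"
    using hom[of "{\<lambda>\<sigma>. \<zero>}" "{\<lambda>\<sigma>. \<zero>}"] zero by (simp add: carr add)
  moreover have "h {\<lambda>\<sigma>. \<zero>} \<in> carrier R" using bij zero by (auto simp: carr bij_betw_def)
  ultimately have "h {\<lambda>\<sigma>. \<zero>} = \<zero>" by (simp add: add.l_cancel_one')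
  then have "z \<noteq> (\<lambda>\<sigma>. \<zero>)" using x z one_not_zero by auto
  moreover have "\<exists>t\<in>carrier R. c = (\<lambda>\<sigma>. t \<otimes> z \<sigma>)" if c: "is_cycle X j c" for c
  proof -
    let ?t = "h {c}"
    have t: "?t \<in> carrier R" using bij c by (auto simp: carr bij_betw_def)
    have cin: "{c} \<in> carrier ?H" using c carr by auto
    have tz: "{\<lambda>\<sigma>. ?t \<otimes> z \<sigma>} = ?t \<odot>\<^bsub>?H\<^esub> {z}" using smult[OF t z(2)] by simp
    have "is_cycle X j (\<lambda>\<sigma>. ?t \<otimes> z \<sigma>)" by (rule is_cycle_smult[OF t z(2)])
    then have "{\<lambda>\<sigma>. ?t \<otimes> z \<sigma>} \<in> carrier ?H" using carr by auto
    moreover have "h {\<lambda>\<sigma>. ?t \<otimes> z \<sigma>} = h {c}"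
      unfolding tz using hs[OF t, of "{z}"] x z t by simp
    ultimately have "{\<lambda>\<sigma>. ?t \<otimes> z \<sigma>} = {c}" using bij cin by (auto simp: bij_betw_def inj_on_def)
    then have "c = (\<lambda>\<sigma>. ?t \<otimes> z \<sigma>)" by simp
    with t show ?thesis by (rule bexI[rotated])
  qed
  ultimately show ?thesis using z(2) by blast
qed

end

section \<open>Links and facets of finite complexes\<close>

lemma link_empty [simp]: "link X {} = X"
  by (simp add: link_def)

lemma singleton_in_link: "{v} \<in> link X \<sigma> \<longleftrightarrow> v \<notin> \<sigma> \<and> insert v \<sigma> \<in> X"
  by (simp add: link_def)

lemma simplicial_complexD:
  assumes "simplicial_complex X"
  shows "finite (\<Union>X)" "{} \<in> X" "\<And>\<sigma> \<tau>. \<sigma> \<in> X \<Longrightarrow> \<tau> \<subseteq> \<sigma> \<Longrightarrow> \<tau> \<in> X"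
    "\<And>\<sigma>. \<sigma> \<in> X \<Longrightarrow> finite \<sigma>" "finite X"
proof -
  show fin: "finite (\<Union>X)" "{} \<in> X" "\<And>\<sigma> \<tau>. \<sigma> \<in> X \<Longrightarrow> \<tau> \<subseteq> \<sigma> \<Longrightarrow> \<tau> \<in> X"
    using assms by (auto simp: simplicial_complex_def)
  show "finite \<sigma>" if "\<sigma> \<in> X" for \<sigma>
    by (rule finite_subset[OF _ fin(1)]) (use that in auto)
  show "finite X" using fin(1) by (rule finite_UnionD)
qed

lemma simplicial_complex_link:
  assumes "simplicial_complex X" "\<sigma> \<in> X"
  shows "simplicial_complex (link X \<sigma>)"
  unfolding simplicial_complex_def
proof (intro conjI ballI allI impI)
  show "finite (\<Union>(link X \<sigma>))"
    by (rule finite_subset[OF _ simplicial_complexD(1)[OF assms(1)]]) (auto simp: link_def)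
  show "{} \<in> link X \<sigma>" using assms by (simp add: link_def)
  fix \<tau> \<tau>' assume "\<tau> \<in> link X \<sigma>" "\<tau>' \<subseteq> \<tau>"
  then have "\<tau> \<inter> \<sigma> = {}" "\<tau> \<union> \<sigma> \<in> X" "\<tau>' \<union> \<sigma> \<subseteq> \<tau> \<union> \<sigma>" by (auto simp: link_def)
  then show "\<tau>' \<in> link X \<sigma>"
    using simplicial_complexD(3)[OF assms(1)] \<open>\<tau>' \<subseteq> \<tau>\<close> by (auto simp: link_def)
qed

lemma card_face_le:
  assumes "complex_of_dim d X" "\<sigma> \<in> X"
  shows "int (card \<sigma>) \<le> d + 1"
proof -
  have "simplicial_complex X" "complex_dim X = d" using assms(1) by (auto simp: complex_of_dim_def)
  then have "face_dim \<sigma> \<le> d"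
    using assms(2) simplicial_complexD(5) Max_ge[of "face_dim ` X" "face_dim \<sigma>"]
    unfolding complex_dim_def by blast
  then show ?thesis by (simp add: face_dim_def)
qed

lemma extend_to_facet:
  assumes "\<And>\<sigma>. \<sigma> \<in> X \<Longrightarrow> finite \<sigma>"
    and "\<And>\<sigma>. \<sigma> \<in> X \<Longrightarrow> card \<sigma> < k \<Longrightarrow> \<exists>v. v \<notin> \<sigma> \<and> insert v \<sigma> \<in> X"
    and "\<sigma> \<in> X" "card \<sigma> \<le> k"
  shows "\<exists>f\<in>X. card f = k \<and> \<sigma> \<subseteq> f"
  using assms(3,4)
proof (induction "k - card \<sigma>" arbitrary: \<sigma>)
  case 0
  then show ?case by auto
next
  case (Suc m)
  then obtain v where v: "v \<notin> \<sigma>" "insert v \<sigma> \<in> X" using assms(2)[of \<sigma>] by (metis zero_less_Suc zero_less_diff)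
  then have "card (insert v \<sigma>) = Suc (card \<sigma>)" using assms(1) Suc by simp
  then have "m = k - card (insert v \<sigma>)" "card (insert v \<sigma>) \<le> k" using Suc.hyps(2) by linarith+
  then show ?case using Suc.hyps(1)[of "insert v \<sigma>"] v(2) by blast
qed

section \<open>Homology in degrees -1 and 0\<close>

context coefficient_field
begin

lemma minus_one_not_zero: "\<ominus> \<one> \<noteq> \<zero>"
  by (metis minus_minus minus_zero one_closed one_not_zero)

text \<open>The empty face is a cycle of degree -1, and a chain bounding it must contain a
  vertex.\<close>

lemma zero_homology_imp_vertex:
  assumes X: "simplicial_complex X" and z: "zero_space (reduced_homology R X (- 1))"
  shows "\<exists>v. {v} \<in> X"
proof -
  let ?c = "\<lambda>\<sigma>. if \<sigma> = {} then \<one> else \<zero>"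
  have "is_cycle X (- 1) ?c"
    using simplicial_complexD(2)[OF X]
    by (auto simp: carrier_chain_space face_dim_def boundary_map_def intro!: ext add.finprod_one_eqI)
  then obtain b where b: "b \<in> carrier (chain_space R X (- 1 + 1))" "boundary_map R X b = ?c"
    using zero_space_cycle[OF z] by blast
  then have "boundary_map R X b {} \<noteq> \<zero>" by simp
  then obtain v where "b {v} \<noteq> \<zero>"
    using boundary_map_nonzeroD[OF chain_on_chain_space[OF b(1)] simplicial_complexD(1)[OF X], of "{}"]
    by auto
  then show ?thesis using b(1) by (auto simp: carrier_chain_space)
qed

lemma boundary_map_point:
  assumes "simplicial_complex X" "{p} \<in> X" "a \<in> carrier R"
  shows "boundary_map R X (\<lambda>\<sigma>. if \<sigma> = {p} then a else \<zero>) \<tau> = (if \<tau> = {} then a else \<zero>)"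
    (is "boundary_map R X ?c \<tau> = _")
proof -
  have ch: "chain_on X ?c" using assms by (auto simp: chain_on_def)
  note fin = simplicial_complexD(1)[OF assms(1)]
  show ?thesis
  proof (cases "\<tau> = {}")
    case True
    have pV: "p \<in> \<Union>X" using assms by auto
    have "boundary_map R X ?c {} = (\<Oplus>v\<in>\<Union>X. if v = p then a else \<zero>)"
      unfolding boundary_map_eq[OF ch fin order_refl] using assms
      by (intro finsum_cong') (auto simp: incidence_sign_def)
    also have "\<dots> = a"
      by (rule add.finprod_singleton_swap[OF pV fin, of "\<lambda>_. a"]) (use assms in auto)
    finally show ?thesis using True by simp
  next
    case False
    have "boundary_map R X ?c \<tau> = \<zero>"
    proof (rule ccontr)
      assume "boundary_map R X ?c \<tau> \<noteq> \<zero>"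
      then obtain v where v: "v \<notin> \<tau>" "?c (insert v \<tau>) \<noteq> \<zero>"
        using boundary_map_nonzeroD[OF ch fin] by blast
      then have "insert v \<tau> = {p}" by presburger
      with v(1) show False using False by auto
    qed
    then show ?thesis using False by simp
  qed
qed

text \<open>The 0-cycle \<open>p - q\<close>; that it bounds expresses that \<open>p\<close> and
  \<open>q\<close> lie in one component.\<close>

definition point_difference :: "'v \<Rightarrow> 'v \<Rightarrow> 'v set \<Rightarrow> 'f" where
  "point_difference p q = (\<lambda>\<sigma>. (if \<sigma> = {p} then \<one> else \<zero>) \<oplus> (if \<sigma> = {q} then \<ominus> \<one> else \<zero>))"

lemma point_difference_closed [simp]: "point_difference p q \<sigma> \<in> carrier R"
  by (simp add: point_difference_def)

lemma is_cycle_point_difference: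
  assumes "simplicial_complex X" "{p} \<in> X" "{q} \<in> X"
  shows "is_cycle X 0 (point_difference p q)"
proof
  show "point_difference p q \<in> carrier (chain_space R X 0)"
    using assms by (auto simp: point_difference_def carrier_chain_space face_dim_def)
  have "boundary_map R X (point_difference p q) \<tau> = (if \<tau> = {} then \<one> else \<zero>) \<oplus> (if \<tau> = {} then \<ominus> \<one> else \<zero>)" for \<tau>
    unfolding point_difference_def
    using assms by (subst boundary_map_add)
      (auto simp: chain_on_def boundary_map_point simplicial_complexD)
  then show "boundary_map R X (point_difference p q) = (\<lambda>\<tau>. \<zero>)" by (auto simp: r_neg)
qed

text \<open>Suppose \<open>b\<close> bounds \<open>p - q\<close> with \<open>q\<close> outside
  \<open>P\<close>. Summing the boundary of \<open>b\<close> over the vertices in \<open>P\<close>,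
  each edge inside \<open>P\<close> contributes twice with opposite signs and no edge leaves
  \<open>P\<close>, so the sum is zero; but it is one, from \<open>p\<close> alone. An arbitrary
  closed set \<open>P\<close> takes the place of paths, as this is how the lemma is applied.\<close>

lemma zero_homology_imp_connected:
  fixes X :: "'v::linorder set set"
  assumes X: "simplicial_complex X" and z: "zero_space (reduced_homology R X 0)"
    and p: "{p} \<in> X" "p \<in> P" and q: "{q} \<in> X"
    and edge: "\<And>x y. x \<in> P \<Longrightarrow> {x, y} \<in> X \<Longrightarrow> y \<in> P"
  shows "q \<in> P"
proof (rule ccontr)
  assume qP: "q \<notin> P"
  note fin = simplicial_complexD(1)[OF X]
  obtain b where b: "b \<in> carrier (chain_space R X (0 + 1))" "boundary_map R X b = point_difference p q"
    using zero_space_cycle[OF z is_cycle_point_difference[OF X p(1) q]] by blast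
  note ch = chain_on_chain_space[OF b(1)]
  have bc: "b \<sigma> \<in> carrier R" for \<sigma> using ch by (simp add: chain_on_def)
  let ?A = "P \<inter> \<Union>X"
  have finA: "finite ?A" using fin by auto
  have "(\<Oplus>v\<in>?A. \<Oplus>u\<in>?A - {v}. incidence_sign u {v} \<otimes> b {u, v}) = \<zero>"
  proof (rule finsum_antisymmetric[where g = "\<lambda>v u. incidence_sign u {v} \<otimes> b {u, v}", OF finA])
    fix u v :: 'v assume "u \<noteq> v"
    then have "incidence_sign v {u} = \<ominus> incidence_sign u {v}"
    proof (cases "u < v")
      case True
      then have "{w \<in> {u}. w < v} = {u}" "{w \<in> {v}. w < u} = {}" by auto
      then show ?thesis by (simp only: incidence_sign_def) simp
    next
      case False
      then have "{w \<in> {u}. w < v} = {}" "{w \<in> {v}. w < u} = {v}" using \<open>u \<noteq> v\<close> by auto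
      then show ?thesis by (simp only: incidence_sign_def) (simp add: minus_minus)
    qed
    then show "incidence_sign v {u} \<otimes> b {v, u} = \<ominus> (incidence_sign u {v} \<otimes> b {u, v})"
      using bc by (simp add: l_minus insert_commute)
  qed (use bc in auto)
  moreover have "(\<Oplus>u\<in>?A - {v}. incidence_sign u {v} \<otimes> b {u, v}) = point_difference p q {v}" if v: "v \<in> ?A" for v
  proof -
    have "boundary_map R X b {v} = (\<Oplus>u\<in>\<Union>X - {v}. incidence_sign u {v} \<otimes> b {u, v})"
      by (rule boundary_map_eq[OF ch fin order_refl])
    also have "\<dots> = (\<Oplus>u\<in>?A - {v}. incidence_sign u {v} \<otimes> b {u, v})"
    proof (rule add.finprod_mono_neutral_cong_right)
      fix u assume u: "u \<in> \<Union>X - {v} - (?A - {v})"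
      then have "{u, v} \<notin> X" using edge[of v u] v by (auto simp: insert_commute)
      then show "incidence_sign u {v} \<otimes> b {u, v} = \<zero>" using ch by (simp add: chain_on_def)
    qed (use fin bc in auto)
    finally show ?thesis using b(2) by simp
  qed
  then have "(\<Oplus>v\<in>?A. point_difference p q {v}) =
      (\<Oplus>v\<in>?A. \<Oplus>u\<in>?A - {v}. incidence_sign u {v} \<otimes> b {u, v})"
    by (intro finsum_cong'[OF refl]) (auto simp: bc Pi_def)
  ultimately have "(\<Oplus>v\<in>?A. point_difference p q {v}) = \<zero>" by simp
  moreover have "(\<Oplus>v\<in>?A. point_difference p q {v}) = (\<Oplus>v\<in>?A. if v = p then \<one> else \<zero>)"
    using qP by (intro finsum_cong') (auto simp: point_difference_def)
  moreover have "\<dots> = \<one>"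
    by (rule add.finprod_singleton_swap[OF _ finA, of p "\<lambda>_. \<one>"]) (use p in auto)
  ultimately show False using one_not_zero by simp
qed

text \<open>Without edges every single point is a closed set, so degree -1 yields one point and
  degree 0 excludes a second.\<close>

lemma acyclic_points:
  assumes X: "simplicial_complex X" and pts: "\<And>\<sigma>. \<sigma> \<in> X \<Longrightarrow> card \<sigma> \<le> 1"
    and ac: "acyclic_complex R X"
  obtains v where "\<And>w. {w} \<in> X \<longleftrightarrow> w = v"
proof -
  obtain v where v: "{v} \<in> X"
    using zero_homology_imp_vertex[OF X] ac by (auto simp: acyclic_complex_def)
  have "w \<in> {v}" if "{w} \<in> X" for w
  proof (rule zero_homology_imp_connected[OF X _ v _ that])
    show "zero_space (reduced_homology R X 0)" using ac by (simp add: acyclic_complex_def)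
    fix x y assume "x \<in> {v}" "{x, y} \<in> X"
    then show "y \<in> {v}" using pts[of "{x, y}"] by (auto simp: card_insert_if split: if_splits)
  qed simp
  then show ?thesis using that v by blast
qed

text \<open>The 0-cycles form a line. With one point there would be no nonzero cycle; with three
  points \<open>v\<close>, \<open>w\<close>, \<open>u\<close> the cycles \<open>v - w\<close> and
  \<open>v - u\<close> would not be proportional.\<close>

lemma sphere_points:
  assumes X: "simplicial_complex X" and pts: "\<And>\<sigma>. \<sigma> \<in> X \<Longrightarrow> card \<sigma> \<le> 1"
    and sph: "sphere_homology R 0 X"
  obtains v w where "v \<noteq> w" "\<And>u. {u} \<in> X \<longleftrightarrow> u = v \<or> u = w"
proof -
  obtain v where v: "{v} \<in> X"
    using zero_homology_imp_vertex[OF X] sph by (auto simp: sphere_homology_def)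
  have top: "\<forall>\<sigma>\<in>X. face_dim \<sigma> \<noteq> 0 + 1" using pts by (fastforce simp: face_dim_def)
  have iso: "iso_to_field R (reduced_homology R X 0)" using sph by (simp add: sphere_homology_def)
  from top_homology_line[OF top iso] obtain z where zl: "is_cycle X 0 z \<and> z \<noteq> (\<lambda>\<sigma>. \<zero>) \<and>
    (\<forall>c. is_cycle X 0 c \<longrightarrow> (\<exists>t\<in>carrier R. c = (\<lambda>\<sigma>. t \<otimes> z \<sigma>)))" ..
  then have z: "is_cycle X 0 z" "z \<noteq> (\<lambda>\<sigma>. \<zero>)" by simp_all
  have line: "\<exists>t\<in>carrier R. c = (\<lambda>\<sigma>. t \<otimes> z \<sigma>)" if "is_cycle X 0 c" for c
    using zl that by blast
  have zc: "z \<sigma> \<in> carrier R" for \<sigma> using z(1) by (simp add: carrier_chain_space)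
  have "\<exists>w. w \<noteq> v \<and> {w} \<in> X"
  proof (rule ccontr)
    assume no: "\<nexists>w. w \<noteq> v \<and> {w} \<in> X"
    have zp: "z \<sigma> = (if \<sigma> = {v} then z {v} else \<zero>)" for \<sigma>
    proof (cases "\<sigma> \<in> X \<and> face_dim \<sigma> = 0")
      case True
      then obtain x where "\<sigma> = {x}" by (auto simp: face_dim_def card_1_singleton_iff)
      then show ?thesis using no True by auto
    next
      case False
      then show ?thesis using z(1) v by (auto simp: carrier_chain_space face_dim_def)
    qed
    have zv: "z = (\<lambda>\<sigma>. if \<sigma> = {v} then z {v} else \<zero>)" by (rule ext) (rule zp)
    have "boundary_map R X z {} = z {v}"
      by (subst zv) (simp add: boundary_map_point[OF X v zc])
    then have "z {v} = \<zero>" using z(1) by simp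
    then have "z \<sigma> = \<zero>" for \<sigma> by (subst zp) simp
    then show False using z(2) by blast
  qed
  then obtain w where w: "w \<noteq> v" "{w} \<in> X" by blast
  have "u = v \<or> u = w" if u: "{u} \<in> X" for u
  proof (rule ccontr)
    assume ne: "\<not> (u = v \<or> u = w)"
    obtain s where s: "s \<in> carrier R" "point_difference v w = (\<lambda>\<sigma>. s \<otimes> z \<sigma>)"
      using line[OF is_cycle_point_difference[OF X v w(2)]] by blast
    obtain t where t: "t \<in> carrier R" "point_difference v u = (\<lambda>\<sigma>. t \<otimes> z \<sigma>)"
      using line[OF is_cycle_point_difference[OF X v u]] by blast
    have "t \<otimes> z {u} = \<ominus> \<one>" using fun_cong[OF t(2), of "{u}"] ne by (auto simp: point_difference_def)
    then have "z {u} \<noteq> \<zero>" using t(1) minus_one_not_zero by (metis r_null)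
    moreover have "s \<otimes> z {u} = \<zero>" using fun_cong[OF s(2), of "{u}"] ne by (auto simp: point_difference_def)
    ultimately have "s = \<zero>" using s(1) zc integral by blast
    then have "point_difference v w {v} = \<zero>" using fun_cong[OF s(2), of "{v}"] zc by simp
    then show False using w(1) one_not_zero by (simp add: point_difference_def)
  qed
  then show ?thesis using that[of v w] v w by blast
qed

end

section \<open>The facets of a 1-stacked homology ball\<close>

locale one_stacked_ball = coefficient_field +
  fixes Y :: "'v::linorder set set" and n :: nat
  assumes stacked_ball: "stacked_homology_ball R 1 (int n) Y" and n_pos: "n \<ge> 1"
begin

abbreviation bd :: "'v set set" where "bd \<equiv> ball_boundary R Y"
abbreviation facets :: "'v set set" where "facets \<equiv> {f \<in> Y. card f = n + 1}"

lemma ball: "homology_ball R (int n) Y"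
  using stacked_ball by (simp add: stacked_homology_ball_def)

lemma Y_complex: "simplicial_complex Y"
  using ball by (simp add: homology_ball_def complex_of_dim_def)

lemma Y_card: "\<sigma> \<in> Y \<Longrightarrow> card \<sigma> \<le> n + 1"
  using card_face_le[of "int n" Y \<sigma>] ball by (simp add: homology_ball_def)

text \<open>Covers the ball itself, interior faces and boundary faces uniformly: each link is
  acyclic or has homology only in its top degree.\<close>

lemma Y_zero_homology:
  assumes "\<sigma> \<in> Y" "j \<noteq> int n - int (card \<sigma>)"
  shows "zero_space (reduced_homology R (link Y \<sigma>) j)"
proof (cases "\<sigma> = {}")
  case True
  then show ?thesis using ball by (simp add: homology_ball_def acyclic_complex_def)
next
  case False
  then have "sphere_homology R (int n - face_dim \<sigma> - 1) (link Y \<sigma>) \<or> acyclic_complex R (link Y \<sigma>)"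
    using ball assms(1) by (simp add: homology_ball_def)
  then show ?thesis using assms(2)
    by (auto simp: sphere_homology_def acyclic_complex_def face_dim_def)
qed

lemma small_face_in_bd: "\<sigma> \<in> Y \<Longrightarrow> card \<sigma> < n \<Longrightarrow> \<sigma> \<in> bd"
  using stacked_ball by (simp add: stacked_homology_ball_def face_dim_def)

lemma bd_sphere: "homology_sphere R (int n - 1) bd"
  using ball by (simp add: homology_ball_def)

lemma bd_complex: "simplicial_complex bd" and bd_dim: "complex_of_dim (int n - 1) bd"
  using bd_sphere by (simp_all add: homology_sphere_def complex_of_dim_def)

lemma bd_subset: "bd \<subseteq> Y"
  by (auto simp: ball_boundary_def)

lemma bd_zero_homology:
  assumes "\<sigma> \<in> bd" "j \<noteq> int n - 1 - int (card \<sigma>)"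
  shows "zero_space (reduced_homology R (link bd \<sigma>) j)"
  using bd_sphere assms by (auto simp: homology_sphere_def sphere_homology_def face_dim_def)

text \<open>As long as \<open>\<tau>\<close> has at most \<open>n\<close> vertices, degree -1 is not
  the top degree of its link, so the link has a vertex and \<open>\<tau>\<close> can be
  enlarged.\<close>

lemma face_in_facet: "\<sigma> \<in> Y \<Longrightarrow> \<exists>f\<in>facets. \<sigma> \<subseteq> f"
proof -
  assume \<sigma>: "\<sigma> \<in> Y"
  have "\<exists>v. v \<notin> \<tau> \<and> insert v \<tau> \<in> Y" if "\<tau> \<in> Y" "card \<tau> < n + 1" for \<tau>
    using zero_homology_imp_vertex[OF simplicial_complex_link[OF Y_complex that(1)] Y_zero_homology[OF that(1)]] that
    by (simp add: singleton_in_link)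
  then have "\<exists>f\<in>Y. card f = n + 1 \<and> \<sigma> \<subseteq> f"
    by (intro extend_to_facet) (use \<sigma> Y_card simplicial_complexD(4)[OF Y_complex] in auto)
  then show ?thesis by blast
qed

lemma bd_face_in_ridge: "\<sigma> \<in> bd \<Longrightarrow> \<exists>\<rho>\<in>bd. card \<rho> = n \<and> \<sigma> \<subseteq> \<rho>"
proof -
  assume \<sigma>: "\<sigma> \<in> bd"
  have "\<exists>v. v \<notin> \<tau> \<and> insert v \<tau> \<in> bd" if "\<tau> \<in> bd" "card \<tau> < n" for \<tau>
    using zero_homology_imp_vertex[OF simplicial_complex_link[OF bd_complex that(1)] bd_zero_homology[OF that(1)]] that
    by (simp add: singleton_in_link)
  then show ?thesis using card_face_le[OF bd_dim \<sigma>]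
    by (intro extend_to_facet) (use \<sigma> simplicial_complexD(4)[OF bd_complex] in auto)
qed

text \<open>The link of a ridge is a set of points. It is acyclic exactly for boundary ridges, which
  makes it one point; otherwise it is a 0-sphere and hence two points.\<close>

lemma ridge_cases:
  assumes "\<rho> \<in> Y" "card \<rho> = n"
  shows "\<rho> \<in> bd \<and> (\<exists>v. \<forall>u. u \<notin> \<rho> \<and> insert u \<rho> \<in> Y \<longleftrightarrow> u = v) \<or>
    \<rho> \<notin> bd \<and> (\<exists>v w. v \<noteq> w \<and> (\<forall>u. u \<notin> \<rho> \<and> insert u \<rho> \<in> Y \<longleftrightarrow> u = v \<or> u = w))"
proof -
  note L = simplicial_complex_link[OF Y_complex assms(1)]
  note \<rho>fin = simplicial_complexD(4)[OF Y_complex assms(1)]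
  have pts: "card \<tau> \<le> 1" if "\<tau> \<in> link Y \<rho>" for \<tau>
  proof -
    have "\<tau> \<inter> \<rho> = {}" "\<tau> \<union> \<rho> \<in> Y" using that by (auto simp: link_def)
    moreover have "finite \<tau>" using simplicial_complexD(4)[OF L that] .
    ultimately show ?thesis using Y_card[of "\<tau> \<union> \<rho>"] \<rho>fin assms(2) by (simp add: card_Un_disjoint)
  qed
  show ?thesis
  proof (cases "acyclic_complex R (link Y \<rho>)")
    case True
    then obtain v where "\<And>w. {w} \<in> link Y \<rho> \<longleftrightarrow> w = v" using acyclic_points[OF L pts] by blast
    then have "\<forall>u. u \<notin> \<rho> \<and> insert u \<rho> \<in> Y \<longleftrightarrow> u = v" by (simp add: singleton_in_link)
    moreover have "\<rho> \<in> bd" using True assms(1) by (simp add: ball_boundary_def)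
    ultimately show ?thesis by metis
  next
    case False
    have "\<rho> \<noteq> {}" using assms(2) n_pos by auto
    then have "sphere_homology R (int n - face_dim \<rho> - 1) (link Y \<rho>)"
      using ball assms(1) False by (auto simp: homology_ball_def)
    then have "sphere_homology R 0 (link Y \<rho>)" using assms(2) by (simp add: face_dim_def)
    then obtain v w where "v \<noteq> w" "\<And>u. {u} \<in> link Y \<rho> \<longleftrightarrow> u = v \<or> u = w"
      using sphere_points[OF L pts] by blast
    then have "v \<noteq> w \<and> (\<forall>u. u \<notin> \<rho> \<and> insert u \<rho> \<in> Y \<longleftrightarrow> u = v \<or> u = w)"
      by (simp add: singleton_in_link)
    moreover have "\<rho> \<notin> bd" using False by (simp add: ball_boundary_def)
    ultimately show ?thesis by metis
  qed
qed

lemma facet_over_ridge: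
  assumes "g \<in> facets" "\<rho> \<subseteq> g" "card \<rho> = n"
  obtains u where "g = insert u \<rho>" "u \<notin> \<rho>" "insert u \<rho> \<in> Y"
proof -
  have "finite g" using assms(1) simplicial_complexD(4)[OF Y_complex] by auto
  then have "card (g - \<rho>) = 1" using assms by (simp add: card_Diff_subset finite_subset)
  then obtain u where "g - \<rho> = {u}" by (auto simp: card_1_singleton_iff)
  then have "g = insert u \<rho>" "u \<notin> \<rho>" using assms(2) by auto
  then show ?thesis using that assms(1) by auto
qed

lemma ridge_in_Y: "g \<in> facets \<Longrightarrow> \<rho> \<subseteq> g \<Longrightarrow> \<rho> \<in> Y"
  using simplicial_complexD(3)[OF Y_complex] by blast

lemma bd_ridge_iff:
  assumes "\<rho> \<in> Y" "card \<rho> = n"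
  shows "\<rho> \<in> bd \<longleftrightarrow> (\<exists>!g. g \<in> facets \<and> \<rho> \<subseteq> g)"
proof -
  note \<rho>fin = simplicial_complexD(4)[OF Y_complex assms(1)]
  have facet: "insert u \<rho> \<in> facets" if "u \<notin> \<rho>" "insert u \<rho> \<in> Y" for u
    using that \<rho>fin assms(2) by simp
  from ridge_cases[OF assms] show ?thesis
  proof (elim disjE conjE exE)
    fix v assume b: "\<rho> \<in> bd" and v: "\<forall>u. u \<notin> \<rho> \<and> insert u \<rho> \<in> Y \<longleftrightarrow> u = v"
    have "g = insert v \<rho>" if "g \<in> facets" "\<rho> \<subseteq> g" for g
      using facet_over_ridge[OF that assms(2)] v by metis
    moreover have "insert v \<rho> \<in> facets" using v facet by metis
    ultimately have "\<exists>!g. g \<in> facets \<and> \<rho> \<subseteq> g" by (intro ex1I[of _ "insert v \<rho>"]) auto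
    then show ?thesis using b by simp
  next
    fix v w assume b: "\<rho> \<notin> bd" and vw: "v \<noteq> w" "\<forall>u. u \<notin> \<rho> \<and> insert u \<rho> \<in> Y \<longleftrightarrow> u = v \<or> u = w"
    have "insert v \<rho> \<in> facets" "insert w \<rho> \<in> facets" using vw facet by metis+
    moreover have "insert v \<rho> \<noteq> insert w \<rho>" using vw by (metis insertE insertI1)
    ultimately have "\<not> (\<exists>!g. g \<in> facets \<and> \<rho> \<subseteq> g)" by (metis subset_insertI)
    then show ?thesis using b by simp
  qed
qed

text \<open>The boundary sphere is pure, so it is generated by its ridges, and these are recognised
  by lying in a unique facet. Thus the homological boundary depends on the facets alone.\<close>

lemma bd_eq_stacked_boundary: "bd = stacked_boundary n facets"
proof (rule Set.set_eqI)
  fix \<sigma>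
  show "\<sigma> \<in> bd \<longleftrightarrow> \<sigma> \<in> stacked_boundary n facets"
  proof
    assume "\<sigma> \<in> bd"
    then obtain \<rho> where \<rho>: "\<rho> \<in> bd" "card \<rho> = n" "\<sigma> \<subseteq> \<rho>" using bd_face_in_ridge by blast
    then have "\<rho> \<in> Y" using bd_subset by blast
    then have "\<exists>!g. g \<in> facets \<and> \<rho> \<subseteq> g" using bd_ridge_iff \<rho> by blast
    moreover have "finite \<rho>" using simplicial_complexD(4)[OF Y_complex \<open>\<rho> \<in> Y\<close>] .
    ultimately have "\<rho> \<in> boundary_ridges n facets" using \<rho>(2) by (simp add: boundary_ridges_def)
    then show "\<sigma> \<in> stacked_boundary n facets" using \<rho>(3) by (auto simp: generated_complex_def)
  next
    assume "\<sigma> \<in> stacked_boundary n facets"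
    then obtain \<rho> where \<rho>: "\<rho> \<in> boundary_ridges n facets" "\<sigma> \<subseteq> \<rho>" by (auto simp: generated_complex_def)
    then have ex: "\<exists>!g. g \<in> facets \<and> \<rho> \<subseteq> g" and c: "card \<rho> = n" by (auto simp: boundary_ridges_def)
    then have "\<rho> \<in> Y" using ridge_in_Y by blast
    then have "\<rho> \<in> bd" using bd_ridge_iff[OF _ c] ex by blast
    then show "\<sigma> \<in> bd" using simplicial_complexD(3)[OF bd_complex] \<rho>(2) by blast
  qed
qed

text \<open>If the facets around \<open>\<sigma>\<close> split into two parts sharing no ridge, then a maximal
  intersection of facets from both parts has a disconnected link of positive dimension.\<close>

lemma star_connected:
  assumes ne: "A \<noteq> {}" and A: "A \<subseteq> {f \<in> facets. \<sigma> \<subseteq> f}"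
    and closed: "\<And>a b. a \<in> A \<Longrightarrow> b \<in> facets \<Longrightarrow> \<sigma> \<subseteq> b \<Longrightarrow> card (a \<inter> b) = n \<Longrightarrow> b \<in> A"
  shows "{f \<in> facets. \<sigma> \<subseteq> f} \<subseteq> A"
proof (rule ccontr)
  assume not: "\<not> ?thesis"
  let ?B = "{f \<in> facets. \<sigma> \<subseteq> f} - A"
  define T where "T = (\<lambda>(a, b). a \<inter> b) ` (A \<times> ?B)"
  have "finite Y" using simplicial_complexD(5)[OF Y_complex] .
  moreover have "A \<subseteq> Y" "?B \<subseteq> Y" using A by auto
  ultimately have "finite A" "finite ?B" using finite_subset by blast+
  then have "finite T" by (simp add: T_def)
  moreover have "T \<noteq> {}" using ne not by (auto simp: T_def)
  ultimately obtain \<tau> where \<tau>: "\<tau> \<in> T" and max: "\<And>\<tau>'. \<tau>' \<in> T \<Longrightarrow> \<tau> \<subseteq> \<tau>' \<Longrightarrow> \<tau> = \<tau>'"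
    using finite_has_maximal[of T] by blast
  from \<tau> obtain a0 b0 where ab: "a0 \<in> A" "b0 \<in> ?B" "\<tau> = a0 \<inter> b0" by (auto simp: T_def)
  have a0: "a0 \<in> Y" "card a0 = n + 1" "\<sigma> \<subseteq> a0" and b0: "b0 \<in> facets" "b0 \<in> Y" "card b0 = n + 1" "\<sigma> \<subseteq> b0" "b0 \<notin> A"
    using ab A by auto
  have fin: "finite a0" "finite b0" using a0 b0 simplicial_complexD(4)[OF Y_complex] by auto
  have \<tau>Y: "\<tau> \<in> Y" using simplicial_complexD(3)[OF Y_complex a0(1)] ab(3) by blast
  have "a0 \<noteq> b0" using ab by auto
  have "\<not> a0 \<subseteq> b0"
    using \<open>a0 \<noteq> b0\<close> card_subset_eq[OF fin(2), of a0] a0(2) b0(3) by auto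
  have "\<not> b0 \<subseteq> a0"
    using \<open>a0 \<noteq> b0\<close> card_subset_eq[OF fin(1), of b0] a0(2) b0(3) by auto
  obtain p where p: "p \<in> a0" "p \<notin> \<tau>" using \<open>\<not> a0 \<subseteq> b0\<close> ab(3) by auto
  obtain q where q: "q \<in> b0" "q \<notin> \<tau>" using \<open>\<not> b0 \<subseteq> a0\<close> ab(3) by auto
  have "card \<tau> < card a0" using p ab(3) fin by (intro psubset_card_mono) auto
  \<comment> \<open>If \<open>\<tau>\<close> were a ridge, crossing it would put \<open>b0\<close>
    into \<open>A\<close>. With fewer than \<open>n\<close> vertices it has a link whose top degree
    is positive, so degree 0 vanishes.\<close>
  moreover have "card \<tau> \<noteq> n" using closed[OF ab(1) b0(1,4)] b0(5) ab(3) by auto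
  ultimately have "zero_space (reduced_homology R (link Y \<tau>) 0)"
    using a0(2) by (intro Y_zero_homology[OF \<tau>Y]) auto
  note conn = zero_homology_imp_connected[OF simplicial_complex_link[OF Y_complex \<tau>Y] this]
  let ?P = "{x. x \<notin> \<tau> \<and> (\<exists>a\<in>A. insert x \<tau> \<subseteq> a)}"
  \<comment> \<open>A vertex \<open>x\<close> of the link of \<open>\<tau>\<close> that is seen from
    both parts would produce a larger common face, against the maximality of
    \<open>\<tau>\<close>.\<close>
  have sep: False if "a \<in> A" "b \<in> ?B" "insert x \<tau> \<subseteq> a" "x \<in> b" "\<tau> \<subseteq> b" "x \<notin> \<tau>" for a b x
  proof -
    have "a \<inter> b \<in> T" using that(1,2) by (force simp: T_def)
    then show False using max[of "a \<inter> b"] that by auto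
  qed
  have "q \<in> ?P"
  proof (rule conn)
    show "{p} \<in> link Y \<tau>" "p \<in> ?P"
      using p ab simplicial_complexD(3)[OF Y_complex a0(1), of "insert p \<tau>"] by (auto simp: singleton_in_link)
    show "{q} \<in> link Y \<tau>"
      using q ab simplicial_complexD(3)[OF Y_complex b0(2), of "insert q \<tau>"] by (auto simp: singleton_in_link)
    fix x y assume x: "x \<in> ?P" and xy: "{x, y} \<in> link Y \<tau>"
    then have "{x, y} \<union> \<tau> \<in> Y" "y \<notin> \<tau>" by (auto simp: link_def)
    then obtain c where c: "c \<in> facets" "{x, y} \<union> \<tau> \<subseteq> c" using face_in_facet by blast
    have "\<sigma> \<subseteq> c" using ab(3) a0(3) b0(4) c(2) by blast
    obtain a where a: "a \<in> A" "insert x \<tau> \<subseteq> a" using x by auto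
    have "c \<in> A"
    proof (rule ccontr)
      assume "c \<notin> A"
      then have "c \<in> ?B" using c(1) \<open>\<sigma> \<subseteq> c\<close> by simp
      then show False using sep[OF a(1) _ a(2)] c(2) x by auto
    qed
    then show "y \<in> ?P" using c(2) \<open>y \<notin> \<tau>\<close> by auto
  qed
  then obtain a where "a \<in> A" "insert q \<tau> \<subseteq> a" by auto
  then show False using sep[of a b0 q] ab q by auto
qed

section \<open>Chains across interior ridges and bridges of the dual graph\<close>

lemma at_most_two_facets:
  assumes "card \<rho> = n" "{f, g, h} \<subseteq> facets" "\<rho> \<subseteq> f \<inter> g \<inter> h"
  shows "f = g \<or> f = h \<or> g = h"
proof -
  have \<rho>: "\<rho> \<in> Y" using ridge_in_Y[of f \<rho>] assms by auto
  obtain x where x: "f = insert x \<rho>" "x \<notin> \<rho>" "insert x \<rho> \<in> Y"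
    using facet_over_ridge[of f \<rho>] assms by auto
  obtain y where y: "g = insert y \<rho>" "y \<notin> \<rho>" "insert y \<rho> \<in> Y"
    using facet_over_ridge[of g \<rho>] assms by auto
  obtain z where z: "h = insert z \<rho>" "z \<notin> \<rho>" "insert z \<rho> \<in> Y"
    using facet_over_ridge[of h \<rho>] assms by auto
  from ridge_cases[OF \<rho> assms(1)] have "x = y \<or> x = z \<or> y = z"
  proof (elim disjE conjE exE)
    fix v assume "\<forall>u. u \<notin> \<rho> \<and> insert u \<rho> \<in> Y \<longleftrightarrow> u = v"
    then have "x = v" "y = v" using x y by metis+
    then show ?thesis by simp
  next
    fix v w assume "\<forall>u. u \<notin> \<rho> \<and> insert u \<rho> \<in> Y \<longleftrightarrow> u = v \<or> u = w"
    then have "x = v \<or> x = w" "y = v \<or> y = w" "z = v \<or> z = w" using x y z by metis+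
    then show ?thesis by auto
  qed
  then show ?thesis using x y z by auto
qed

text \<open>Exactly two facets contain an interior ridge, so only two coefficients enter. The signs
  are chosen before the chain, since two different chains will be compared at the same
  ridge.\<close>

lemma boundary_at_interior_ridge:
  assumes f: "f \<in> facets" and g: "g \<in> facets" and card: "card (f \<inter> g) = n"
  shows "f \<inter> g \<in> Y - bd"
    "\<exists>s\<in>{\<one>, \<ominus> \<one>}. \<exists>t\<in>{\<one>, \<ominus> \<one>}. \<forall>c\<in>carrier (chain_space R Y (int n)).
      boundary_map R Y c (f \<inter> g) = s \<otimes> c f \<oplus> t \<otimes> c g"
proof -
  let ?\<rho> = "f \<inter> g"
  have \<rho>Y: "?\<rho> \<in> Y" using ridge_in_Y[OF f] by blast
  obtain x where x: "f = insert x ?\<rho>" "x \<notin> ?\<rho>" "insert x ?\<rho> \<in> Y"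
    using facet_over_ridge[OF f _ card] by blast
  obtain y where y: "g = insert y ?\<rho>" "y \<notin> ?\<rho>" "insert y ?\<rho> \<in> Y"
    using facet_over_ridge[OF g _ card] by blast
  have "card (f \<inter> f) \<noteq> n" using f by simp
  then have "f \<noteq> g" using card by metis
  then have "x \<noteq> y" using x(1) y(1) by metis
  then have "\<not> (\<forall>u. u \<notin> ?\<rho> \<and> insert u ?\<rho> \<in> Y \<longleftrightarrow> u = v)" for v
    using x(2,3) y(2,3) by metis
  then obtain v w where nb: "?\<rho> \<notin> bd" and vw: "\<And>u. u \<notin> ?\<rho> \<and> insert u ?\<rho> \<in> Y \<longleftrightarrow> u = v \<or> u = w"
    using ridge_cases[OF \<rho>Y card] by metis
  have "{v, w} = {x, y}" using vw[of x] vw[of y] x y \<open>x \<noteq> y\<close> by auto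
  then have set: "{u. u \<notin> ?\<rho> \<and> insert u ?\<rho> \<in> Y} = {x, y}" using vw by auto
  show "f \<inter> g \<in> Y - bd" using \<rho>Y nb by simp
  have "boundary_map R Y c ?\<rho> = incidence_sign x ?\<rho> \<otimes> c f \<oplus> incidence_sign y ?\<rho> \<otimes> c g"
    if "c \<in> carrier (chain_space R Y (int n))" for c
  proof -
    have cc: "c \<sigma> \<in> carrier R" for \<sigma> using that by (simp add: carrier_chain_space)
    have "boundary_map R Y c ?\<rho> = (\<Oplus>u\<in>{x, y}. incidence_sign u ?\<rho> \<otimes> c (insert u ?\<rho>))"
      unfolding boundary_map_def set incidence_sign_def ..
    also have "\<dots> = incidence_sign x ?\<rho> \<otimes> c (insert x ?\<rho>) \<oplus> incidence_sign y ?\<rho> \<otimes> c (insert y ?\<rho>)"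
      using \<open>x \<noteq> y\<close> cc by (simp add: Pi_def)
    finally show ?thesis using x(1) y(1) by simp
  qed
  then show "\<exists>s\<in>{\<one>, \<ominus> \<one>}. \<exists>t\<in>{\<one>, \<ominus> \<one>}. \<forall>c\<in>carrier (chain_space R Y (int n)).
      boundary_map R Y c (f \<inter> g) = s \<otimes> c f \<oplus> t \<otimes> c g"
    using incidence_sign_cases[of x ?\<rho>] incidence_sign_cases[of y ?\<rho>]
    by (intro bexI[of _ "incidence_sign x ?\<rho>"] bexI[of _ "incidence_sign y ?\<rho>"]) auto
qed

text \<open>Signs are their own inverses, so the factor is \<open>\<ominus> (s \<otimes> t)\<close>.
  It does not depend on \<open>x\<close> and \<open>y\<close>, hence is the same for every chain
  that is closed at a given ridge.\<close>

lemma signed_sum_zeroD: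
  assumes "s \<in> {\<one>, \<ominus> \<one>}" "t \<in> {\<one>, \<ominus> \<one>}"
  obtains u where "u \<in> carrier R"
    "\<And>x y. x \<in> carrier R \<Longrightarrow> y \<in> carrier R \<Longrightarrow> s \<otimes> x \<oplus> t \<otimes> y = \<zero> \<Longrightarrow> x = u \<otimes> y"
proof -
  have st: "s \<in> carrier R" "t \<in> carrier R" "s \<otimes> s = \<one>" using assms by (auto simp: l_minus minus_minus)
  have "x = \<ominus> (s \<otimes> t) \<otimes> y" if xy: "x \<in> carrier R" "y \<in> carrier R" "s \<otimes> x \<oplus> t \<otimes> y = \<zero>" for x y
  proof -
    have "s \<otimes> x = \<ominus> (t \<otimes> y)" using xy st by (metis m_closed minus_equality minus_minus)
    then have "s \<otimes> (s \<otimes> x) = s \<otimes> \<ominus> (t \<otimes> y)" by simp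
    then have "x = s \<otimes> \<ominus> (t \<otimes> y)" using xy st by (simp add: m_assoc[symmetric])
    then show ?thesis using xy st by (simp add: r_minus l_minus m_assoc)
  qed
  then show ?thesis using that[of "\<ominus> (s \<otimes> t)"] st by blast
qed

text \<open>The generating cycle of the boundary sphere bounds a chain \<open>w\<close> in the
  acyclic ball. Across an interior ridge the coefficients of \<open>w\<close> agree up to sign, so
  its nonempty support spreads over all facets by \<open>star_connected\<close>.\<close>

lemma fundamental_chain:
  obtains w where "w \<in> carrier (chain_space R Y (int n))" "\<And>f. f \<in> facets \<Longrightarrow> w f \<noteq> \<zero>"
    "\<And>\<tau>. \<tau> \<notin> bd \<Longrightarrow> boundary_map R Y w \<tau> = \<zero>"
proof -
  note finY = simplicial_complexD(1)[OF Y_complex]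
  have top: "\<forall>\<sigma>\<in>bd. face_dim \<sigma> \<noteq> (int n - 1) + 1"
    using card_face_le[OF bd_dim] by (fastforce simp: face_dim_def)
  have "{} \<in> bd" using simplicial_complexD(2)[OF bd_complex] .
  then have "sphere_homology R (int n - 1) bd"
    using bd_sphere by (auto simp: homology_sphere_def face_dim_def)
  then have iso: "iso_to_field R (reduced_homology R bd (int n - 1))" by (simp add: sphere_homology_def)
  from top_homology_line[OF top iso] obtain z where "is_cycle bd (int n - 1) z \<and> z \<noteq> (\<lambda>\<sigma>. \<zero>) \<and>
    (\<forall>c. is_cycle bd (int n - 1) c \<longrightarrow> (\<exists>t\<in>carrier R. c = (\<lambda>\<sigma>. t \<otimes> z \<sigma>)))" ..
  then have z: "is_cycle bd (int n - 1) z" "z \<noteq> (\<lambda>\<sigma>. \<zero>)" by simp_all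
  have "is_cycle Y (int n - 1) z"
    using z(1) bd_subset boundary_map_cong[OF chain_on_chain_space bd_subset finY, of z "int n - 1"]
    by (auto simp: carrier_chain_space)
  moreover have "zero_space (reduced_homology R Y (int n - 1))"
    using Y_zero_homology[OF simplicial_complexD(2)[OF Y_complex], of "int n - 1"] by simp
  ultimately obtain w where w: "w \<in> carrier (chain_space R Y (int n))" "boundary_map R Y w = z"
    using zero_space_cycle[of Y "int n - 1" z] by auto
  have wc: "w \<sigma> \<in> carrier R" for \<sigma> using w(1) by (simp add: carrier_chain_space)
  have interior: "boundary_map R Y w \<tau> = \<zero>" if "\<tau> \<notin> bd" for \<tau>
    using that w(2) z(1) by (auto simp: carrier_chain_space)
  let ?A = "{f \<in> facets. w f \<noteq> \<zero>}"
  have "{f \<in> facets. {} \<subseteq> f} \<subseteq> ?A"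
  proof (rule star_connected)
    show "?A \<noteq> {}"
    proof
      assume e: "?A = {}"
      have "w \<sigma> = \<zero>" for \<sigma>
      proof (cases "\<sigma> \<in> Y \<and> face_dim \<sigma> = int n")
        case True
        then have "\<sigma> \<in> facets" by (simp add: face_dim_def)
        then show ?thesis using e by blast
      qed (use w(1) in \<open>auto simp: carrier_chain_space\<close>)
      then have "w = (\<lambda>\<sigma>. \<zero>)" by (rule ext)
      then show False using w(2) z(2) boundary_map_zero by metis
    qed
    fix a b assume a: "a \<in> ?A" and b: "b \<in> facets" and card: "card (a \<inter> b) = n"
    then have aF: "a \<in> facets" by simp
    obtain s t where st: "s \<in> {\<one>, \<ominus> \<one>}" "t \<in> {\<one>, \<ominus> \<one>}"
      "boundary_map R Y w (a \<inter> b) = s \<otimes> w a \<oplus> t \<otimes> w b"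
      using boundary_at_interior_ridge(2)[OF aF b card] w(1) by blast
    moreover have "boundary_map R Y w (a \<inter> b) = \<zero>"
      using interior boundary_at_interior_ridge(1)[OF aF b card] by simp
    ultimately have "s \<otimes> w a \<oplus> t \<otimes> w b = \<zero>" by simp
    then obtain u where "u \<in> carrier R" "w a = u \<otimes> w b" using signed_sum_zeroD[OF st(1,2)] wc by metis
    then show "b \<in> ?A" using a b by auto
  qed auto
  then show ?thesis using that[OF w(1)] interior by blast
qed

lemma jump_chain:
  assumes f: "f \<in> facets" and g: "g \<in> facets" and card: "card (f \<inter> g) = n"
  obtains c where "c \<in> carrier (chain_space R Y (int n))" "boundary_map R Y c (f \<inter> g) = \<one>"
    "\<And>\<tau>. \<tau> \<notin> bd \<Longrightarrow> \<tau> \<noteq> f \<inter> g \<Longrightarrow> boundary_map R Y c \<tau> = \<zero>"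
proof -
  let ?\<rho> = "f \<inter> g"
  note finY = simplicial_complexD(1)[OF Y_complex]
  have \<rho>: "?\<rho> \<in> Y" "?\<rho> \<notin> bd" using boundary_at_interior_ridge(1)[OF assms] by auto
  \<comment> \<open>The coefficient \<open>a\<close> provides both the ridge and its negative, so
    that additivity of the boundary suffices; \<open>b\<close> will bound the boundary of the
    negative.\<close>
  define e where "e a = (\<lambda>\<sigma>. if \<sigma> = ?\<rho> then a else \<zero>)" for a
  have e: "chain_on Y (e a)" "e a \<in> carrier (chain_space R Y (int n - 1))" if "a \<in> carrier R" for a
    using that \<rho> card by (auto simp: e_def chain_on_def carrier_chain_space face_dim_def)
  have "boundary_map R Y (e (\<ominus> \<one>)) \<in> carrier (chain_space R bd (int n - 2))"
    unfolding carrier_chain_space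
  proof (intro conjI allI impI)
    fix \<tau>
    show "boundary_map R Y (e (\<ominus> \<one>)) \<tau> \<in> carrier R" by (rule boundary_map_closed[OF e(1) finY]) simp
    assume not: "\<not> (\<tau> \<in> bd \<and> face_dim \<tau> = int n - 2)"
    show "boundary_map R Y (e (\<ominus> \<one>)) \<tau> = \<zero>"
    proof (rule ccontr)
      assume "boundary_map R Y (e (\<ominus> \<one>)) \<tau> \<noteq> \<zero>"
      then obtain v where v: "v \<notin> \<tau>" "e (\<ominus> \<one>) (insert v \<tau>) \<noteq> \<zero>"
        using boundary_map_nonzeroD[OF e(1) finY, of "\<ominus> \<one>" \<tau>] by auto
      then have eq: "insert v \<tau> = ?\<rho>" unfolding e_def by presburger
      then have "finite (insert v \<tau>)" "\<tau> \<in> Y"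
        using \<rho>(1) simplicial_complexD(3,4)[OF Y_complex \<rho>(1)] by (metis, blast)
      then have "card \<tau> + 1 = n" using v(1) eq card by (metis Suc_eq_plus1 card_insert_disjoint finite_insert)
      then have "\<tau> \<in> bd" "face_dim \<tau> = int n - 2"
        using small_face_in_bd[OF \<open>\<tau> \<in> Y\<close>] by (auto simp: face_dim_def)
      then show False using not by simp
    qed
  qed
  \<comment> \<open>This boundary was formed in \<open>Y\<close> but has to be a cycle of the
    subcomplex \<open>bd\<close>; on chains of \<open>bd\<close> the two boundary maps
    agree.\<close>
  moreover from this have "boundary_map R bd (boundary_map R Y (e (\<ominus> \<one>))) = (\<lambda>\<tau>. \<zero>)"
    using boundary_map_cong[OF chain_on_chain_space bd_subset finY]
      boundary_map_boundary_map[OF Y_complex e(1), of "\<ominus> \<one>"] by fastforce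
  ultimately have "is_cycle bd (int n - 2) (boundary_map R Y (e (\<ominus> \<one>)))" ..
  moreover have "zero_space (reduced_homology R bd (int n - 2))"
    using bd_zero_homology[OF simplicial_complexD(2)[OF bd_complex], of "int n - 2"] by simp
  ultimately obtain b where "b \<in> carrier (chain_space R bd (int n - 2 + 1))"
    and bb: "boundary_map R bd b = boundary_map R Y (e (\<ominus> \<one>))"
    using zero_space_cycle by blast
  then have b: "b \<in> carrier (chain_space R bd (int n - 1))" by (simp add: algebra_simps)
  have bY: "chain_on Y b" using b bd_subset by (auto simp: carrier_chain_space chain_on_def)
  let ?h = "\<lambda>\<sigma>. e \<one> \<sigma> \<oplus> b \<sigma>"
  have h\<tau>: "?h \<tau> = (if \<tau> = ?\<rho> then \<one> else \<zero>)" if "\<tau> \<notin> bd" for \<tau>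
    using b that by (auto simp: carrier_chain_space e_def)
  have "is_cycle Y (int n - 1) ?h"
  proof
    show "?h \<in> carrier (chain_space R Y (int n - 1))"
      using e(2)[OF one_closed] b bd_subset by (auto simp: carrier_chain_space)
    have "boundary_map R Y ?h \<tau> = \<zero>" for \<tau>
    proof -
      have "boundary_map R Y ?h \<tau> = boundary_map R Y (e \<one>) \<tau> \<oplus> boundary_map R Y b \<tau>"
        by (rule boundary_map_add[OF e(1) bY finY]) simp
      also have "boundary_map R Y b = boundary_map R Y (e (\<ominus> \<one>))"
        using bb boundary_map_cong[OF chain_on_chain_space[OF b] bd_subset finY] by simp
      also have "boundary_map R Y (e \<one>) \<tau> \<oplus> boundary_map R Y (e (\<ominus> \<one>)) \<tau> =
        boundary_map R Y (\<lambda>\<sigma>. e \<one> \<sigma> \<oplus> e (\<ominus> \<one>) \<sigma>) \<tau>"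
        by (rule boundary_map_add[OF e(1) e(1) finY, symmetric]) simp_all
      also have "(\<lambda>\<sigma>. e \<one> \<sigma> \<oplus> e (\<ominus> \<one>) \<sigma>) = (\<lambda>\<sigma>. \<zero>)"
        by (auto simp: e_def r_neg)
      finally show ?thesis by (simp add: boundary_map_zero)
    qed
    then show "boundary_map R Y ?h = (\<lambda>\<tau>. \<zero>)" by (rule ext)
  qed
  moreover have "zero_space (reduced_homology R Y (int n - 1))"
    using Y_zero_homology[OF simplicial_complexD(2)[OF Y_complex], of "int n - 1"] by simp
  ultimately obtain c where "c \<in> carrier (chain_space R Y (int n - 1 + 1))" "boundary_map R Y c = ?h"
    using zero_space_cycle by blast
  then show ?thesis using that[of c] h\<tau> \<rho>(2) by simp
qed

lemma cross_ratio:
  assumes "x \<in> carrier R" "y \<in> carrier R" "w \<in> carrier R - {\<zero>}" "z \<in> carrier R - {\<zero>}"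
    and "x \<otimes> z = y \<otimes> w"
  shows "x \<otimes> inv w = y \<otimes> inv z"
proof -
  have i: "inv w \<in> carrier R" "inv z \<in> carrier R" "w \<otimes> inv w = \<one>" "z \<otimes> inv z = \<one>"
    using assms(3,4) field_Units by auto
  have "x \<otimes> z \<otimes> inv z = x" using i(4) i(2) assms(1-4) by (simp add: m_assoc)
  then have "x \<otimes> inv w = x \<otimes> z \<otimes> inv z \<otimes> inv w" by simp
  also have "\<dots> = y \<otimes> w \<otimes> inv z \<otimes> inv w" using assms(5) by simp
  also have "\<dots> = y \<otimes> inv z \<otimes> (w \<otimes> inv w)" using i(1,2) assms by (simp add: m_ac)
  finally show ?thesis using i assms by simp
qed

text \<open>At any other interior ridge \<open>c\<close> and \<open>w\<close> satisfy the same
  signed relation, so the quotients on its two sides agree. If they agreed across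
  \<open>f \<inter> g\<close> as well, the boundary of \<open>c\<close> there would be a multiple of
  that of \<open>w\<close>, hence zero instead of one.\<close>

lemma ridge_is_bridge:
  assumes f: "f \<in> facets" and g: "g \<in> facets" and card: "card (f \<inter> g) = n"
  shows "\<exists>r :: 'v set \<Rightarrow> 'a. r f \<noteq> r g \<and>
    (\<forall>a\<in>facets. \<forall>b\<in>facets. card (a \<inter> b) = n \<longrightarrow> a \<inter> b \<noteq> f \<inter> g \<longrightarrow> r a = r b)"
proof -
  obtain w where w: "w \<in> carrier (chain_space R Y (int n))" "\<And>f. f \<in> facets \<Longrightarrow> w f \<noteq> \<zero>"
    "\<And>\<tau>. \<tau> \<notin> bd \<Longrightarrow> boundary_map R Y w \<tau> = \<zero>" using fundamental_chain by blast
  obtain c where c: "c \<in> carrier (chain_space R Y (int n))" "boundary_map R Y c (f \<inter> g) = \<one>"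
    "\<And>\<tau>. \<tau> \<notin> bd \<Longrightarrow> \<tau> \<noteq> f \<inter> g \<Longrightarrow> boundary_map R Y c \<tau> = \<zero>"
    using jump_chain[OF assms] by blast
  have wc: "w \<sigma> \<in> carrier R" "c \<sigma> \<in> carrier R" for \<sigma> using w(1) c(1) by (auto simp: carrier_chain_space)
  have wi: "inv (w h) \<in> carrier R" "w h \<otimes> inv (w h) = \<one>" if "h \<in> facets" for h
    using w(2)[OF that] wc field_Units by auto
  define r where "r h = c h \<otimes> inv (w h)" for h
  have cr: "c h = r h \<otimes> w h" "r h \<in> carrier R" if "h \<in> facets" for h
    using wi[OF that] wc[of h] by (simp_all add: r_def m_assoc m_comm[of "inv (w h)"])
  have "r f \<noteq> r g"
  proof
    assume eq: "r f = r g"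
    obtain s t where st: "s \<in> {\<one>, \<ominus> \<one>}" "t \<in> {\<one>, \<ominus> \<one>}"
      "\<And>c. c\<in>carrier (chain_space R Y (int n)) \<Longrightarrow> boundary_map R Y c (f \<inter> g) = s \<otimes> c f \<oplus> t \<otimes> c g"
      using boundary_at_interior_ridge(2)[OF f g card] by blast
    have sc: "s \<in> carrier R" "t \<in> carrier R" using st by auto
    have "\<one> = s \<otimes> (r g \<otimes> w f) \<oplus> t \<otimes> (r g \<otimes> w g)"
      using c(2) st(3)[OF c(1)] cr(1)[OF f] cr(1)[OF g] eq by simp
    also have "\<dots> = r g \<otimes> (s \<otimes> w f \<oplus> t \<otimes> w g)"
      using sc wc cr(2)[OF g] by (simp add: r_distr m_ac)
    also have "s \<otimes> w f \<oplus> t \<otimes> w g = \<zero>"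
      using st(3)[OF w(1)] w(3) boundary_at_interior_ridge(1)[OF f g card] by auto
    finally show False using cr(2)[OF g] one_not_zero by simp
  qed
  moreover have "r a = r b" if a: "a \<in> facets" and b: "b \<in> facets" and ab: "card (a \<inter> b) = n" "a \<inter> b \<noteq> f \<inter> g" for a b
  proof -
    obtain s t where st: "s \<in> {\<one>, \<ominus> \<one>}" "t \<in> {\<one>, \<ominus> \<one>}"
      "\<And>c. c\<in>carrier (chain_space R Y (int n)) \<Longrightarrow> boundary_map R Y c (a \<inter> b) = s \<otimes> c a \<oplus> t \<otimes> c b"
      using boundary_at_interior_ridge(2)[OF a b ab(1)] by blast
    obtain u where u: "u \<in> carrier R"
      "\<And>x y. x \<in> carrier R \<Longrightarrow> y \<in> carrier R \<Longrightarrow> s \<otimes> x \<oplus> t \<otimes> y = \<zero> \<Longrightarrow> x = u \<otimes> y"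
      using signed_sum_zeroD[OF st(1,2)] by blast
    have int: "a \<inter> b \<notin> bd" using boundary_at_interior_ridge(1)[OF a b ab(1)] by simp
    have "c a = u \<otimes> c b" "w a = u \<otimes> w b"
      using u(2) wc st(3)[OF c(1)] st(3)[OF w(1)] c(3)[OF int ab(2)] w(3)[OF int] by metis+
    then have "c a \<otimes> w b = c b \<otimes> w a" using wc u(1) by (simp add: m_ac)
    then show ?thesis unfolding r_def using wc w(2) a b by (intro cross_ratio) auto
  qed
  ultimately show ?thesis by (intro exI[of _ r]) simp
qed

lemma stacked_facets_facets: "stacked_facets n facets"
proof (rule stacked_facets_if_tree)
  show "finite facets" using simplicial_complexD(5)[OF Y_complex] by simp
  show "facets \<noteq> {}" using face_in_facet[OF simplicial_complexD(2)[OF Y_complex]] by blast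
  show "finite f \<and> card f = n + 1" if "f \<in> facets" for f
    using that simplicial_complexD(4)[OF Y_complex] by simp
qed (fact at_most_two_facets star_connected ridge_is_bridge)+

end

section \<open>Homology over the field with two elements\<close>

text \<open>The default simp rules for \<^typ>\<open>bit\<close> turn sums into Boolean conditions.\<close>

declare add_bit_eq_xor [simp del] mult_bit_eq_and [simp del] bit_not_zero_iff [simp del]
  bit_not_one_iff [simp del]

lemma bit_self_add [simp]: "(x :: bit) + x = 0"
  by (cases x) simp_all

lemma sum_symmetric_off_diagonal:
  fixes g :: "'v \<Rightarrow> 'v \<Rightarrow> bit"
  assumes "finite A" "\<And>u v. g u v = g v u"
  shows "(\<Sum>v\<in>A. \<Sum>u\<in>A - {v}. g v u) = 0"
  using assms(1)
proof (induction A)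
  case (insert a A)
  have "(\<Sum>u\<in>insert a A - {v}. g v u) = g a v + (\<Sum>u\<in>A - {v}. g v u)" if "v \<in> A" for v
  proof -
    have "insert a A - {v} = insert a (A - {v})" using insert.hyps that by auto
    then show ?thesis using insert.hyps assms(2)[of v a] by simp
  qed
  then have "(\<Sum>v\<in>A. \<Sum>u\<in>insert a A - {v}. g v u) = (\<Sum>v\<in>A. g a v) + (\<Sum>v\<in>A. \<Sum>u\<in>A - {v}. g v u)"
    by (simp add: sum.distrib)
  moreover have "insert a A - {a} = A" using insert.hyps by auto
  ultimately show ?case using insert by simp
qed simp

section \<open>Chains mod 2 and their splitting at a vertex\<close>

definition bchain :: "'v set set \<Rightarrow> nat \<Rightarrow> ('v set \<Rightarrow> bit) \<Rightarrow> bool" where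
  "bchain X k c \<longleftrightarrow> (\<forall>\<sigma>. c \<sigma> \<noteq> 0 \<longrightarrow> \<sigma> \<in> X \<and> card \<sigma> = k)"

text \<open>When \<open>k\<close> is the number of vertices of a facet, this is the candidate for
  the fundamental cycle mod 2.\<close>

definition all_faces :: "'v set set \<Rightarrow> nat \<Rightarrow> 'v set \<Rightarrow> bit" where
  "all_faces X k = (\<lambda>\<sigma>. of_bool (\<sigma> \<in> X \<and> card \<sigma> = k))"

definition cone :: "'v \<Rightarrow> ('v set \<Rightarrow> bit) \<Rightarrow> 'v set \<Rightarrow> bit" where
  "cone v e = (\<lambda>\<sigma>. if v \<in> \<sigma> then e (\<sigma> - {v}) else 0)"

definition link_chain :: "'v \<Rightarrow> ('v set \<Rightarrow> bit) \<Rightarrow> 'v set \<Rightarrow> bit" where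
  "link_chain v c = (\<lambda>\<tau>. if v \<in> \<tau> then 0 else c (insert v \<tau>))"

definition deletion_chain :: "'v \<Rightarrow> ('v set \<Rightarrow> bit) \<Rightarrow> 'v set \<Rightarrow> bit" where
  "deletion_chain v c = (\<lambda>\<sigma>. if v \<in> \<sigma> then 0 else c \<sigma>)"

lemma chain_decomposition: "c = (\<lambda>\<sigma>. deletion_chain v c \<sigma> + cone v (link_chain v c) \<sigma>)"
  by (auto simp: deletion_chain_def cone_def link_chain_def insert_absorb)

lemma bchain_zero [simp]: "bchain X k (\<lambda>\<sigma>. 0)"
  by (simp add: bchain_def)

lemma bchain_add: "bchain X k b \<Longrightarrow> bchain X k c \<Longrightarrow> bchain X k (\<lambda>\<sigma>. b \<sigma> + c \<sigma>)"
  unfolding bchain_def by (metis add.right_neutral)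

lemma bchain_all_faces: "bchain X k (all_faces X k)"
  by (simp add: bchain_def all_faces_def)

locale finite_vertex_set =
  fixes V :: "'v set"
  assumes finite_V: "finite V"
begin

text \<open>The sum runs over an ambient vertex set and mentions no complex, so one chain can be
  regarded in a complex, a deletion and a link at once.\<close>

definition bd2 :: "('v set \<Rightarrow> bit) \<Rightarrow> 'v set \<Rightarrow> bit" where
  "bd2 c = (\<lambda>\<tau>. \<Sum>v\<in>V - \<tau>. c (insert v \<tau>))"

abbreviation cycle2 :: "'v set set \<Rightarrow> nat \<Rightarrow> ('v set \<Rightarrow> bit) \<Rightarrow> bool" where
  "cycle2 X k c \<equiv> bchain X k c \<and> bd2 c = (\<lambda>\<tau>. 0)"

lemma bd2_zero [simp]: "bd2 (\<lambda>\<sigma>. 0) = (\<lambda>\<tau>. 0)"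
  by (simp add: bd2_def)

lemma bd2_add: "bd2 (\<lambda>\<sigma>. b \<sigma> + c \<sigma>) = (\<lambda>\<tau>. bd2 b \<tau> + bd2 c \<tau>)"
  by (simp add: bd2_def sum.distrib)

lemma bd2_bd2: "bd2 (bd2 c) = (\<lambda>\<tau>. 0)"
proof
  fix \<tau>
  have "V - insert v \<tau> = V - \<tau> - {v}" for v by auto
  then have "bd2 (bd2 c) \<tau> = (\<Sum>v\<in>V - \<tau>. \<Sum>u\<in>V - \<tau> - {v}. c (insert u (insert v \<tau>)))"
    by (simp add: bd2_def)
  also have "\<dots> = 0"
    by (rule sum_symmetric_off_diagonal[where g = "\<lambda>v u. c (insert u (insert v \<tau>))"])
      (simp_all add: finite_V insert_commute)
  finally show "bd2 (bd2 c) \<tau> = 0" .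
qed

lemma bd2_cone:
  assumes "v \<in> V" and e: "\<forall>\<tau>. v \<in> \<tau> \<longrightarrow> e \<tau> = 0"
  shows "bd2 (cone v e) = (\<lambda>\<tau>. e \<tau> + cone v (bd2 e) \<tau>)"
proof
  fix \<tau>
  show "bd2 (cone v e) \<tau> = e \<tau> + cone v (bd2 e) \<tau>"
  proof (cases "v \<in> \<tau>")
    case True
    have "bd2 (cone v e) \<tau> = (\<Sum>u\<in>V - \<tau>. e (insert u (\<tau> - {v})))"
      unfolding bd2_def using True by (intro sum.cong) (auto simp: cone_def insert_Diff_if)
    moreover have "V - (\<tau> - {v}) = insert v (V - \<tau>)" using True assms(1) by auto
    then have "bd2 e (\<tau> - {v}) = e \<tau> + (\<Sum>u\<in>V - \<tau>. e (insert u (\<tau> - {v})))"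
      using True finite_V by (simp add: bd2_def insert_absorb)
    ultimately show ?thesis using True e by (simp add: cone_def)
  next
    case False
    have "bd2 (cone v e) \<tau> = (\<Sum>u\<in>V - \<tau>. if u = v then e \<tau> else 0)"
      unfolding bd2_def using False by (intro sum.cong) (auto simp: cone_def)
    also have "\<dots> = e \<tau>" using False assms(1) finite_V by simp
    finally show ?thesis using False by (simp add: cone_def)
  qed
qed

lemma bd2_link_chain: "v \<in> V \<Longrightarrow> bd2 (link_chain v c) = link_chain v (bd2 c)"
proof
  fix \<tau> assume v: "v \<in> V"
  show "bd2 (link_chain v c) \<tau> = link_chain v (bd2 c) \<tau>"
  proof (cases "v \<in> \<tau>")
    case True
    then show ?thesis by (simp add: bd2_def link_chain_def)
  next
    case False
    have split: "V - \<tau> = insert v (V - insert v \<tau>)" using False v by auto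
    have "finite (V - insert v \<tau>)" "v \<notin> V - insert v \<tau>" using finite_V by auto
    then have "bd2 (link_chain v c) \<tau> = link_chain v c (insert v \<tau>) +
      (\<Sum>u\<in>V - insert v \<tau>. link_chain v c (insert u \<tau>))"
      unfolding bd2_def split by (rule sum.insert)
    also have "\<dots> = (\<Sum>u\<in>V - insert v \<tau>. link_chain v c (insert u \<tau>))"
      by (simp add: link_chain_def)
    also have "\<dots> = bd2 c (insert v \<tau>)"
      unfolding bd2_def using False by (intro sum.cong) (auto simp: link_chain_def insert_commute)
    finally show ?thesis using False by (simp add: link_chain_def)
  qed
qed

text \<open>Degrees count vertices here, so \<open>sphere2 k\<close> describes spheres of dimension \<open>k - 1\<close>. Their
  fundamental cycle is required to be the sum of all facets, so that removing any facet makes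
  them acyclic.\<close>

definition acyclic2 :: "'v set set \<Rightarrow> bool" where
  "acyclic2 X \<longleftrightarrow> (\<forall>k c. cycle2 X k c \<longrightarrow> (\<exists>b. bchain X (Suc k) b \<and> bd2 b = c))"

definition sphere2 :: "nat \<Rightarrow> 'v set set \<Rightarrow> bool" where
  "sphere2 k X \<longleftrightarrow> (\<forall>\<sigma>\<in>X. card \<sigma> \<le> k) \<and> (\<exists>\<sigma>\<in>X. card \<sigma> = k) \<and> bd2 (all_faces X k) = (\<lambda>\<tau>. 0) \<and>
    (\<forall>c. cycle2 X k c \<longrightarrow> c = (\<lambda>\<sigma>. 0) \<or> c = all_faces X k) \<and>
    (\<forall>i<k. \<forall>c. cycle2 X i c \<longrightarrow> (\<exists>b. bchain X (Suc i) b \<and> bd2 b = c))"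

text \<open>Write a cycle as \<open>d + v * l\<close> with \<open>d\<close> and \<open>l\<close>
  avoiding \<open>v\<close>. Closedness forces the boundary of \<open>d\<close> to be
  \<open>l\<close>, and then the cone \<open>v * d\<close> has boundary
  \<open>d + v * l\<close>.\<close>

lemma acyclic2_cone_point:
  assumes "v \<in> V" "X \<subseteq> Pow V" and cone: "\<And>\<sigma>. \<sigma> \<in> X \<Longrightarrow> insert v \<sigma> \<in> X"
  shows "acyclic2 X"
  unfolding acyclic2_def
proof (intro allI impI)
  fix k c assume c: "cycle2 X k c"
  let ?d = "deletion_chain v c" and ?l = "link_chain v c"
  have l: "bd2 ?l = (\<lambda>\<tau>. 0)" using c assms(1) by (simp add: bd2_link_chain) (simp add: link_chain_def)
  have dv: "\<forall>\<tau>. v \<in> \<tau> \<longrightarrow> ?d \<tau> = 0" and lv: "\<forall>\<tau>. v \<in> \<tau> \<longrightarrow> ?l \<tau> = 0"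
    by (simp_all add: deletion_chain_def link_chain_def)
  have "bd2 c = (\<lambda>\<tau>. bd2 ?d \<tau> + bd2 (cone v ?l) \<tau>)"
    by (subst chain_decomposition[of c v]) (rule bd2_add)
  also have "bd2 (cone v ?l) = ?l" using bd2_cone[OF assms(1) lv] l by (simp add: cone_def)
  finally have "bd2 ?d \<tau> + ?l \<tau> = 0" for \<tau> using c by metis
  then have "bd2 ?d \<tau> = ?l \<tau>" for \<tau> by (metis add.assoc add.right_neutral bit_self_add)
  then have "bd2 ?d = ?l" by (rule ext)
  then have "bd2 (cone v ?d) = c" using bd2_cone[OF assms(1) dv] chain_decomposition[of c v] by simp
  moreover have "bchain X (Suc k) (cone v ?d)"
    unfolding bchain_def
  proof (intro allI impI)
    fix \<sigma> assume "cone v ?d \<sigma> \<noteq> 0"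
    then have v: "v \<in> \<sigma>" and "?d (\<sigma> - {v}) \<noteq> 0" by (auto simp: cone_def split: if_splits)
    then have "c (\<sigma> - {v}) \<noteq> 0" by (auto simp: deletion_chain_def)
    then have s: "\<sigma> - {v} \<in> X" "card (\<sigma> - {v}) = k" using c by (auto simp: bchain_def)
    have "finite (\<sigma> - {v})" using finite_subset[OF _ finite_V] s(1) assms(2) by (metis PowD subsetD)
    then have "card \<sigma> = Suc k" using v s(2) card_Suc_Diff1[of \<sigma> v] by simp
    moreover have "insert v (\<sigma> - {v}) = \<sigma>" using v by auto
    then have "\<sigma> \<in> X" using cone[OF s(1)] by simp
    ultimately show "\<sigma> \<in> X \<and> card \<sigma> = Suc k" by simp
  qed
  ultimately show "\<exists>b. bchain X (Suc k) b \<and> bd2 b = c" by blast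
qed

end

text \<open>A vertex \<open>v\<close> of the complex \<open>X\<close> splits it into the deletion \<open>D\<close> and the cone over the
  link \<open>K\<close>, glued along \<open>K\<close>.\<close>

locale vertex_splitting = finite_vertex_set V for V :: "'v set" +
  fixes X D K :: "'v set set" and v :: 'v
  assumes X_V: "X \<subseteq> Pow V" and v_V: "v \<in> V"
    and D: "\<And>\<sigma>. \<sigma> \<in> D \<longleftrightarrow> \<sigma> \<in> X \<and> v \<notin> \<sigma>"
    and K: "\<And>\<tau>. \<tau> \<in> K \<longleftrightarrow> v \<notin> \<tau> \<and> insert v \<tau> \<in> X"
    and K_D: "K \<subseteq> D"
begin

lemma finite_face: "\<sigma> \<in> X \<Longrightarrow> finite \<sigma>"
  using X_V finite_V by (metis PowD finite_subset subsetD)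

lemma bchain_cone: "bchain K k b \<Longrightarrow> bchain X (Suc k) (cone v b)"
  unfolding bchain_def
proof (intro allI impI)
  fix \<sigma> assume b: "\<forall>\<sigma>. b \<sigma> \<noteq> 0 \<longrightarrow> \<sigma> \<in> K \<and> card \<sigma> = k" and "cone v b \<sigma> \<noteq> 0"
  then have v: "v \<in> \<sigma>" and "b (\<sigma> - {v}) \<noteq> 0" by (auto simp: cone_def split: if_splits)
  then have k: "\<sigma> - {v} \<in> K" "card (\<sigma> - {v}) = k" using b by auto
  have "insert v (\<sigma> - {v}) = \<sigma>" using v by auto
  then have "\<sigma> \<in> X" using k(1) K by metis
  then have "finite \<sigma>" by (rule finite_face)
  then show "\<sigma> \<in> X \<and> card \<sigma> = Suc k" using v k(2) card_Suc_Diff1[of \<sigma> v] \<open>\<sigma> \<in> X\<close> by simp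
qed

lemma bchain_D_X: "bchain D k c \<Longrightarrow> bchain X k c"
  using D unfolding bchain_def by blast

lemma bchain_K_D: "bchain K k c \<Longrightarrow> bchain D k c"
  using K_D unfolding bchain_def by blast

lemma bchain_deletion: "bchain X k c \<Longrightarrow> bchain D k (deletion_chain v c)"
  using D unfolding bchain_def deletion_chain_def by auto

lemma bchain_link:
  assumes "bchain X k c"
  shows "bchain K (k - 1) (link_chain v c)"
  unfolding bchain_def
proof (intro allI impI)
  fix \<tau> assume "link_chain v c \<tau> \<noteq> 0"
  then have v: "v \<notin> \<tau>" "c (insert v \<tau>) \<noteq> 0" by (auto simp: link_chain_def split: if_splits)
  then have x: "insert v \<tau> \<in> X" "card (insert v \<tau>) = k" using assms by (auto simp: bchain_def)
  then have "finite (insert v \<tau>)" by (intro finite_face)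
  then show "\<tau> \<in> K \<and> card \<tau> = k - 1" using v x K by auto
qed

text \<open>\<open>bchain_link\<close> lowers the degree by truncated subtraction and is
  uninformative in degree zero; there no face contains \<open>v\<close>.\<close>

lemma link_chain_zero_degree:
  assumes "bchain X 0 c"
  shows "link_chain v c = (\<lambda>\<tau>. 0)"
proof
  fix \<tau>
  show "link_chain v c \<tau> = 0"
  proof (rule ccontr)
    assume "link_chain v c \<tau> \<noteq> 0"
    then have "c (insert v \<tau>) \<noteq> 0" by (auto simp: link_chain_def split: if_splits)
    then have "insert v \<tau> \<in> X" "card (insert v \<tau>) = 0" using assms by (auto simp: bchain_def)
    moreover have "finite (insert v \<tau>)" using calculation(1) by (rule finite_face)
    ultimately show False by simp
  qed
qed

lemma bd2_link_chain_cycle: "bd2 c = (\<lambda>\<tau>. 0) \<Longrightarrow> bd2 (link_chain v c) = (\<lambda>\<tau>. 0)"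
  using bd2_link_chain[OF v_V, of c] by (simp add: link_chain_def)

text \<open>A Mayer-Vietoris step on chains: adding the boundary of the cone over \<open>b\<close>
  pushes the cycle \<open>c\<close> into \<open>D\<close>, where it bounds some \<open>a\<close>; so
  \<open>c\<close> is the boundary of \<open>a\<close> plus that cone.\<close>

lemma boundary_if_link_boundary:
  assumes D_acyc: "acyclic2 D" and c: "cycle2 X k c" and b: "bchain K k b" "bd2 b = link_chain v c"
  shows "\<exists>b'. bchain X (Suc k) b' \<and> bd2 b' = c"
proof -
  have bv: "\<forall>\<tau>. v \<in> \<tau> \<longrightarrow> b \<tau> = 0" using b(1) K unfolding bchain_def by metis
  have cone_b: "bd2 (cone v b) = (\<lambda>\<tau>. b \<tau> + cone v (link_chain v c) \<tau>)"
    using bd2_cone[OF v_V bv] b(2) by simp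
  let ?d = "\<lambda>\<sigma>. deletion_chain v c \<sigma> + b \<sigma>"
  have eq: "?d = (\<lambda>\<sigma>. c \<sigma> + bd2 (cone v b) \<sigma>)"
  proof
    fix \<sigma>
    have "c \<sigma> = deletion_chain v c \<sigma> + cone v (link_chain v c) \<sigma>"
      using fun_cong[OF chain_decomposition[of c v], of \<sigma>] .
    then show "?d \<sigma> = c \<sigma> + bd2 (cone v b) \<sigma>"
      unfolding cone_b by (simp add: add.assoc add.left_commute[of _ "b \<sigma>"])
  qed
  have "bd2 ?d = (\<lambda>\<tau>. 0)" unfolding eq bd2_add using c by (simp add: bd2_bd2)
  moreover have "bchain D k ?d" using c b(1) bchain_deletion bchain_K_D bchain_add by blast
  ultimately obtain a where a: "bchain D (Suc k) a" "bd2 a = ?d" using D_acyc by (auto simp: acyclic2_def)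
  have "bd2 (\<lambda>\<sigma>. a \<sigma> + cone v b \<sigma>) = c"
    unfolding bd2_add a(2) eq by (simp add: add.assoc)
  moreover have "bchain X (Suc k) (\<lambda>\<sigma>. a \<sigma> + cone v b \<sigma>)"
    using a(1) b(1) bchain_D_X bchain_cone bchain_add by blast
  ultimately show ?thesis by blast
qed

lemma boundary_if_zero_degree:
  assumes "acyclic2 D" "cycle2 X 0 c"
  shows "\<exists>b'. bchain X (Suc 0) b' \<and> bd2 b' = c"
  by (rule boundary_if_link_boundary[OF assms, of "\<lambda>\<sigma>. 0"]) (use assms in \<open>simp_all add: link_chain_zero_degree\<close>)

lemma acyclic2_X:
  assumes "acyclic2 D" "acyclic2 K"
  shows "acyclic2 X"
  unfolding acyclic2_def
proof (intro allI impI)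
  fix k c assume c: "cycle2 X k c"
  show "\<exists>b. bchain X (Suc k) b \<and> bd2 b = c"
  proof (cases k)
    case 0
    then show ?thesis using boundary_if_zero_degree[OF assms(1)] c by simp
  next
    case (Suc m)
    have "cycle2 K m (link_chain v c)" using bchain_link[of k c] bd2_link_chain_cycle c Suc by auto
    then obtain b where "bchain K k b" "bd2 b = link_chain v c"
      using assms(2) Suc by (auto simp: acyclic2_def)
    then show ?thesis using boundary_if_link_boundary[OF assms(1) c] by blast
  qed
qed

text \<open>The model is a ball \<open>D\<close> whose boundary sphere \<open>K\<close> is closed
  off by a cone. A top cycle is determined by its link at \<open>v\<close>, a cycle of
  \<open>K\<close>, which leaves two possibilities; in lower degrees the link bounds in
  \<open>K\<close> and the previous step applies. \<open>fund\<close> makes the sum of all facets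
  closed.\<close>

lemma sphere2_X:
  assumes D_acyc: "acyclic2 D" and sph: "sphere2 k K" and Dk: "\<And>\<sigma>. \<sigma> \<in> D \<Longrightarrow> card \<sigma> \<le> Suc k"
    and fund: "bd2 (all_faces D (Suc k)) = all_faces K k"
  shows "sphere2 (Suc k) X"
proof -
  have K_sph: "\<And>\<tau>. \<tau> \<in> K \<Longrightarrow> card \<tau> \<le> k" "\<exists>\<tau>\<in>K. card \<tau> = k" "bd2 (all_faces K k) = (\<lambda>\<tau>. 0)"
    "\<And>c. cycle2 K k c \<Longrightarrow> c = (\<lambda>\<sigma>. 0) \<or> c = all_faces K k"
    "\<And>i c. i < k \<Longrightarrow> cycle2 K i c \<Longrightarrow> \<exists>b. bchain K (Suc i) b \<and> bd2 b = c"
    using sph unfolding sphere2_def by blast+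
  note fin = finite_face
  have card_v: "card \<sigma> = Suc (card (\<sigma> - {v}))" "\<sigma> - {v} \<in> K" if "\<sigma> \<in> X" "v \<in> \<sigma>" for \<sigma>
  proof -
    show "card \<sigma> = Suc (card (\<sigma> - {v}))" using fin[OF that(1)] that(2) card_Suc_Diff1 by metis
    have "insert v (\<sigma> - {v}) = \<sigma>" using that by auto
    then show "\<sigma> - {v} \<in> K" using K that by simp
  qed
  have dimX: "card \<sigma> \<le> Suc k" if "\<sigma> \<in> X" for \<sigma>
  proof (cases "v \<in> \<sigma>")
    case True
    then show ?thesis using card_v[OF that True] K_sph(1)[of "\<sigma> - {v}"] by simp
  next
    case False
    then show ?thesis using Dk D that by simp
  qed
  have topX: "\<exists>\<sigma>\<in>X. card \<sigma> = Suc k"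
  proof -
    obtain \<tau> where "\<tau> \<in> K" "card \<tau> = k" using K_sph(2) by blast
    then have "insert v \<tau> \<in> X" "v \<notin> \<tau>" using K by auto
    moreover have "finite \<tau>" using fin[OF \<open>insert v \<tau> \<in> X\<close>] by simp
    ultimately show ?thesis using \<open>card \<tau> = k\<close> by (intro bexI[of _ "insert v \<tau>"]) auto
  qed
  have all: "all_faces X (Suc k) = (\<lambda>\<sigma>. all_faces D (Suc k) \<sigma> + cone v (all_faces K k) \<sigma>)"
  proof
    fix \<sigma>
    show "all_faces X (Suc k) \<sigma> = all_faces D (Suc k) \<sigma> + cone v (all_faces K k) \<sigma>"
    proof (cases "v \<in> \<sigma>")
      case True
      have "insert v (\<sigma> - {v}) = \<sigma>" using True by auto
      then have "\<sigma> - {v} \<in> K \<longleftrightarrow> \<sigma> \<in> X" using K by simp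
      then have "\<sigma> - {v} \<in> K \<and> card (\<sigma> - {v}) = k \<longleftrightarrow> \<sigma> \<in> X \<and> card \<sigma> = Suc k"
        using card_v(1)[OF _ True] by (cases "\<sigma> \<in> X") simp_all
      then show ?thesis using True D by (simp add: all_faces_def cone_def)
    qed (use D in \<open>auto simp: all_faces_def cone_def\<close>)
  qed
  have Kv: "\<forall>\<tau>. v \<in> \<tau> \<longrightarrow> all_faces K k \<tau> = 0" using K by (simp add: all_faces_def)
  have "bd2 (all_faces X (Suc k)) = (\<lambda>\<tau>. 0)"
    unfolding all bd2_add fund bd2_cone[OF v_V Kv] K_sph(3) by (simp add: cone_def)
  moreover have "c = (\<lambda>\<sigma>. 0) \<or> c = all_faces X (Suc k)" if c: "cycle2 X (Suc k) c" for c
  proof -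
    \<comment> \<open>With zero link the cycle lies in \<open>D\<close>, where it bounds a chain of
      a degree in which \<open>D\<close> has no faces.\<close>
    have zero: "c = (\<lambda>\<sigma>. 0)" if c: "cycle2 X (Suc k) c" and l: "link_chain v c = (\<lambda>\<tau>. 0)" for c
    proof -
      have "c = deletion_chain v c" using chain_decomposition[of c v] l by (simp add: cone_def)
      then have "cycle2 D (Suc k) c" using c bchain_deletion by metis
      then obtain b where b: "bchain D (Suc (Suc k)) b" "bd2 b = c" using D_acyc by (auto simp: acyclic2_def)
      have "b \<sigma> = 0" for \<sigma> using b(1) Dk[of \<sigma>] unfolding bchain_def by (metis Suc_n_not_le_n)
      then have "b = (\<lambda>\<sigma>. 0)" by (rule ext)
      then show ?thesis using b(2) by simp
    qed
    have "cycle2 K k (link_chain v c)" using bchain_link[of "Suc k" c] bd2_link_chain_cycle c by auto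
    then consider "link_chain v c = (\<lambda>\<tau>. 0)" | "link_chain v c = all_faces K k" using K_sph(4) by blast
    then show ?thesis
    proof cases
      case 1
      then show ?thesis using zero c by blast
    next
      case 2
      \<comment> \<open>Both summands have the same link at \<open>v\<close>, so their sum falls
        under \<open>zero\<close>.\<close>
      let ?d = "\<lambda>\<sigma>. c \<sigma> + all_faces X (Suc k) \<sigma>"
      have lall: "link_chain v (all_faces X (Suc k)) = all_faces K k"
      proof
        fix \<tau>
        show "link_chain v (all_faces X (Suc k)) \<tau> = all_faces K k \<tau>"
        proof (cases "v \<notin> \<tau> \<and> insert v \<tau> \<in> X")
          case True
          then have "finite \<tau>" using fin[of "insert v \<tau>"] by simp
          then show ?thesis using True K by (simp add: link_chain_def all_faces_def)
        qed (use K in \<open>auto simp: link_chain_def all_faces_def\<close>)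
      qed
      have "link_chain v ?d \<tau> = link_chain v c \<tau> + link_chain v (all_faces X (Suc k)) \<tau>" for \<tau>
        by (simp add: link_chain_def)
      then have "link_chain v ?d = (\<lambda>\<tau>. 0)" using 2 lall by (intro ext) simp
      moreover have "cycle2 X (Suc k) ?d"
        using c \<open>bd2 (all_faces X (Suc k)) = (\<lambda>\<tau>. 0)\<close> by (simp add: bchain_add bchain_all_faces bd2_add)
      ultimately have d0: "?d = (\<lambda>\<sigma>. 0)" using zero by blast
      have "c \<sigma> = all_faces X (Suc k) \<sigma>" for \<sigma>
        using fun_cong[OF d0, of \<sigma>] by (metis add.assoc add.right_neutral bit_self_add)
      then show ?thesis by blast
    qed
  qed
  moreover have "\<exists>b. bchain X (Suc i) b \<and> bd2 b = c" if i: "i < Suc k" and c: "cycle2 X i c" for i c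
  proof (cases i)
    case 0
    then show ?thesis using boundary_if_zero_degree[OF D_acyc] c by simp
  next
    case (Suc m)
    have "cycle2 K m (link_chain v c)" using bchain_link[of i c] bd2_link_chain_cycle c Suc by auto
    then obtain b where "bchain K i b" "bd2 b = link_chain v c"
      using K_sph(5)[of m] Suc i by auto
    then show ?thesis using boundary_if_link_boundary[OF D_acyc c] by blast
  qed
  ultimately show ?thesis unfolding sphere2_def using dimX topX by blast
qed

end

section \<open>Spheres mod 2: removing a facet, inserting a vertex\<close>

context finite_vertex_set
begin

text \<open>A chain bounding a cycle may use \<open>\<tau>\<close> only in top degree, where the
  fundamental cycle can be added to it. In the top degree itself the only nonzero cycle contains
  \<open>\<tau>\<close> and is gone.\<close>

lemma acyclic2_remove_facet:
  assumes sph: "sphere2 k X" and \<tau>: "\<tau> \<in> X" "card \<tau> = k"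
  shows "acyclic2 (X - {\<tau>})"
  unfolding acyclic2_def
proof (intro allI impI)
  fix i c assume c: "cycle2 (X - {\<tau>}) i c"
  have S: "\<And>\<sigma>. \<sigma> \<in> X \<Longrightarrow> card \<sigma> \<le> k" "bd2 (all_faces X k) = (\<lambda>\<tau>. 0)"
    "\<And>c. cycle2 X k c \<Longrightarrow> c = (\<lambda>\<sigma>. 0) \<or> c = all_faces X k"
    "\<And>i c. i < k \<Longrightarrow> cycle2 X i c \<Longrightarrow> \<exists>b. bchain X (Suc i) b \<and> bd2 b = c"
    using sph unfolding sphere2_def by blast+
  have cX: "cycle2 X i c" and c\<tau>: "c \<tau> = 0" using c unfolding bchain_def by blast+
  have remove: "bchain (X - {\<tau>}) j b" if "bchain X j b" "b \<tau> = 0" for j b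
    using that unfolding bchain_def by blast
  consider "i < k" | "i = k" | "k < i" by linarith
  then show "\<exists>b. bchain (X - {\<tau>}) (Suc i) b \<and> bd2 b = c"
  proof cases
    case 1
    then obtain b where b: "bchain X (Suc i) b" "bd2 b = c" using S(4) cX by blast
    show ?thesis
    proof (cases "b \<tau> = 0")
      case True
      then show ?thesis using remove b by blast
    next
      case False
      then have "Suc i = k" using b(1) \<tau> by (auto simp: bchain_def)
      have "b \<tau> = 1" using False by (cases "b \<tau>") simp_all
      \<comment> \<open>Both summands have coefficient one at \<open>\<tau>\<close>, so the sum
        avoids \<open>\<tau>\<close> and its boundary is unchanged.\<close>
      let ?b = "\<lambda>\<sigma>. b \<sigma> + all_faces X k \<sigma>"
      have "?b \<tau> = 0" using \<open>b \<tau> = 1\<close> \<tau> by (simp add: all_faces_def)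
      moreover have "bchain X (Suc i) ?b"
        using bchain_add[OF b(1)] bchain_all_faces[of X k] \<open>Suc i = k\<close> by simp
      moreover have "bd2 ?b = c" unfolding bd2_add S(2) b(2) by simp
      ultimately show ?thesis using remove by blast
    qed
  next
    case 2
    have "all_faces X k \<tau> \<noteq> 0" using \<tau> by (simp add: all_faces_def)
    then have "c = (\<lambda>\<sigma>. 0)" using S(3)[of c] cX 2 c\<tau> by metis
    then show ?thesis by (intro exI[of _ "\<lambda>\<sigma>. 0"]) simp
  next
    case 3
    have "c \<sigma> = 0" for \<sigma> using cX S(1)[of \<sigma>] 3 unfolding bchain_def by (metis leD)
    then have "c = (\<lambda>\<sigma>. 0)" by (rule ext)
    then show ?thesis by (intro exI[of _ "\<lambda>\<sigma>. 0"]) simp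
  qed
qed

lemma acyclic2_Pow:
  assumes "\<tau> \<subseteq> V" "\<tau> \<noteq> {}"
  shows "acyclic2 (Pow \<tau>)"
proof -
  obtain w where "w \<in> \<tau>" using assms by auto
  then show ?thesis using assms by (intro acyclic2_cone_point[of w]) auto
qed

lemma bd2_simplex:
  assumes "\<tau> \<subseteq> V"
  shows "bd2 (\<lambda>\<sigma>. of_bool (\<sigma> = \<tau>)) = all_faces (boundary_complex \<tau>) (card \<tau> - 1)"
proof
  fix \<sigma>
  have fin: "finite \<tau>" using finite_subset[OF assms finite_V] .
  show "bd2 (\<lambda>\<sigma>. of_bool (\<sigma> = \<tau>)) \<sigma> = all_faces (boundary_complex \<tau>) (card \<tau> - 1) \<sigma>"
  proof (cases "\<exists>x\<in>\<tau>. \<sigma> = \<tau> - {x}")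
    case True
    then obtain x where x: "x \<in> \<tau>" "\<sigma> = \<tau> - {x}" by blast
    have "bd2 (\<lambda>\<sigma>. of_bool (\<sigma> = \<tau>)) \<sigma> = (\<Sum>u\<in>V - \<sigma>. if u = x then 1 else 0)"
      unfolding bd2_def
    proof (intro sum.cong refl)
      fix u assume "u \<in> V - \<sigma>"
      then have "insert u \<sigma> = \<tau> \<longleftrightarrow> u = x" using x by blast
      then show "of_bool (insert u \<sigma> = \<tau>) = (if u = x then 1 else 0)" by simp
    qed
    also have "\<dots> = 1" using x assms finite_V by (subst sum.delta) auto
    finally show ?thesis using x fin by (auto simp: all_faces_def boundary_complex_def)
  next
    case False
    have "of_bool (insert u \<sigma> = \<tau>) = (0 :: bit)" if "u \<in> V - \<sigma>" for u
    proof -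
      have "insert u \<sigma> \<noteq> \<tau>" using False that by auto
      then show ?thesis by simp
    qed
    then have "bd2 (\<lambda>\<sigma>. of_bool (\<sigma> = \<tau>)) \<sigma> = 0" unfolding bd2_def by (intro sum.neutral) blast
    moreover have "\<not> (\<sigma> \<subset> \<tau> \<and> card \<sigma> = card \<tau> - 1)"
    proof
      assume s: "\<sigma> \<subset> \<tau> \<and> card \<sigma> = card \<tau> - 1"
      then have "card \<tau> > 0" using fin by (auto simp: card_gt_0_iff)
      moreover have "\<sigma> \<subseteq> \<tau>" "finite \<sigma>" using s finite_subset[OF _ fin] by auto
      ultimately have "card (\<tau> - \<sigma>) = 1" using s by (simp add: card_Diff_subset)
      then obtain x where "\<tau> - \<sigma> = {x}" by (auto simp: card_1_singleton_iff)
      then have "x \<in> \<tau>" "\<sigma> = \<tau> - {x}" using s by auto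
      then show False using False by blast
    qed
    ultimately show ?thesis by (simp add: all_faces_def boundary_complex_def)
  qed
qed

text \<open>The sphere of dimension -1, which occurs as the link of a facet and starts the induction
  for boundaries of simplices.\<close>

lemma sphere2_empty_face: "sphere2 0 {{}}"
proof -
  have "c = (\<lambda>\<sigma>. 0) \<or> c = all_faces {{}} 0" if c: "bchain {{}} 0 c" for c
  proof -
    have z: "c \<sigma> = 0" if "\<sigma> \<noteq> {}" for \<sigma> using c that unfolding bchain_def by blast
    show ?thesis
    proof (cases "c {}")
      case zero
      then have "c \<sigma> = 0" for \<sigma> using z by (cases "\<sigma> = {}") simp_all
      then show ?thesis by blast
    next
      case one
      then have "c \<sigma> = all_faces {{}} 0 \<sigma>" for \<sigma>
        using z by (cases "\<sigma> = {}") (simp_all add: all_faces_def)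
      then show ?thesis by blast
    qed
  qed
  then show ?thesis by (auto simp: sphere2_def bd2_def all_faces_def)
qed

text \<open>At a vertex \<open>v\<close> the boundary of the simplex on
  \<open>insert v \<tau>\<close> splits into the full simplex on \<open>\<tau>\<close>, which is
  acyclic, and the cone over the boundary of \<open>\<tau>\<close>.\<close>

lemma sphere2_boundary_complex:
  assumes "\<tau> \<subseteq> V" "\<tau> \<noteq> {}"
  shows "sphere2 (card \<tau> - 1) (boundary_complex \<tau>)"
proof -
  have "finite \<tau>" using finite_subset[OF assms(1) finite_V] .
  then show ?thesis using assms(2,1)
  proof (induction rule: finite_ne_induct)
    case (singleton x)
    have "boundary_complex {x} = {{}}" by (auto simp: boundary_complex_def)
    then show ?case using sphere2_empty_face by simp
  next
    case (insert v \<tau>)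
    have c: "card \<tau> \<ge> 1" using insert by (simp add: Suc_leI card_gt_0_iff)
    have D: "\<sigma> \<in> Pow \<tau> \<longleftrightarrow> \<sigma> \<in> boundary_complex (insert v \<tau>) \<and> v \<notin> \<sigma>" for \<sigma>
      using insert.hyps by (auto simp: boundary_complex_def)
    interpret vertex_splitting V "boundary_complex (insert v \<tau>)" "Pow \<tau>" "boundary_complex \<tau>" v
    proof
      show "\<sigma> \<in> boundary_complex \<tau> \<longleftrightarrow> v \<notin> \<sigma> \<and> insert v \<sigma> \<in> boundary_complex (insert v \<tau>)" for \<sigma>
        using insert.hyps by (auto simp: boundary_complex_def)
    qed (use insert D in \<open>auto simp: boundary_complex_def\<close>)
    have "\<sigma> \<subseteq> \<tau> \<and> card \<sigma> = card \<tau> \<longleftrightarrow> \<sigma> = \<tau>" for \<sigma>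
      using card_subset_eq[OF insert.hyps(1)] by blast
    then have "all_faces (Pow \<tau>) (card \<tau>) = (\<lambda>\<sigma>. of_bool (\<sigma> = \<tau>))"
      by (simp add: all_faces_def)
    then have "bd2 (all_faces (Pow \<tau>) (Suc (card \<tau> - 1))) = all_faces (boundary_complex \<tau>) (card \<tau> - 1)"
      using bd2_simplex[of \<tau>] insert.prems c by simp
    then have "sphere2 (Suc (card \<tau> - 1)) (boundary_complex (insert v \<tau>))"
      using insert c acyclic2_Pow[of \<tau>] by (intro sphere2_X) (auto simp: card_mono)
    then show ?case using insert.hyps c by simp
  qed
qed

text \<open>At the new vertex the result splits into \<open>X\<close> without the facet
  \<open>\<tau>\<close>, which is acyclic, and the cone over the boundary of
  \<open>\<tau>\<close>.\<close>

lemma sphere2_bistellar_move: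
  assumes sph: "sphere2 k X" and X: "X \<subseteq> Pow V" "\<And>\<sigma> \<sigma>'. \<sigma> \<in> X \<Longrightarrow> \<sigma>' \<subseteq> \<sigma> \<Longrightarrow> \<sigma>' \<in> X"
    and \<tau>: "\<tau> \<in> X" "card \<tau> = k" "k \<ge> 1" and v: "v \<in> V" "v \<notin> \<Union>X"
  shows "sphere2 k (bistellar_move X \<tau> {v})"
proof -
  have v\<tau>: "v \<notin> \<tau>" "\<tau> \<subseteq> V" using \<tau> v X by auto
  have vX: "\<sigma> \<in> X \<Longrightarrow> v \<notin> \<sigma>" for \<sigma> using v by auto
  have D: "\<sigma> \<in> X - {\<tau>} \<longleftrightarrow> \<sigma> \<in> bistellar_move X \<tau> {v} \<and> v \<notin> \<sigma>" for \<sigma>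
    unfolding in_bistellar_move_new_vertex using vX[of \<sigma>] X(2)[OF \<tau>(1), of \<sigma>] by blast
  have K: "\<sigma> \<in> boundary_complex \<tau> \<longleftrightarrow> v \<notin> \<sigma> \<and> insert v \<sigma> \<in> bistellar_move X \<tau> {v}" for \<sigma>
  proof -
    have "insert v \<sigma> \<notin> X" using vX by blast
    moreover have "\<kappa> \<subset> \<tau> \<Longrightarrow> v \<notin> \<sigma> \<Longrightarrow> insert v \<sigma> = insert v \<kappa> \<longleftrightarrow> \<sigma> = \<kappa>" "\<kappa> \<subset> \<tau> \<Longrightarrow> insert v \<sigma> \<noteq> \<kappa>" for \<kappa>
      using v\<tau>(1) by auto
    ultimately show ?thesis
      unfolding in_bistellar_move_new_vertex boundary_complex_def using v\<tau>(1) by blast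
  qed
  interpret vertex_splitting V "bistellar_move X \<tau> {v}" "X - {\<tau>}" "boundary_complex \<tau>" v
  proof
    show "bistellar_move X \<tau> {v} \<subseteq> Pow V"
    proof
      fix \<sigma> assume "\<sigma> \<in> bistellar_move X \<tau> {v}"
      then have "\<sigma> \<in> X \<or> \<sigma> \<subseteq> insert v \<tau>" unfolding in_bistellar_move_new_vertex by blast
      then show "\<sigma> \<in> Pow V" using X(1) v\<tau>(2) v(1) by auto
    qed
    show "boundary_complex \<tau> \<subseteq> X - {\<tau>}" using X(2)[OF \<tau>(1)] by (auto simp: boundary_complex_def)
  qed (use D K v in auto)
  have sk: "\<And>\<sigma>. \<sigma> \<in> X \<Longrightarrow> card \<sigma> \<le> k" "bd2 (all_faces X k) = (\<lambda>\<sigma>. 0)"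
    using sph unfolding sphere2_def by blast+
  \<comment> \<open>The sum of all facets of \<open>X\<close> is closed, so after dropping
    \<open>\<tau>\<close> its boundary is that of \<open>\<tau>\<close> alone.\<close>
  have "all_faces (X - {\<tau>}) k = (\<lambda>\<sigma>. all_faces X k \<sigma> + of_bool (\<sigma> = \<tau>))"
    using \<tau> by (auto simp: all_faces_def)
  then have "bd2 (all_faces (X - {\<tau>}) k) = all_faces (boundary_complex \<tau>) (k - 1)"
    using bd2_simplex[OF v\<tau>(2)] \<tau>(2) by (simp add: bd2_add sk(2))
  moreover have "\<tau> \<noteq> {}" using \<tau>(2,3) by auto
  then have "sphere2 (k - 1) (boundary_complex \<tau>)"
    using sphere2_boundary_complex[OF v\<tau>(2)] \<tau>(2) by simp
  ultimately have "sphere2 (Suc (k - 1)) (bistellar_move X \<tau> {v})"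
    using acyclic2_remove_facet[OF sph \<tau>(1,2)] sk(1) \<tau>(3) by (intro sphere2_X) auto
  then show ?thesis using \<tau>(3) by simp
qed

end

section \<open>Links in stacked balls and their boundaries\<close>

lemma in_link: "\<tau> \<in> link X \<sigma> \<longleftrightarrow> \<tau> \<inter> \<sigma> = {} \<and> \<tau> \<union> \<sigma> \<in> X"
  by (simp add: link_def)

lemma link_Pow: "\<sigma> \<subseteq> f \<Longrightarrow> link (Pow f) \<sigma> = Pow (f - \<sigma>)"
  unfolding set_eq_iff in_link by blast

lemma link_boundary_complex: "\<sigma> \<subset> f \<Longrightarrow> link (boundary_complex f) \<sigma> = boundary_complex (f - \<sigma>)"
  unfolding set_eq_iff in_link boundary_complex_def by blast

context finite_vertex_set
begin

text \<open>The link of \<open>\<sigma>\<close> in the \<open>n\<close>-dimensional \<open>Y\<close>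
  has facets with \<open>n + 1 - card \<sigma>\<close> vertices, in the boundary one fewer. The
  empty face is included, so the homology of \<open>Y\<close> and of \<open>X\<close> themselves is
  covered.\<close>

abbreviation good_links :: "nat \<Rightarrow> 'v set set \<Rightarrow> 'v set set \<Rightarrow> bool" where
  "good_links n Y X \<equiv>
    (\<forall>\<sigma>\<in>Y. if \<sigma> \<in> X then acyclic2 (link Y \<sigma>) else sphere2 (n + 1 - card \<sigma>) (link Y \<sigma>)) \<and>
    (\<forall>\<sigma>\<in>X. sphere2 (n - card \<sigma>) (link X \<sigma>))"

lemma acyclic2_link_simplex: "f \<subseteq> V \<Longrightarrow> \<sigma> \<subset> f \<Longrightarrow> acyclic2 (link (Pow f) \<sigma>)"
  using acyclic2_Pow[of "f - \<sigma>"] by (subst link_Pow) auto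

lemma sphere2_link_simplex: "sphere2 0 (link (Pow f) f)"
  using sphere2_empty_face by (simp add: link_Pow)

lemma sphere2_link_boundary_complex:
  assumes "f \<subseteq> V" "card f = n + 1" "\<sigma> \<subset> f"
  shows "sphere2 (n - card \<sigma>) (link (boundary_complex f) \<sigma>)"
proof -
  have "finite f" using finite_subset[OF assms(1) finite_V] .
  then have "finite \<sigma>" using assms(3) finite_subset by blast
  then have "card (f - \<sigma>) = n + 1 - card \<sigma>"
    using assms by (simp add: card_Diff_subset psubset_imp_subset)
  moreover have "sphere2 (card (f - \<sigma>) - 1) (boundary_complex (f - \<sigma>))"
    using assms by (intro sphere2_boundary_complex) auto
  ultimately show ?thesis using link_boundary_complex[OF assms(3)] by simp
qed

lemma good_links_single:
  assumes "f \<subseteq> V" "card f = n + 1"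
  shows "good_links n (generated_complex {f}) (stacked_boundary n {f})"
proof -
  have fin: "finite f" using finite_subset[OF assms(1) finite_V] .
  have gen: "generated_complex {f} = Pow f" by (auto simp: generated_complex_def)
  have bdf: "stacked_boundary n {f} = boundary_complex f" by (rule in_stacked_boundary_single[OF fin assms(2)])
  show ?thesis
    unfolding gen bdf
  proof (intro conjI ballI)
    fix \<sigma> assume "\<sigma> \<in> Pow f"
    show "if \<sigma> \<in> boundary_complex f then acyclic2 (link (Pow f) \<sigma>) else sphere2 (n + 1 - card \<sigma>) (link (Pow f) \<sigma>)"
    proof (cases "\<sigma> = f")
      case True
      then show ?thesis using sphere2_link_simplex assms(2) by (simp add: boundary_complex_def)
    next
      case False
      then have "\<sigma> \<subset> f" using \<open>\<sigma> \<in> Pow f\<close> by auto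
      then show ?thesis using acyclic2_link_simplex[OF assms(1)] by (simp add: boundary_complex_def)
    qed
  next
    fix \<sigma> assume "\<sigma> \<in> boundary_complex f"
    then show "sphere2 (n - card \<sigma>) (link (boundary_complex f) \<sigma>)"
      using sphere2_link_boundary_complex[OF assms] by (simp add: boundary_complex_def)
  qed
qed

text \<open>There are four kinds of faces. Links of faces through \<open>v\<close> are those in the
  new simplex, and links of faces avoiding \<open>v\<close> and not contained in
  \<open>\<rho>\<close> do not change. The ridge \<open>\<rho>\<close> becomes interior with a link
  of two points. For a proper face of \<open>\<rho>\<close> the link in the ball gains a cone and
  the link in the boundary undergoes a move.\<close>

lemma good_links_glue:
  assumes st: "stacked_facets n \<F>" and \<rho>: "\<rho> \<in> boundary_ridges n \<F>" and v: "v \<notin> \<Union>\<F>"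
    and V: "v \<in> V" "\<Union>\<F> \<subseteq> V"
    and IH: "good_links n (generated_complex \<F>) (stacked_boundary n \<F>)"
  shows "good_links n (generated_complex (insert (insert v \<rho>) \<F>))
    (stacked_boundary n (insert (insert v \<rho>) \<F>))"
proof -
  define Y where "Y = generated_complex \<F>"
  define X where "X = stacked_boundary n \<F>"
  define f where "f = insert v \<rho>"
  define Y' where "Y' = generated_complex (insert f \<F>)"
  define X' where "X' = stacked_boundary n (insert f \<F>)"
  have X'_eq: "X' = bistellar_move X \<rho> {v}"
    unfolding X'_def X_def f_def by (rule stacked_boundary_glue[OF st \<rho> v])
  have X': "\<sigma> \<in> X' \<longleftrightarrow> \<sigma> \<in> X \<and> \<not> \<sigma> \<subseteq> \<rho> \<or> (\<exists>\<tau>. \<tau> \<subset> \<rho> \<and> (\<sigma> = \<tau> \<or> \<sigma> = insert v \<tau>))" for \<sigma>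
    unfolding X'_eq by (rule in_bistellar_move_new_vertex)
  have Y': "\<sigma> \<in> Y' \<longleftrightarrow> \<sigma> \<in> Y \<or> \<sigma> \<subseteq> f" for \<sigma>
    by (auto simp: Y'_def Y_def generated_complex_def)
  have XY: "X \<subseteq> Y" unfolding X_def Y_def by (rule stacked_boundary_subset)
  have downY: "\<tau> \<in> Y" if "\<sigma> \<in> Y" "\<tau> \<subseteq> \<sigma>" for \<sigma> \<tau> using that by (auto simp: Y_def generated_complex_def)
  have downX: "\<tau> \<in> X" if "\<sigma> \<in> X" "\<tau> \<subseteq> \<sigma>" for \<sigma> \<tau> using that by (auto simp: X_def generated_complex_def)
  have YV: "\<sigma> \<subseteq> V" if "\<sigma> \<in> Y" for \<sigma> using that V(2) by (auto simp: Y_def generated_complex_def)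
  have vY: "v \<notin> \<sigma>" if "\<sigma> \<in> Y" for \<sigma> using that v by (auto simp: Y_def generated_complex_def)
  have \<rho>X: "\<rho> \<in> X" unfolding X_def generated_complex_def using \<rho> by blast
  have \<rho>Y: "\<rho> \<in> Y" using \<rho>X XY by blast
  have v\<rho>: "v \<notin> \<rho>" using vY[OF \<rho>Y] .
  have \<rho>V: "\<rho> \<subseteq> V" using YV[OF \<rho>Y] .
  have c\<rho>: "card \<rho> = n" and fin\<rho>: "finite \<rho>" using \<rho> by (simp_all add: boundary_ridges_def)
  have fV: "f \<subseteq> V" and cf: "card f = n + 1" using \<rho>V V(1) c\<rho> fin\<rho> v\<rho> by (simp_all add: f_def)
  have IHY: "if \<sigma> \<in> X then acyclic2 (link Y \<sigma>) else sphere2 (n + 1 - card \<sigma>) (link Y \<sigma>)" if "\<sigma> \<in> Y" for \<sigma>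
    using IH that unfolding X_def Y_def by blast
  have IHX: "sphere2 (n - card \<sigma>) (link X \<sigma>)" if "\<sigma> \<in> X" for \<sigma>
    using IH that unfolding X_def Y_def by blast
  have X'_in: "\<sigma> \<in> X' \<longleftrightarrow> \<sigma> \<subset> f" if "v \<in> \<sigma>" "\<sigma> \<subseteq> f" for \<sigma>
  proof
    assume "\<sigma> \<in> X'"
    moreover have "\<sigma> \<notin> X" using vY XY that(1) by blast
    ultimately obtain \<tau> where "\<tau> \<subset> \<rho>" "\<sigma> = \<tau> \<or> \<sigma> = insert v \<tau>" unfolding X' by blast
    then show "\<sigma> \<subset> f" using that v\<rho> by (auto simp: f_def)
  next
    assume "\<sigma> \<subset> f"
    then have "\<sigma> - {v} \<subset> \<rho>" "\<sigma> = insert v (\<sigma> - {v})" using that v\<rho> by (auto simp: f_def)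
    then show "\<sigma> \<in> X'" unfolding X' by blast
  qed
  have far: "link Y' \<sigma> = link Y \<sigma>" "link X' \<sigma> = link X \<sigma>" "\<sigma> \<in> X' \<longleftrightarrow> \<sigma> \<in> X"
    if "v \<notin> \<sigma>" "\<not> \<sigma> \<subseteq> \<rho>" for \<sigma>
  proof -
    have n: "\<not> \<tau> \<union> \<sigma> \<subseteq> f" for \<tau> using that by (auto simp: f_def)
    show "link Y' \<sigma> = link Y \<sigma>" unfolding set_eq_iff in_link Y' using n by blast
    have x: "\<tau> \<union> \<sigma> \<in> X' \<longleftrightarrow> \<tau> \<union> \<sigma> \<in> X" for \<tau>
    proof -
      have "\<not> \<tau> \<union> \<sigma> \<subseteq> \<rho>" using that(2) by blast
      moreover have "\<not> (\<exists>\<kappa>. \<kappa> \<subset> \<rho> \<and> (\<tau> \<union> \<sigma> = \<kappa> \<or> \<tau> \<union> \<sigma> = insert v \<kappa>))"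
        using n[of \<tau>] by (auto simp: f_def)
      ultimately show ?thesis unfolding X' by blast
    qed
    show "link X' \<sigma> = link X \<sigma>" unfolding set_eq_iff in_link x by blast
    show "\<sigma> \<in> X' \<longleftrightarrow> \<sigma> \<in> X" using x[of "{}"] by simp
  qed
  have near: "link Y' \<sigma> = link (Pow f) \<sigma>" if "v \<in> \<sigma>" "\<sigma> \<subseteq> f" for \<sigma>
  proof -
    have "\<tau> \<union> \<sigma> \<notin> Y" for \<tau> using vY that(1) by blast
    then show ?thesis unfolding set_eq_iff in_link Y' by blast
  qed
  have nearX: "link X' \<sigma> = link (boundary_complex f) \<sigma>" if "v \<in> \<sigma>" "\<sigma> \<subseteq> f" for \<sigma>
  proof -
    have "\<tau> \<union> \<sigma> \<in> X' \<longleftrightarrow> \<tau> \<union> \<sigma> \<in> boundary_complex f" for \<tau>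
    proof (cases "\<tau> \<union> \<sigma> \<subseteq> f")
      case True
      then show ?thesis using X'_in[of "\<tau> \<union> \<sigma>"] that by (simp add: boundary_complex_def)
    next
      case False
      have "\<tau> \<union> \<sigma> \<notin> X" using vY XY that(1) by blast
      then have "\<tau> \<union> \<sigma> \<notin> X'" unfolding X' using False by (auto simp: f_def)
      then show ?thesis using False by (auto simp: boundary_complex_def)
    qed
    then show ?thesis unfolding set_eq_iff in_link by blast
  qed
  have inner: "acyclic2 (link Y' \<sigma>)" "\<sigma> \<in> X'" "sphere2 (n - card \<sigma>) (link X' \<sigma>)" if \<sigma>: "\<sigma> \<subset> \<rho>" for \<sigma>
  proof -
    have \<sigma>X: "\<sigma> \<in> X" using downX[OF \<rho>X] \<sigma> by blast
    then have \<sigma>Y: "\<sigma> \<in> Y" using XY by blast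
    have v\<sigma>: "v \<notin> \<sigma>" using \<sigma> v\<rho> by blast
    show "\<sigma> \<in> X'" unfolding X' using \<sigma> by blast
    \<comment> \<open>The link of \<open>v\<close> inside \<open>link Y' \<sigma>\<close> is the
      full simplex on \<open>\<rho> - \<sigma>\<close>, nonempty since \<open>\<sigma>\<close> is
      proper; gluing a cone along it preserves acyclicity.\<close>
    interpret vertex_splitting V "link Y' \<sigma>" "link Y \<sigma>" "Pow (\<rho> - \<sigma>)" v
    proof
      show "link Y' \<sigma> \<subseteq> Pow V"
      proof
        fix \<tau> assume "\<tau> \<in> link Y' \<sigma>"
        then have "\<tau> \<union> \<sigma> \<in> Y \<or> \<tau> \<union> \<sigma> \<subseteq> f" by (simp add: in_link Y')
        then show "\<tau> \<in> Pow V" using YV fV by blast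
      qed
      show "\<tau> \<in> link Y \<sigma> \<longleftrightarrow> \<tau> \<in> link Y' \<sigma> \<and> v \<notin> \<tau>" for \<tau>
      proof -
        have "\<tau> \<union> \<sigma> \<in> Y" if "\<tau> \<union> \<sigma> \<subseteq> f" "v \<notin> \<tau>"
          using downY[OF \<rho>Y, of "\<tau> \<union> \<sigma>"] that v\<sigma> by (auto simp: f_def)
        then show ?thesis unfolding in_link Y' using vY by blast
      qed
      show "\<tau> \<in> Pow (\<rho> - \<sigma>) \<longleftrightarrow> v \<notin> \<tau> \<and> insert v \<tau> \<in> link Y' \<sigma>" for \<tau>
      proof -
        have "insert v \<tau> \<union> \<sigma> \<notin> Y" using vY by blast
        moreover have "insert v \<tau> \<union> \<sigma> \<subseteq> f \<and> v \<notin> \<tau> \<longleftrightarrow> \<tau> \<subseteq> \<rho> \<and> v \<notin> \<tau>"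
          using \<sigma> v\<sigma> by (auto simp: f_def)
        moreover have "insert v \<tau> \<inter> \<sigma> = {} \<longleftrightarrow> \<tau> \<inter> \<sigma> = {}" using v\<sigma> by blast
        ultimately show ?thesis unfolding in_link Y' using v\<rho> by blast
      qed
      show "Pow (\<rho> - \<sigma>) \<subseteq> link Y \<sigma>"
      proof
        fix \<tau> assume "\<tau> \<in> Pow (\<rho> - \<sigma>)"
        then have "\<tau> \<union> \<sigma> \<subseteq> \<rho>" "\<tau> \<inter> \<sigma> = {}" using \<sigma> by auto
        then show "\<tau> \<in> link Y \<sigma>" using downY[OF \<rho>Y] by (simp add: in_link)
      qed
    qed (rule V(1))
    show "acyclic2 (link Y' \<sigma>)"
    proof (rule acyclic2_X)
      show "acyclic2 (link Y \<sigma>)" using IHY[OF \<sigma>Y] \<sigma>X by simp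
      show "acyclic2 (Pow (\<rho> - \<sigma>))" using \<sigma> \<rho>V by (intro acyclic2_Pow) auto
    qed
    \<comment> \<open>Taking the link of a proper face of \<open>\<rho>\<close> commutes with the
      move: \<open>\<rho>\<close> shrinks to \<open>\<rho> - \<sigma>\<close> and the new vertex
      stays.\<close>
    have "link X' \<sigma> = bistellar_move (link X \<sigma>) (\<rho> - \<sigma>) {v}"
    proof (rule Set.set_eqI)
      fix \<tau>
      show "\<tau> \<in> link X' \<sigma> \<longleftrightarrow> \<tau> \<in> bistellar_move (link X \<sigma>) (\<rho> - \<sigma>) {v}"
      proof (cases "\<tau> \<inter> \<sigma> = {}")
        case True
        have 1: "\<tau> \<union> \<sigma> \<subseteq> \<rho> \<longleftrightarrow> \<tau> \<subseteq> \<rho> - \<sigma>" using True \<sigma> by blast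
        have 2: "(\<exists>\<kappa>. \<kappa> \<subset> \<rho> \<and> (\<tau> \<union> \<sigma> = \<kappa> \<or> \<tau> \<union> \<sigma> = insert v \<kappa>)) \<longleftrightarrow>
          (\<exists>\<kappa>. \<kappa> \<subset> \<rho> - \<sigma> \<and> (\<tau> = \<kappa> \<or> \<tau> = insert v \<kappa>))"
        proof
          assume "\<exists>\<kappa>. \<kappa> \<subset> \<rho> \<and> (\<tau> \<union> \<sigma> = \<kappa> \<or> \<tau> \<union> \<sigma> = insert v \<kappa>)"
          then obtain \<kappa> where \<kappa>: "\<kappa> \<subset> \<rho>" "\<tau> \<union> \<sigma> = \<kappa> \<or> \<tau> \<union> \<sigma> = insert v \<kappa>" by blast
          have "\<sigma> \<subseteq> insert v \<kappa>" using \<kappa>(2) by auto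
          then have "\<sigma> \<subseteq> \<kappa>" using v\<sigma> by auto
          then have "\<kappa> - \<sigma> \<subset> \<rho> - \<sigma>" using \<kappa>(1) by blast
          moreover have "\<tau> = (\<tau> \<union> \<sigma>) - \<sigma>" using True by auto
          then have "\<tau> = \<kappa> - \<sigma> \<or> \<tau> = insert v (\<kappa> - \<sigma>)" using \<kappa>(2) v\<sigma> by (metis insert_Diff_if)
          ultimately show "\<exists>\<kappa>. \<kappa> \<subset> \<rho> - \<sigma> \<and> (\<tau> = \<kappa> \<or> \<tau> = insert v \<kappa>)" by blast
        next
          assume "\<exists>\<kappa>. \<kappa> \<subset> \<rho> - \<sigma> \<and> (\<tau> = \<kappa> \<or> \<tau> = insert v \<kappa>)"
          then obtain \<kappa> where \<kappa>: "\<kappa> \<subset> \<rho> - \<sigma>" "\<tau> = \<kappa> \<or> \<tau> = insert v \<kappa>" by blast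
          have "\<kappa> \<union> \<sigma> \<subset> \<rho>" using \<kappa>(1) \<sigma> by blast
          moreover have "\<tau> \<union> \<sigma> = \<kappa> \<union> \<sigma> \<or> \<tau> \<union> \<sigma> = insert v (\<kappa> \<union> \<sigma>)" using \<kappa>(2) by auto
          ultimately show "\<exists>\<kappa>. \<kappa> \<subset> \<rho> \<and> (\<tau> \<union> \<sigma> = \<kappa> \<or> \<tau> \<union> \<sigma> = insert v \<kappa>)" by blast
        qed
        show ?thesis unfolding in_bistellar_move_new_vertex in_link X' 1 2 using True by simp
      next
        case False
        have "\<not> (\<exists>\<kappa>. \<kappa> \<subset> \<rho> - \<sigma> \<and> (\<tau> = \<kappa> \<or> \<tau> = insert v \<kappa>))" using False v\<sigma> by auto
        then show ?thesis unfolding in_bistellar_move_new_vertex in_link using False by simp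
      qed
    qed
    moreover have "sphere2 (n - card \<sigma>) (bistellar_move (link X \<sigma>) (\<rho> - \<sigma>) {v})"
    proof (rule sphere2_bistellar_move[OF IHX[OF \<sigma>X]])
      have "finite \<sigma>" using finite_subset[OF _ fin\<rho>] \<sigma> by blast
      have "card \<sigma> < card \<rho>" by (rule psubset_card_mono[OF fin\<rho> \<sigma>])
      then show "1 \<le> n - card \<sigma>" using c\<rho> by simp
      show "card (\<rho> - \<sigma>) = n - card \<sigma>"
        using card_Diff_subset[OF \<open>finite \<sigma>\<close>, of \<rho>] \<sigma> c\<rho> by (simp add: psubset_imp_subset)
      show "link X \<sigma> \<subseteq> Pow V"
      proof
        fix \<tau> assume "\<tau> \<in> link X \<sigma>"
        then have "\<tau> \<union> \<sigma> \<in> Y" using XY by (auto simp: in_link)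
        then show "\<tau> \<in> Pow V" using YV by blast
      qed
      have "(\<rho> - \<sigma>) \<union> \<sigma> = \<rho>" using \<sigma> by blast
      then show "\<rho> - \<sigma> \<in> link X \<sigma>" using \<rho>X by (auto simp: in_link)
      show "v \<notin> \<Union>(link X \<sigma>)"
      proof
        assume "v \<in> \<Union>(link X \<sigma>)"
        then obtain \<tau> where "v \<in> \<tau>" "\<tau> \<union> \<sigma> \<in> X" by (auto simp: in_link)
        then show False using vY XY by blast
      qed
      show "\<tau>' \<in> link X \<sigma>" if "\<tau> \<in> link X \<sigma>" "\<tau>' \<subseteq> \<tau>" for \<tau> \<tau>'
      proof -
        have "\<tau> \<inter> \<sigma> = {}" "\<tau> \<union> \<sigma> \<in> X" "\<tau>' \<union> \<sigma> \<subseteq> \<tau> \<union> \<sigma>" using that by (auto simp: in_link)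
        then show ?thesis using downX that(2) by (auto simp: in_link)
      qed
    qed (rule V(1))
    ultimately show "sphere2 (n - card \<sigma>) (link X' \<sigma>)" by simp
  qed
  have ridge: "\<rho> \<notin> X'" "sphere2 (n + 1 - card \<rho>) (link Y' \<rho>)"
  proof -
    show "\<rho> \<notin> X'" unfolding X' using v\<rho> by blast
    obtain g where g: "g \<in> \<F>" "\<rho> \<subseteq> g" and uniq: "\<And>h. h \<in> \<F> \<Longrightarrow> \<rho> \<subseteq> h \<Longrightarrow> h = g"
      using \<rho> by (auto simp: boundary_ridges_def)
    have "finite g" "card g = n + 1" using stacked_facets_basic(3)[OF st g(1)] by auto
    then have "card (g - \<rho>) = 1" using g(2) c\<rho> fin\<rho> by (simp add: card_Diff_subset)
    then obtain w where w: "g - \<rho> = {w}" by (auto simp: card_1_singleton_iff)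
    have gw: "g = insert w \<rho>" "w \<notin> \<rho>" using w g(2) by auto
    have wv: "w \<noteq> v" "w \<in> V" using v g(1) V(2) gw by auto
    have "\<tau> \<in> link Y' \<rho> \<longleftrightarrow> \<tau> \<subset> {v, w}" for \<tau>
    proof -
      have "\<tau> \<union> \<rho> \<in> Y \<longleftrightarrow> \<tau> \<union> \<rho> \<subseteq> g"
        unfolding Y_def generated_complex_def using uniq g(1) by blast
      then have "\<tau> \<in> link Y' \<rho> \<longleftrightarrow> \<tau> \<inter> \<rho> = {} \<and> (\<tau> \<subseteq> insert w \<rho> \<or> \<tau> \<subseteq> insert v \<rho>)"
        unfolding in_link Y' f_def gw(1) by blast
      also have "\<dots> \<longleftrightarrow> \<tau> \<subseteq> {w} \<or> \<tau> \<subseteq> {v}" using gw(2) v\<rho> by blast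
      also have "\<dots> \<longleftrightarrow> \<tau> \<subset> {v, w}" using wv(1) by auto
      finally show ?thesis .
    qed
    then have "link Y' \<rho> = boundary_complex {v, w}" by (auto simp: boundary_complex_def)
    moreover have "sphere2 (card {v, w} - 1) (boundary_complex {v, w})"
      using wv V(1) by (intro sphere2_boundary_complex) auto
    ultimately show "sphere2 (n + 1 - card \<rho>) (link Y' \<rho>)" using wv(1) c\<rho> by (simp add: insert_commute)
  qed
  have "good_links n Y' X'"
  proof (intro conjI ballI)
    fix \<sigma> assume \<sigma>: "\<sigma> \<in> Y'"
    consider "v \<in> \<sigma>" | "v \<notin> \<sigma>" "\<not> \<sigma> \<subseteq> \<rho>" | "\<sigma> = \<rho>" | "\<sigma> \<subset> \<rho>" by blast
    then show "if \<sigma> \<in> X' then acyclic2 (link Y' \<sigma>) else sphere2 (n + 1 - card \<sigma>) (link Y' \<sigma>)"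
    proof cases
      case 1
      then have sf: "\<sigma> \<subseteq> f" using \<sigma> Y' vY by blast
      show ?thesis
      proof (cases "\<sigma> = f")
        case True
        then have "\<sigma> \<notin> X'" using X'_in[OF 1 sf] by blast
        then show ?thesis using near[OF 1 sf] sphere2_link_simplex[of f] True cf by simp
      next
        case False
        then have "\<sigma> \<subset> f" using sf by blast
        then show ?thesis using X'_in[OF 1 sf] near[OF 1 sf] acyclic2_link_simplex[OF fV] by simp
      qed
    next
      case 2
      have "\<sigma> \<in> Y" using \<sigma> 2 unfolding Y' f_def by blast
      then show ?thesis using IHY[of \<sigma>] unfolding far(1,3)[OF 2] by blast
    next
      case 3
      then show ?thesis using ridge by simp
    next
      case 4
      then show ?thesis using inner(1,2)[OF 4] by simp
    qed
  next
    fix \<sigma> assume \<sigma>: "\<sigma> \<in> X'"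
    consider "v \<in> \<sigma>" | "v \<notin> \<sigma>" "\<not> \<sigma> \<subseteq> \<rho>" | "\<sigma> = \<rho>" | "\<sigma> \<subset> \<rho>" by blast
    then show "sphere2 (n - card \<sigma>) (link X' \<sigma>)"
    proof cases
      case 1
      have "\<sigma> \<notin> X" using 1 vY XY by blast
      then have sf: "\<sigma> \<subseteq> f" using \<sigma> unfolding X' f_def by blast
      then have "\<sigma> \<subset> f" using X'_in[OF 1 sf] \<sigma> by blast
      then show ?thesis using nearX[OF 1 sf] sphere2_link_boundary_complex[OF fV cf] by simp
    next
      case 2
      then show ?thesis using IHX far[OF 2] \<sigma> by simp
    next
      case 3
      then show ?thesis using ridge \<sigma> by simp
    next
      case 4
      then show ?thesis using inner(3) by simp
    qed
  qed
  then show ?thesis unfolding Y'_def X'_def f_def .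
qed

lemma stacked_good_links:
  assumes "stacked_facets n \<F>" "\<Union>\<F> \<subseteq> V"
  shows "good_links n (generated_complex \<F>) (stacked_boundary n \<F>)"
  using assms
proof induction
  case (single f)
  then show ?case by (intro good_links_single) auto
next
  case (glue \<F> \<rho> v)
  then show ?case by (intro good_links_glue) auto
qed

end

section \<open>Transfer to fields inside the universe\<close>

text \<open>Any two distinct elements of the universe can serve as zero \<open>z\<close> and one
  \<open>u\<close>.\<close>

definition two_element_field :: "'f \<Rightarrow> 'f \<Rightarrow> 'f ring" where
  "two_element_field z u =
     \<lparr>carrier = {z, u}, mult = (\<lambda>x y. if x = u \<and> y = u then u else z), one = u,
      zero = z, add = (\<lambda>x y. if x = y then z else u)\<rparr>"

lemma field_two_element_field:
  assumes "z \<noteq> u"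
  shows "field (two_element_field z u)" (is "field ?F")
proof -
  have [simp]: "carrier ?F = {z, u}" "\<one>\<^bsub>?F\<^esub> = u" "\<zero>\<^bsub>?F\<^esub> = z"
    "x \<oplus>\<^bsub>?F\<^esub> y = (if x = y then z else u)" "x \<otimes>\<^bsub>?F\<^esub> y = (if x = u \<and> y = u then u else z)" for x y
    by (simp_all add: two_element_field_def)
  have "abelian_group ?F"
    by (rule abelian_groupI) (use assms in \<open>auto split: if_splits\<close>)
  moreover have "comm_monoid ?F"
    by (rule comm_monoidI) (use assms in \<open>auto split: if_splits\<close>)
  ultimately have cr: "cring ?F"
    by (rule cringI) (use assms in \<open>auto split: if_splits\<close>)
  show ?thesis
    by (rule cring.cring_fieldI[OF cr]) (use assms in \<open>auto simp: Units_def\<close>)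
qed

section \<open>From chains mod 2 to chains over the field\<close>

locale bit_coefficients = finite_vertex_set V for V :: "'v::linorder set" +
  fixes z u :: 'f
  assumes zu: "z \<noteq> u"
begin

abbreviation F2 :: "'f ring" where "F2 \<equiv> two_element_field z u"

sublocale F2: coefficient_field F2
  unfolding coefficient_field_def by (rule field_two_element_field[OF zu])

definition embed :: "bit \<Rightarrow> 'f" where "embed x = (if x = 0 then z else u)"

lemma F2_simps: "carrier F2 = {z, u}" "\<one>\<^bsub>F2\<^esub> = u" "\<zero>\<^bsub>F2\<^esub> = z"
  "x \<oplus>\<^bsub>F2\<^esub> y = (if x = y then z else u)" "x \<otimes>\<^bsub>F2\<^esub> y = (if x = u \<and> y = u then u else z)"
  by (simp_all add: two_element_field_def)

lemma embed_simps: "embed x \<in> carrier F2" "embed 0 = \<zero>\<^bsub>F2\<^esub>" "embed 1 = \<one>\<^bsub>F2\<^esub>"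
  "embed (x + y) = embed x \<oplus>\<^bsub>F2\<^esub> embed y" "embed x = embed y \<longleftrightarrow> x = y"
  using zu by (cases x; cases y; simp add: embed_def F2_simps)+

lemma embed_surj: "x \<in> carrier F2 \<Longrightarrow> \<exists>y. x = embed y"
  by (metis embed_simps(2,3) F2_simps(1-3) insertE singletonD)

lemma finsum_embed: "finite A \<Longrightarrow> finsum F2 (\<lambda>v. embed (c v)) A = embed (sum c A)"
proof (induction A rule: finite_induct)
  case (insert a A)
  then have "finsum F2 (\<lambda>v. embed (c v)) (insert a A) = embed (c a) \<oplus>\<^bsub>F2\<^esub> finsum F2 (\<lambda>v. embed (c v)) A"
    by (intro F2.finsum_insert) (auto simp: embed_simps(1))
  then show ?case using insert by (simp add: embed_simps(4))
qed (simp add: embed_simps(2))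

lemma incidence_sign_one: "F2.incidence_sign v \<tau> = \<one>\<^bsub>F2\<^esub>"
proof -
  have "\<one>\<^bsub>F2\<^esub> \<oplus>\<^bsub>F2\<^esub> \<one>\<^bsub>F2\<^esub> = \<zero>\<^bsub>F2\<^esub>" by (simp add: F2_simps)
  then have "\<ominus>\<^bsub>F2\<^esub> \<one>\<^bsub>F2\<^esub> = \<one>\<^bsub>F2\<^esub>" using F2.minus_equality F2.one_closed by metis
  then show ?thesis using F2.incidence_sign_cases by metis
qed

lemma boundary_map_embed:
  assumes "X \<subseteq> Pow V" "bchain X k c"
  shows "boundary_map F2 X (\<lambda>\<sigma>. embed (c \<sigma>)) = (\<lambda>\<tau>. embed (bd2 c \<tau>))"
proof
  fix \<tau>
  have "F2.chain_on X (\<lambda>\<sigma>. embed (c \<sigma>))"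
    using assms(2) unfolding F2.chain_on_def bchain_def by (metis embed_simps(1,2))
  moreover have "\<Union>X \<subseteq> V" using assms(1) by blast
  ultimately have "boundary_map F2 X (\<lambda>\<sigma>. embed (c \<sigma>)) \<tau> =
    finsum F2 (\<lambda>v. F2.incidence_sign v \<tau> \<otimes>\<^bsub>F2\<^esub> embed (c (insert v \<tau>))) (V - \<tau>)"
    using F2.boundary_map_eq finite_V by blast
  also have "\<dots> = finsum F2 (\<lambda>v. embed (c (insert v \<tau>))) (V - \<tau>)"
    by (simp only: incidence_sign_one F2.l_one[OF embed_simps(1)])
  also have "\<dots> = embed (bd2 c \<tau>)" unfolding bd2_def by (rule finsum_embed) (simp add: finite_V)
  finally show "boundary_map F2 X (\<lambda>\<sigma>. embed (c \<sigma>)) \<tau> = embed (bd2 c \<tau>)" .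
qed

lemma chain_space_embed:
  fixes c :: "'v set \<Rightarrow> bit"
  shows "(\<lambda>\<sigma>. embed (c \<sigma>)) \<in> carrier (chain_space F2 X (int k - 1)) \<longleftrightarrow> bchain X k c"
proof -
  have fd: "face_dim \<sigma> = int k - 1 \<longleftrightarrow> card \<sigma> = k" for \<sigma> :: "'v set" by (simp add: face_dim_def)
  have e0: "embed x = \<zero>\<^bsub>F2\<^esub> \<longleftrightarrow> x = 0" for x using embed_simps(2,5) by metis
  show ?thesis
    unfolding F2.carrier_chain_space bchain_def fd e0 using embed_simps(1) by blast
qed

lemma cycle_embed:
  assumes X: "X \<subseteq> Pow V" and c': "F2.is_cycle X (int k - 1) c'"
  obtains c where "c' = (\<lambda>\<sigma>. embed (c \<sigma>))" "cycle2 X k c"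
proof -
  have "\<forall>\<sigma>. \<exists>x. c' \<sigma> = embed x" using c' embed_surj by (auto simp: F2.carrier_chain_space)
  then obtain c where "\<forall>\<sigma>. c' \<sigma> = embed (c \<sigma>)" by metis
  then have c: "c' = (\<lambda>\<sigma>. embed (c \<sigma>))" by (intro ext) simp
  have ch: "bchain X k c" using conjunct1[OF c'] chain_space_embed[of c X k] by (simp only: c)
  have "embed (bd2 c \<tau>) = embed 0" for \<tau>
    using conjunct2[OF c'] boundary_map_embed[OF X ch] c by (metis embed_simps(2))
  then have "bd2 c = (\<lambda>\<tau>. 0)" using embed_simps(5) by (intro ext) blast
  then show ?thesis using that c ch by blast
qed

lemma zero_space_embed:
  assumes X: "X \<subseteq> Pow V"
    and ex: "\<And>k c. j = int k - 1 \<Longrightarrow> cycle2 X k c \<Longrightarrow> \<exists>b. bchain X (Suc k) b \<and> bd2 b = c"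
  shows "zero_space (reduced_homology F2 X j)"
proof (rule F2.zero_spaceI)
  show "finite (\<Union>X)" using finite_subset[OF _ finite_V] X by blast
  fix c' assume c': "F2.is_cycle X j c'"
  show "\<exists>b\<in>carrier (chain_space F2 X (j + 1)). boundary_map F2 X b = c'"
  proof (cases "j < - 1")
    \<comment> \<open>No face has dimension below -1, so zero is the only chain in these degrees,
      which correspond to no vertex count.\<close>
    case True
    then have "face_dim \<sigma> \<noteq> j" for \<sigma> :: "'v set" by (simp add: face_dim_def)
    then have "c' \<sigma> = \<zero>\<^bsub>F2\<^esub>" for \<sigma> using c' by (simp add: F2.carrier_chain_space)
    then have "c' = (\<lambda>\<sigma>. \<zero>\<^bsub>F2\<^esub>)" by (rule ext)
    then show ?thesis
      using F2.boundary_map_zero by (intro bexI[of _ "\<lambda>\<sigma>. \<zero>\<^bsub>F2\<^esub>"]) (auto simp: F2.carrier_chain_space)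
  next
    case False
    then obtain k where "j + 1 = int k" using zero_le_imp_eq_int[of "j + 1"] by auto
    then have k: "j = int k - 1" by simp
    obtain c where c: "c' = (\<lambda>\<sigma>. embed (c \<sigma>))" "cycle2 X k c"
      using cycle_embed[OF X] c' k by blast
    obtain b where b: "bchain X (Suc k) b" "bd2 b = c" using ex[OF k c(2)] by blast
    have "(\<lambda>\<sigma>. embed (b \<sigma>)) \<in> carrier (chain_space F2 X (j + 1))"
      using chain_space_embed[of b X "Suc k"] b(1) k by simp
    moreover have "boundary_map F2 X (\<lambda>\<sigma>. embed (b \<sigma>)) = c'"
      using boundary_map_embed[OF X b(1)] b(2) c(1) by simp
    ultimately show ?thesis by (intro bexI)
  qed
qed

lemma acyclic2_acyclic_complex:
  assumes "X \<subseteq> Pow V" "acyclic2 X"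
  shows "acyclic_complex F2 X"
  unfolding acyclic_complex_def
  using assms zero_space_embed by (simp add: acyclic2_def)

lemma sphere2_sphere_homology:
  assumes X: "X \<subseteq> Pow V" and sph: "sphere2 k X"
  shows "sphere_homology F2 (int k - 1) X"
  unfolding sphere_homology_def
proof (intro conjI allI impI)
  have S: "\<And>\<sigma>. \<sigma> \<in> X \<Longrightarrow> card \<sigma> \<le> k" "\<exists>\<sigma>\<in>X. card \<sigma> = k" "bd2 (all_faces X k) = (\<lambda>\<tau>. 0)"
    "\<And>c. cycle2 X k c \<Longrightarrow> c = (\<lambda>\<sigma>. 0) \<or> c = all_faces X k"
    "\<And>i c. i < k \<Longrightarrow> cycle2 X i c \<Longrightarrow> \<exists>b. bchain X (Suc i) b \<and> bd2 b = c"
    using sph unfolding sphere2_def by blast+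
  obtain \<sigma>0 where \<sigma>0: "\<sigma>0 \<in> X" "card \<sigma>0 = k" using S(2) by blast
  let ?z = "\<lambda>\<sigma>. embed (all_faces X k \<sigma>)"
  show "iso_to_field F2 (reduced_homology F2 X (int k - 1))"
  \<comment> \<open>The sum of all facets generates the top cycles, and any one facet
    \<open>\<sigma>0\<close> reads off the multiple.\<close>
  proof (rule F2.iso_to_field_top[of X "int k - 1" ?z \<sigma>0])
    show "\<forall>\<sigma>\<in>X. face_dim \<sigma> \<noteq> int k - 1 + 1" using S(1) by (fastforce simp: face_dim_def)
    show "F2.is_cycle X (int k - 1) ?z"
      using chain_space_embed[of "all_faces X k" X k] bchain_all_faces[of X k]
        boundary_map_embed[OF X bchain_all_faces, of k] S(3)
      by (simp add: embed_simps(2))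
    show "?z \<sigma>0 = \<one>\<^bsub>F2\<^esub>" using \<sigma>0 by (simp add: all_faces_def embed_simps(3))
    fix c' assume "F2.is_cycle X (int k - 1) c'"
    then obtain c where c: "c' = (\<lambda>\<sigma>. embed (c \<sigma>))" "cycle2 X k c" using cycle_embed[OF X] by blast
    from S(4)[OF c(2)] show "\<exists>t\<in>carrier F2. c' = (\<lambda>\<sigma>. t \<otimes>\<^bsub>F2\<^esub> ?z \<sigma>)"
    proof
      assume "c = (\<lambda>\<sigma>. 0)"
      then have "c' = (\<lambda>\<sigma>. \<zero>\<^bsub>F2\<^esub> \<otimes>\<^bsub>F2\<^esub> ?z \<sigma>)"
        using c(1) F2.l_null[OF embed_simps(1)] by (simp add: embed_simps(2))
      then show ?thesis using F2.zero_closed by (rule bexI)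
    next
      assume "c = all_faces X k"
      then have "c' = (\<lambda>\<sigma>. \<one>\<^bsub>F2\<^esub> \<otimes>\<^bsub>F2\<^esub> ?z \<sigma>)" using c(1) F2.l_one[OF embed_simps(1)] by simp
      then show ?thesis using F2.one_closed by (rule bexI)
    qed
  qed
  fix j assume j: "j \<noteq> int k - 1"
  show "zero_space (reduced_homology F2 X j)"
  proof (rule zero_space_embed[OF X])
    fix i c assume ji: "j = int i - 1" and c: "cycle2 X i c"
    show "\<exists>b. bchain X (Suc i) b \<and> bd2 b = c"
    proof (cases "i < k")
      case True
      then show ?thesis using S(5) c by blast
    next
      case False
      then have "k < i" using j ji by simp
      then have "c \<sigma> = 0" for \<sigma> using c S(1)[of \<sigma>] unfolding bchain_def by (metis leD)
      then have "c = (\<lambda>\<sigma>. 0)" by (rule ext)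
      then show ?thesis by (intro exI[of _ "\<lambda>\<sigma>. 0"]) simp
    qed
  qed
qed

end

text \<open>A trivial homology group has one element, a field at least two. This keeps interior
  faces out of the homological boundary.\<close>

lemma (in coefficient_field) sphere_homology_not_acyclic:
  assumes "sphere_homology R m X"
  shows "\<not> acyclic_complex R X"
proof
  let ?H = "reduced_homology R X m"
  assume "acyclic_complex R X"
  then have "carrier ?H = {\<zero>\<^bsub>?H\<^esub>}" by (simp add: acyclic_complex_def zero_space_def)
  moreover obtain h where "h \<in> iso (add_monoid ?H) (add_monoid R)"
    using assms by (auto simp: sphere_homology_def iso_to_field_def)
  then have "h ` carrier ?H = carrier R" by (simp add: iso_def bij_betw_def)
  ultimately have "carrier R = {h \<zero>\<^bsub>?H\<^esub>}" by simp
  then show False using one_closed zero_closed one_not_zero by (metis singletonD)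
qed

section \<open>Stacked families as stacked homology balls, and the comparison of links\<close>

lemma stacked_homology_of_stacked_facets:
  fixes \<F> :: "'v::linorder set set" and z u :: 'f
  assumes st: "stacked_facets n \<F>" and n: "n \<ge> 1" and zu: "z \<noteq> u"
  defines "K \<equiv> two_element_field z u"
  shows "homology_sphere K (int n - 1) (stacked_boundary n \<F>)"
    and "stacked_homology_ball K 1 (int n) (generated_complex \<F>)"
    and "ball_boundary K (generated_complex \<F>) = stacked_boundary n \<F>"
proof -
  let ?Y = "generated_complex \<F>" and ?X = "stacked_boundary n \<F>"
  note basic = stacked_facets_basic[OF st]
  have "finite (\<Union>\<F>)" using basic(1,3) by blast
  then interpret bit_coefficients "\<Union>\<F>" z u by unfold_locales (use zu in simp_all)
  have links: "good_links n ?Y ?X" by (rule stacked_good_links[OF st order_refl])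
  have Y_V: "link ?Y \<sigma> \<subseteq> Pow (\<Union>\<F>)" for \<sigma>
    unfolding link_def generated_complex_def by blast
  have X_V: "link ?X \<sigma> \<subseteq> Pow (\<Union>\<F>)" for \<sigma>
    using stacked_boundary_subset[of n \<F>] Y_V[of \<sigma>] unfolding link_def by blast
  have card_Y: "card \<sigma> \<le> n + 1" if "\<sigma> \<in> ?Y" for \<sigma>
  proof -
    from that obtain f where "f \<in> \<F>" "\<sigma> \<subseteq> f" by (auto simp: generated_complex_def)
    then show ?thesis using basic(3)[of f] card_mono[of f \<sigma>] by simp
  qed
  have card_X: "card \<sigma> \<le> n" if "\<sigma> \<in> ?X" for \<sigma>
  proof -
    from that obtain f where "f \<in> boundary_ridges n \<F>" "\<sigma> \<subseteq> f" by (auto simp: generated_complex_def)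
    then show ?thesis using card_mono[of f \<sigma>] by (auto simp: boundary_ridges_def)
  qed
  have Y_dim: "complex_of_dim (int n) ?Y"
    using complex_of_dim_generated[OF basic(1,2), of "n + 1"] basic(3) by simp
  have X_dim: "complex_of_dim (int n - 1) ?X"
    by (rule complex_of_dim_generated[OF finite_boundary_ridges[OF st] boundary_ridges_nonempty[OF st n]])
      (simp add: boundary_ridges_def)
  have Y_bd: "acyclic_complex K (link ?Y \<sigma>)" if "\<sigma> \<in> ?Y" "\<sigma> \<in> ?X" for \<sigma>
  proof -
    have "acyclic2 (link ?Y \<sigma>)" using bspec[OF conjunct1[OF links] that(1)] that(2) by simp
    then show ?thesis unfolding K_def by (rule acyclic2_acyclic_complex[OF Y_V])
  qed
  have Y_int: "sphere_homology K (int n - face_dim \<sigma> - 1) (link ?Y \<sigma>)" if "\<sigma> \<in> ?Y" "\<sigma> \<notin> ?X" for \<sigma>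
  proof -
    have "sphere2 (n + 1 - card \<sigma>) (link ?Y \<sigma>)"
      using bspec[OF conjunct1[OF links] that(1)] that(2) by simp
    then have "sphere_homology K (int (n + 1 - card \<sigma>) - 1) (link ?Y \<sigma>)"
      unfolding K_def by (rule sphere2_sphere_homology[OF Y_V])
    moreover have "int (n + 1 - card \<sigma>) - 1 = int n - face_dim \<sigma> - 1"
      using card_Y[OF that(1)] by (simp add: face_dim_def of_nat_diff)
    ultimately show ?thesis by simp
  qed
  show sphere: "homology_sphere K (int n - 1) ?X"
    unfolding homology_sphere_def
  proof (intro conjI ballI X_dim)
    fix \<sigma> assume \<sigma>: "\<sigma> \<in> ?X"
    have "sphere2 (n - card \<sigma>) (link ?X \<sigma>)" using bspec[OF conjunct2[OF links] \<sigma>] .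
    then have "sphere_homology K (int (n - card \<sigma>) - 1) (link ?X \<sigma>)"
      unfolding K_def by (rule sphere2_sphere_homology[OF X_V])
    moreover have "int (n - card \<sigma>) - 1 = int n - 1 - face_dim \<sigma> - 1"
      using card_X[OF \<sigma>] by (simp add: face_dim_def of_nat_diff)
    ultimately show "sphere_homology K (int n - 1 - face_dim \<sigma> - 1) (link ?X \<sigma>)" by simp
  qed
  show bd: "ball_boundary K ?Y = ?X"
  proof (rule Set.set_eqI)
    fix \<sigma>
    have "\<not> acyclic_complex K (link ?Y \<sigma>)" if "\<sigma> \<in> ?Y" "\<sigma> \<notin> ?X"
      using F2.sphere_homology_not_acyclic[of "int n - face_dim \<sigma> - 1" "link ?Y \<sigma>"] Y_int[OF that]
      unfolding K_def by blast
    then show "\<sigma> \<in> ball_boundary K ?Y \<longleftrightarrow> \<sigma> \<in> ?X"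
      using Y_bd stacked_boundary_subset[of n \<F>] unfolding ball_boundary_def by blast
  qed
  have empty: "{} \<in> ?Y" using basic(2) by (auto simp: generated_complex_def)
  then have "{} \<in> ?X" using stacked_small_faces[OF st empty] n by simp
  then have "acyclic_complex K ?Y" using Y_bd[OF empty] by simp
  then have "homology_ball K (int n) ?Y"
    unfolding homology_ball_def bd using Y_dim Y_bd Y_int sphere by blast
  \<comment> \<open>Codimension at least two means \<open>card \<sigma> + 1 \<le> n\<close>, the
    bound of \<open>stacked_small_faces\<close>.\<close>
  moreover have "\<sigma> \<in> ?X" if "\<sigma> \<in> ?Y" "int n - face_dim \<sigma> \<ge> int 1 + 1" for \<sigma>
    using stacked_small_faces[OF st that(1)] that(2) by (simp add: face_dim_def)
  ultimately show "stacked_homology_ball K 1 (int n) ?Y"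
    unfolding stacked_homology_ball_def bd by blast
qed

lemma stellated_iff_stacked_homology_sphere:
  fixes L :: "'a::linorder set set"
  assumes "n \<ge> 1"
  shows "stellated_sphere 1 (int n - 1) L \<longleftrightarrow>
    stacked_homology_sphere TYPE('f::infinite) 1 (int n - 1) L"
proof
  assume "stellated_sphere 1 (int n - 1) L"
  then obtain \<F> where \<F>: "stacked_facets n \<F>" "L = stacked_boundary n \<F>"
    using stellated_imp_stacked assms by blast
  \<comment> \<open>Two distinct elements of the universe carry the two-element field, which serves
    for both the sphere and the ball.\<close>
  obtain z :: 'f where "z \<notin> {}" using arb_element[of "{} :: 'f set"] by simp
  obtain u :: 'f where "u \<notin> {z}" using arb_element[of "{z}"] by blast
  then have zu: "z \<noteq> u" by simp
  note K = stacked_homology_of_stacked_facets[OF \<F>(1) assms zu]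
  have fld: "field (two_element_field z u)" by (rule field_two_element_field[OF zu])
  show "stacked_homology_sphere TYPE('f) 1 (int n - 1) L"
    unfolding stacked_homology_sphere_def
  proof
    show "\<exists>F :: 'f ring. field F \<and> homology_sphere F (int n - 1) L"
      using fld K(1) \<F>(2) by blast
    show "\<exists>(F :: 'f ring) Y. field F \<and> stacked_homology_ball F 1 (int n - 1 + 1) Y \<and> ball_boundary F Y = L"
      using fld K(2,3) \<F>(2)
      by (intro exI[of _ "two_element_field z u"] exI[of _ "generated_complex \<F>"]) simp
  qed
next
  assume "stacked_homology_sphere TYPE('f) 1 (int n - 1) L"
  then obtain F :: "'f ring" and Y where F: "field F" "stacked_homology_ball F 1 (int n) Y"
    "ball_boundary F Y = L"
    by (auto simp: stacked_homology_sphere_def)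
  interpret one_stacked_ball F Y n
    unfolding one_stacked_ball_def one_stacked_ball_axioms_def coefficient_field_def
    using F(1,2) assms by simp
  show "stellated_sphere 1 (int n - 1) L"
    using stacked_imp_stellated[OF stacked_facets_facets assms] bd_eq_stacked_boundary F(3) by simp
qed

text \<open>The two classes differ only in the condition on vertex links, so the equivalence for
  single links is applied with \<open>n = d\<close>.\<close>

theorem corollary2p17:
  fixes d :: nat
  assumes "d \<ge> 1"
  shows "(W_class 1 d :: ('a::{infinite,linorder}) set set set) = K_class TYPE('f::infinite) 1 d"
  unfolding W_class_def K_class_def
  using stellated_iff_stacked_homology_sphere[OF assms, where 'f = 'f and 'a = 'a] by simp

end
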